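(* Let $L>0$, $c>\pi^2/L^2$, $m^2=2c$, and let $\phi_c$ be the $L$-periodic dnoidal wave (defined in the context). Then the orbit $$\Gamma=\{P_{cs}(\phi_c,\phi_c,0,0):\ s\in\mathbb R\}$$ is orbitally unstable in $Y=H^1_{per}([0,2L])\times H^1_{per}([0,2L])\times L^2_{per}([0,2L])$ under the flow of the system $$iu_t+\tfrac12u_{xx}=-v^2u,\qquad v_{tt}-v_{xx}+m^2v=2|u|^2v.$$
   Context: In the system $u$ is complex-valued and $v$ is real-valued, both functions of $(x,t)\in\mathbb R\times\mathbb R$. Elements of $Y$ are triples $(u,v,v_t)$ with $u$ complex-valued and $v,v_t$ real-valued, identified with quadruples of real-valued functions $(u_1,v_1,u_2,v_2)=(\mathrm{Re}\,u,v,\mathrm{Im}\,u,v_t)$; so $(\phi_c,\phi_c,0,0)$ corresponds to the triple $(\phi_c,\phi_c,0)$. Spaces with subscript $per$ on $[0,2L]$ consist of $2L$-periodic functions. Phase action: $P_s(u,v,w)=(e^{is}u,v,w)$; in real coordinates $P_s(u_1,v_1,u_2,v_2)=(u_1\cos s-u_2\sin s,\ v_1,\ u_1\sin s+u_2\cos s,\ v_2)$. Dnoidal wave. $K(k)=\int_0^1\frac{dt}{\sqrt{(1-t^2)(1-k^2t^2)}}$ and $dn(\cdot;k)$ is the Jacobi elliptic dnoidal function. For $c>\pi^2/L^2$, let $k=k(c)\in(0,1)$ be the unique modulus with $c=\frac{2K(k)^2}{L^2}(2-k^2)$, set $\eta=\frac{2K(k)}{L}$ and $$\phi_c(x)=\eta\,dn(\eta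 x;k),$$ a positive function of fundamental period $L$ satisfying $[\phi_c']^2=-\phi_c^4+2c\phi_c^2+2B_{\phi_c}$ for some real constant $B_{\phi_c}$. Orbital stability modulo phase. With $\psi_c=\phi_c$, the orbit $\{P_{sc}(\psi_c,\phi_c,0):s\in\mathbb R\}$ is orbitally stable in $Y$ if for every $\varepsilon>0$ there exists $\delta>0$ such that if $z_0\in Y$ and $\|z_0-(\psi_c,\phi_c,0)\|_Y<\delta$, then the solution $z(t)$ of the system (as a triple $(u,v,v_t)$) with $z(0)=z_0$ exists for all $t$ and $\sup_{t\ge0}\inf_{s\in\mathbb R}\|z(t)-P_s(\psi_c,\phi_c,0)\|_Y<\varepsilon$. Otherwise the orbit is orbitally unstable in $Y$. *)

theory Defs
  imports "HOL-Analysis.Analysis"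
begin

subsection \<open>The dnoidal wave\<close>

definition ellK :: "real \<Rightarrow> real" where
  "ellK k = (LBINT t=0..1. 1 / sqrt ((1 - t\<^sup>2) * (1 - k\<^sup>2 * t\<^sup>2)))"

definition ellF :: "real \<Rightarrow> real \<Rightarrow> real" where
  "ellF k \<phi> = (LBINT \<theta>=0..ereal \<phi>. 1 / sqrt (1 - k\<^sup>2 * (sin \<theta>)\<^sup>2))"

text \<open>For \<open>0 < k < 1\<close> the map \<open>ellF k\<close> is an increasing bijection of the real line
  (the interval integral is oriented, so \<open>ellF k\<close> is odd); the amplitude is its inverse.\<close>

definition jacobi_am :: "real \<Rightarrow> real \<Rightarrow> real" where
  "jacobi_am k x = (THE \<phi>. ellF k \<phi> = x)"

definition jacobi_dn :: "real \<Rightarrow> real \<Rightarrow> real" where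
  "jacobi_dn k x = sqrt (1 - k\<^sup>2 * (sin (jacobi_am k x))\<^sup>2)"

definition dnoidal_modulus :: "real \<Rightarrow> real \<Rightarrow> real" where
  "dnoidal_modulus L c =
     (THE k. 0 < k \<and> k < 1 \<and> c = 2 * (ellK k)\<^sup>2 / L\<^sup>2 * (2 - k\<^sup>2))"

definition dnoidal_wave :: "real \<Rightarrow> real \<Rightarrow> real \<Rightarrow> real" where
  "dnoidal_wave L c x =
     (let k = dnoidal_modulus L c; \<eta> = 2 * ellK k / L in \<eta> * jacobi_dn k (\<eta> * x))"

subsection \<open>Periodic Lebesgue and Sobolev spaces\<close>

text \<open>Elements of the spaces are represented by Borel measurable periodic functions on the
  real line; two functions that agree almost everywhere represent the same element, and
  the norms below do not distinguish them.\<close>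

definition L2_per :: "real \<Rightarrow> (real \<Rightarrow> 'a::euclidean_space) set" where
  "L2_per T = {f. f \<in> borel_measurable borel \<and> (\<forall>x. f (x + T) = f x) \<and>
                  set_integrable lborel {0..T} (\<lambda>x. (norm (f x))\<^sup>2)}"

definition L2_norm :: "real \<Rightarrow> (real \<Rightarrow> 'a::euclidean_space) \<Rightarrow> real" where
  "L2_norm T f = sqrt (LBINT x:{0..T}. (norm (f x))\<^sup>2)"

definition per_test :: "real \<Rightarrow> (real \<Rightarrow> real) set" where
  "per_test T = {\<theta>. (\<forall>n x. (deriv ^^ n) \<theta> differentiable (at x)) \<and> (\<forall>x. \<theta> (x + T) = \<theta> x)}"

definition has_weak_deriv ::
    "real \<Rightarrow> (real \<Rightarrow> 'a::euclidean_space) \<Rightarrow> (real \<Rightarrow> 'a) \<Rightarrow> bool" where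
  "has_weak_deriv T f g \<longleftrightarrow>
     (\<forall>\<theta>\<in>per_test T. (LBINT x:{0..T}. deriv \<theta> x *\<^sub>R f x) = - (LBINT x:{0..T}. \<theta> x *\<^sub>R g x))"

definition H1_per :: "real \<Rightarrow> (real \<Rightarrow> 'a::euclidean_space) set" where
  "H1_per T = {f \<in> L2_per T. \<exists>g\<in>L2_per T. has_weak_deriv T f g}"

text \<open>Weak derivatives are unique up to null sets, so the choice does not affect norms.\<close>

definition weak_deriv :: "real \<Rightarrow> (real \<Rightarrow> 'a::euclidean_space) \<Rightarrow> real \<Rightarrow> 'a" where
  "weak_deriv T f = (SOME g. g \<in> L2_per T \<and> has_weak_deriv T f g)"

definition H1_norm :: "real \<Rightarrow> (real \<Rightarrow> 'a::euclidean_space) \<Rightarrow> real" where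
  "H1_norm T f = sqrt ((L2_norm T f)\<^sup>2 + (L2_norm T (weak_deriv T f))\<^sup>2)"

type_synonym state = "(real \<Rightarrow> complex) \<times> (real \<Rightarrow> real) \<times> (real \<Rightarrow> real)"

definition Y_space :: "real \<Rightarrow> state set" where
  "Y_space L = H1_per (2 * L) \<times> H1_per (2 * L) \<times> L2_per (2 * L)"

fun Y_norm :: "real \<Rightarrow> state \<Rightarrow> real" where
  "Y_norm L (u, v, w) =
     sqrt ((H1_norm (2 * L) u)\<^sup>2 + (H1_norm (2 * L) v)\<^sup>2 + (L2_norm (2 * L) w)\<^sup>2)"

fun state_diff :: "state \<Rightarrow> state \<Rightarrow> state" where
  "state_diff (u, v, w) (u', v', w') =
     ((\<lambda>x. u x - u' x), (\<lambda>x. v x - v' x), (\<lambda>x. w x - w' x))"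

definition Y_dist :: "real \<Rightarrow> state \<Rightarrow> state \<Rightarrow> real" where
  "Y_dist L z z' = Y_norm L (state_diff z z')"

subsection \<open>The flow and orbital stability\<close>

fun phase :: "real \<Rightarrow> state \<Rightarrow> state" where
  "phase s (u, v, w) = ((\<lambda>x. cis s * u x), v, w)"

lemma phase_orbit_reparam:
  assumes "c \<noteq> 0"
  shows "range (\<lambda>s. phase (c * s) \<Phi>) = range (\<lambda>s. phase s \<Phi>)"
proof -
  have "phase s \<Phi> \<in> range (\<lambda>s. phase (c * s) \<Phi>)" for s
    using assms by (intro image_eqI[where x = "s / c"]) auto
  then show ?thesis by auto
qed

text \<open>The system \<open>i u\<^sub>t + u\<^sub>x\<^sub>x / 2 = - v\<^sup>2 u\<close>, \<open>v\<^sub>t = w\<close>, \<open>w\<^sub>t - v\<^sub>x\<^sub>x + m\<^sup>2 v = 2 |u|\<^sup>2 v\<close> at time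
  \<open>t\<close>, in the sense of periodic distributions in \<open>x\<close>: each equation is paired with a test
  function \<open>\<theta>\<close>, and the space derivatives are moved onto \<open>\<theta>\<close>.\<close>

definition system_at ::
    "real \<Rightarrow> real \<Rightarrow> (real \<Rightarrow> real \<Rightarrow> complex) \<Rightarrow> (real \<Rightarrow> real \<Rightarrow> real) \<Rightarrow> (real \<Rightarrow> real \<Rightarrow> real)
      \<Rightarrow> real \<Rightarrow> bool" where
  "system_at L m u v w t \<longleftrightarrow> (\<forall>\<theta>\<in>per_test (2 * L).
     (\<exists>D. ((\<lambda>s. LBINT x:{0..2*L}. \<theta> x *\<^sub>R u s x) has_vector_derivative D) (at t) \<and>
          \<i> * D + 1/2 * (LBINT x:{0..2*L}. deriv (deriv \<theta>) x *\<^sub>R u t x)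
            = - (LBINT x:{0..2*L}. \<theta> x *\<^sub>R (of_real ((v t x)\<^sup>2) * u t x))) \<and>
     ((\<lambda>s. LBINT x:{0..2*L}. \<theta> x * v s x) has_vector_derivative
          (LBINT x:{0..2*L}. \<theta> x * w t x)) (at t) \<and>
     (\<exists>D. ((\<lambda>s. LBINT x:{0..2*L}. \<theta> x * w s x) has_vector_derivative D) (at t) \<and>
          D - (LBINT x:{0..2*L}. deriv (deriv \<theta>) x * v t x)
            + m\<^sup>2 * (LBINT x:{0..2*L}. \<theta> x * v t x)
            = 2 * (LBINT x:{0..2*L}. \<theta> x * ((cmod (u t x))\<^sup>2 * v t x))))"

text \<open>A global solution is a continuous curve in \<open>Y_space L\<close> satisfying the system at all
  times. The initial condition is equality in the quotient, i.e. distance zero.\<close>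

definition global_solution :: "real \<Rightarrow> real \<Rightarrow> state \<Rightarrow> (real \<Rightarrow> state) \<Rightarrow> bool" where
  "global_solution L m z0 z \<longleftrightarrow>
     (\<forall>t. z t \<in> Y_space L) \<and>
     (\<forall>t. ((\<lambda>s. Y_dist L (z s) (z t)) \<longlongrightarrow> 0) (at t)) \<and>
     (\<forall>t. system_at L m (\<lambda>t. fst (z t)) (\<lambda>t. fst (snd (z t))) (\<lambda>t. snd (snd (z t))) t) \<and>
     Y_dist L (z 0) z0 = 0"

text \<open>Stability of the orbit \<open>{P\<^sub>s\<^sub>c \<Phi>}\<close>, which for \<open>c \<noteq> 0\<close> is the full phase orbit \<open>{P\<^sub>s \<Phi>}\<close>
  by \<open>phase_orbit_reparam\<close>.
  Supremum and infimum are taken in the extended nonnegative reals, because the supremum of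
  an unbounded set of reals is unspecified.\<close>

definition orbitally_stable :: "real \<Rightarrow> real \<Rightarrow> state \<Rightarrow> bool" where
  "orbitally_stable L m \<Phi> \<longleftrightarrow>
     (\<forall>\<epsilon>>0. \<exists>\<delta>>0. \<forall>z0\<in>Y_space L. Y_dist L z0 \<Phi> < \<delta> \<longrightarrow>
        (\<exists>z. global_solution L m z0 z \<and>
             (SUP t\<in>{0..}. INF s. ennreal (Y_dist L (z t) (phase s \<Phi>))) < ennreal \<epsilon>))"

abbreviation orbitally_unstable :: "real \<Rightarrow> real \<Rightarrow> state \<Rightarrow> bool" where
  "orbitally_unstable L m \<Phi> \<equiv> \<not> orbitally_stable L m \<Phi>"

end

theory Submission imports Defs begin

text \<open>
  For a modulus slightly above the one of \<open>\<phi>\<^sub>c\<close>, the system has explicit travelling waves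
  \<open>u = exp (i \<omega> t) R (x - a t)\<close>, \<open>v = D (x - a t)\<close> of small speed \<open>a > 0\<close>. Here \<open>D\<close> is again a dnoidal wave
  of period \<open>L\<close>, so that \<open>R\<close> solves a Lame equation; the product of two conjugate solutions of this equation
  is affine in \<open>D\<^sup>2\<close>, namely \<open>|R|\<^sup>2 = (1 - a\<^sup>2) (q + D\<^sup>2)\<close> with \<open>q \<le> 0\<close>, and the phase of \<open>R\<close> has derivative
  \<open>a - j / (q + D\<^sup>2)\<close>. The intermediate value theorem in \<open>q\<close> makes this phase \<open>L\<close>-periodic.
  As the modulus tends to that of \<open>\<phi>\<^sub>c\<close>, the initial data of these waves converge in \<open>Y\<close> to
  \<open>(\<phi>\<^sub>c, \<phi>\<^sub>c, 0)\<close>, but at time \<open>L / (2 a)\<close> the component \<open>v\<close> is shifted by \<open>L / 2\<close> and hence far from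
  \<open>\<phi>\<^sub>c\<close>, which phase rotations do not move. A solution that stays close to the orbit is
  essentially bounded, and essentially bounded distributional solutions are unique: this is a Gronwall argument for the
  energies of the Fourier modes of the difference of two solutions.
\<close>

subsection \<open>Trigonometric polynomials and Fourier coefficients\<close>

text \<open>Stability supplies only some global solution near the orbit, in the distributional
  sense, so an explicit wave contradicts it only through uniqueness in that weak class. Testing with
  eigenfunctions of the second derivative gives an ordinary differential equation for each Fourier
  coefficient; closeness in H^1 becomes boundedness because the Fourier coefficients of an H^1
  function are absolutely summable.

  The family of waves is dictated by m^2 = 2 c. With D'' = 2 C D - 2 D^3, the equation for v says
  that |R|^2 = (1 - a^2) (q + D^2) with (1 - a^2) (q + C) = c. At the modulus of \<phi>_c one has C
  = c, and q \<le> 0 leaves only a = q = 0. A slightly larger modulus gives C > c and frees one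
  parameter, which is spent on closing the phase; c - C \<le> q \<le> 0 then forces both q and a to
  0 together with C - c. This needs C to increase strictly with the modulus, which is not evident,
  since K(k) grows while 2 - k^2 falls.\<close>

definition cas :: "real \<Rightarrow> int \<Rightarrow> real \<Rightarrow> real" where
  "cas T n x = (cos (2 * pi * of_int n / T * x) + sin (2 * pi * of_int n / T * x)) / sqrt T"

abbreviation freq :: "real \<Rightarrow> int \<Rightarrow> real" where
  "freq T n \<equiv> 2 * pi * of_int n / T"

text \<open>Differentiation reflects the index, since cos + sin becomes cos - sin. This is the
  Hartley kernel: it is real, as the members of \<open>per_test\<close> are, and one orthonormal
  family indexed by \<open>int\<close> serves real-valued and complex-valued functions
  alike.\<close>

lemma cas_has_real_derivative [derivative_intros]:
  "((\<lambda>x. cas T n x) has_real_derivative freq T n * cas T (- n) x) (at x within A)"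
proof -
  define \<mu> k where "\<mu> = freq T n" and "k = inverse (sqrt T)"
  have "((\<lambda>x. (cos (\<mu> * x) + sin (\<mu> * x)) * k) has_real_derivative
      \<mu> * ((cos (- \<mu> * x) + sin (- \<mu> * x)) * k)) (at x within A)"
    by (auto intro!: derivative_eq_intros simp: algebra_simps)
  then show ?thesis by (simp add: cas_def divide_inverse \<mu>_def k_def)
qed

lemma deriv_cas: "deriv (cas T n) = (\<lambda>x. freq T n * cas T (- n) x)"
  by (rule ext) (rule DERIV_imp_deriv, rule cas_has_real_derivative)

lemma deriv_deriv_cas: "deriv (deriv (cas T n)) x = - (freq T n)\<^sup>2 * cas T n x"
proof -
  have "((\<lambda>x. freq T n * cas T (- n) x) has_real_derivative freq T n * (freq T (-n) * cas T (- (- n)) x)) (at x)"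
    by (intro DERIV_cmult cas_has_real_derivative)
  from DERIV_imp_deriv[OF this] show ?thesis by (simp add: deriv_cas power2_eq_square)
qed

lemma continuous_on_cas [continuous_intros]: "continuous_on A (cas T n)"
  unfolding cas_def by (auto intro!: continuous_intros simp: divide_inverse)

lemma borel_measurable_cas [measurable]: "cas T n \<in> borel_measurable borel"
  by (intro borel_measurable_continuous_onI continuous_on_cas)

lemma cas_periodic: assumes "T > 0" shows "cas T n (x + T) = cas T n x"
proof -
  have "freq T n * (x + T) = freq T n * x + 2 * pi * of_int n" using assms by (simp add: field_simps)
  then show ?thesis unfolding cas_def by (simp only: cos_add sin_add) (simp)
qed

text \<open>\<open>per_test\<close> asks that every iterated derivative be differentiable; the span
  of \<open>cas T n\<close> and \<open>cas T (- n)\<close> is invariant under \<open>deriv\<close>,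
  which carries the induction.\<close>

lemma deriv_iterate_cas: "\<exists>a b. (deriv ^^ k) (cas T n) = (\<lambda>x. a * cas T n x + b * cas T (- n) x)"
proof (induction k)
  case 0
  show ?case by (intro exI[of _ 1] exI[of _ 0]) auto
next
  case (Suc k)
  then obtain a b where ab: "(deriv ^^ k) (cas T n) = (\<lambda>x. a * cas T n x + b * cas T (- n) x)" by blast
  have "deriv (\<lambda>x. a * cas T n x + b * cas T (- n) x) =
     (\<lambda>x. (- b * freq T n) * cas T n x + (a * freq T n) * cas T (-n) x)"
  proof (rule ext, rule DERIV_imp_deriv)
    fix x
    have "((\<lambda>x. a * cas T n x + b * cas T (- n) x) has_real_derivative
        a * (freq T n * cas T (- n) x) + b * (freq T (- n) * cas T (- (- n)) x)) (at x)"
      by (intro DERIV_add DERIV_cmult cas_has_real_derivative)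
    then show "((\<lambda>x. a * cas T n x + b * cas T (- n) x) has_real_derivative
        (- b * freq T n) * cas T n x + (a * freq T n) * cas T (-n) x) (at x)"
      by (simp add: algebra_simps)
  qed
  then show ?case using ab by (simp only: funpow.simps o_apply) blast
qed

lemma cas_per_test: assumes "T > 0" shows "cas T n \<in> per_test T"
  unfolding per_test_def
proof (intro CollectI conjI allI)
  fix k x
  obtain a b where ab: "(deriv ^^ k) (cas T n) = (\<lambda>x. a * cas T n x + b * cas T (- n) x)"
    using deriv_iterate_cas by blast
  show "(deriv ^^ k) (cas T n) differentiable at x" unfolding ab
    by (intro differentiableI_vector) (auto intro!: derivative_eq_intros simp flip: has_real_derivative_iff_has_vector_derivative)
qed (use cas_periodic assms in auto)

lemma abs_cas_le: assumes "T > 0" shows "\<bar>cas T n x\<bar> \<le> 2 / sqrt T"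
proof -
  have "\<bar>cos (freq T n * x) + sin (freq T n * x)\<bar> \<le> 2"
    using abs_cos_le_one[of "freq T n * x"] abs_sin_le_one[of "freq T n * x"] by linarith
  then show ?thesis using assms by (auto simp: cas_def abs_divide intro!: divide_right_mono)
qed

text \<open>With A and B the two arguments, (cos A + sin A) (cos B + sin B) = cos (A - B) + sin (A +
  B). The cosine is half a sum of two reflected kernels and the sine half a difference, hence the
  single minus sign.\<close>

lemma cas_mult:
  assumes "T > 0"
  shows "cas T n x * cas T m x
    = (cas T (n - m) x + cas T (m - n) x + cas T (n + m) x - cas T (- n - m) x) / (2 * sqrt T)"
proof -
  define A B where "A = freq T n * x" and "B = freq T m * x"
  have *: "freq T (n-m) * x = A - B" "freq T (m-n) * x = B - A" "freq T (n+m) * x = A + B" "freq T (-n-m) * x = - (A + B)"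
    using assms by (simp_all add: A_def B_def field_simps)
  have "(cos A + sin A) * (cos B + sin B) = (cos (A-B) + sin (A-B) + (cos (B-A) + sin (B-A)) + (cos (A+B) + sin (A+B)) - (cos (-(A+B)) + sin (-(A+B)))) / 2"
    by (simp add: cos_add sin_add cos_diff sin_diff algebra_simps)
  moreover have "P / r * (Q / r) = (a / r + b / r + c / r - d / r) / (2 * r)"
    if "P * Q = (a + b + c - d) / 2" for P Q a b c d r :: real
    using arg_cong[OF that, of "\<lambda>y. y / (r * r)"]
    by (simp add: add_divide_distrib[symmetric] diff_divide_distrib[symmetric] ac_simps)
  ultimately show ?thesis unfolding cas_def * A_def[symmetric] B_def[symmetric] by blast
qed

lemma integral_cas: assumes "T > 0" shows "(LBINT x:{0..T}. cas T n x) = (if n = 0 then sqrt T else 0)"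
proof (cases "n = 0")
  case True
  then show ?thesis using assms by (simp add: cas_def set_lebesgue_integral_def real_div_sqrt)
next
  case False
  let ?F = "\<lambda>x. - cas T (-n) x / freq T n"
  have "(LBINT x:{0..T}. cas T n x) = ?F T - ?F 0"
    unfolding set_lebesgue_integral_def
  proof (rule integral_FTC_atLeastAtMost)
    show "(?F has_vector_derivative cas T n x) (at x within {0..T})" for x
      unfolding has_real_derivative_iff_has_vector_derivative[symmetric]
      using False assms by (auto intro!: derivative_eq_intros)
  qed (use assms in \<open>auto intro!: continuous_intros\<close>)
  also have "?F T = ?F 0" using cas_periodic[OF assms, of "-n" 0] by simp
  finally show ?thesis using False by simp
qed

lemma set_integrable_cas: "set_integrable lborel {0..T} (cas T n)"
  by (rule borel_integrable_atLeastAtMost') (rule continuous_on_cas)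

lemma cas_orthonormal: assumes "T > 0"
  shows "(LBINT x:{0..T}. cas T n x * cas T m x) = (if n = m then 1 else 0)"
  unfolding cas_mult[OF assms]
  using assms by (auto simp: set_integral_add set_integral_diff set_integrable_cas integral_cas)

inductive trig_poly :: "real \<Rightarrow> (real \<Rightarrow> real) \<Rightarrow> bool" for T where
  cas: "trig_poly T (cas T n)"
| cmul: "trig_poly T f \<Longrightarrow> trig_poly T (\<lambda>x. a * f x)"
| add: "trig_poly T f \<Longrightarrow> trig_poly T g \<Longrightarrow> trig_poly T (\<lambda>x. f x + g x)"

lemma trig_poly_cas_mult:
  assumes "T > 0" "trig_poly T f" shows "trig_poly T (\<lambda>x. cas T n x * f x)"
  using assms(2)
proof induction
  case (cas m)
  have "trig_poly T (\<lambda>x. 1 / (2 * sqrt T) * (((cas T (n - m) x + cas T (m - n) x) + cas T (n + m) x) + (-1) * cas T (- n - m) x))"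
    by (intro trig_poly.intros)
  then show ?case by (simp add: cas_mult[OF assms(1)] add_divide_distrib diff_divide_distrib)
next
  case (cmul f a)
  then show ?case using trig_poly.cmul[OF cmul(2), of a] by (simp add: mult.left_commute)
next
  case (add f g)
  then show ?case using trig_poly.add[OF add(3,4)] by (simp add: ring_distribs)
qed

lemma trig_poly_mult:
  assumes "T > 0" "trig_poly T f" "trig_poly T g" shows "trig_poly T (\<lambda>x. f x * g x)"
  using assms(2)
proof induction
  case (cas m)
  then show ?case using trig_poly_cas_mult[OF assms(1,3)] by simp
next
  case (cmul f a)
  then show ?case using trig_poly.cmul[OF cmul(2), of a] by (simp add: mult.assoc)
next
  case (add f h)
  then show ?case using trig_poly.add[OF add(3,4)] by (simp add: ring_distribs)
qed

text \<open>Stone-Weierstrass delivers real polynomial functions on the plane, restricted to the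
  unit circle. A linear one is fixed by its values at 1 and \<i>, so only cosine and sine of the
  base frequency enter; products are covered by \<open>trig_poly_mult\<close>.\<close>

lemma trig_poly_polynomial:
  assumes "T > 0" "real_polynomial_function p"
  shows "trig_poly T (\<lambda>x. p (cis (freq T 1 * x)))"
  using assms(2)
proof induction
  case (linear h)
  have h: "h z = Re z * h 1 + Im z * h \<i>" for z
  proof -
    interpret bounded_linear h by fact
    have "Re z *\<^sub>R 1 + Im z *\<^sub>R \<i> = z" by (simp add: complex_eq_iff)
    then have "h z = h (Re z *\<^sub>R 1 + Im z *\<^sub>R \<i>)" by simp
    then show ?thesis by (simp only: add scaleR) simp
  qed
  have "trig_poly T (\<lambda>x. ((h 1 * (sqrt T/2)) * (cas T 1 x + cas T (-1) x))
        + (h \<i> * (sqrt T / 2)) * (cas T 1 x + (-1) * cas T (-1) x))"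
    by (intro trig_poly.intros)
  then show ?case using assms(1) by (subst h) (simp add: cas_def field_simps)
next
  case (const c)
  have "trig_poly T (\<lambda>x. (sqrt T * c) * cas T 0 x)" by (intro trig_poly.intros)
  then show ?case using assms(1) by (simp add: cas_def)
next
  case (add f g)
  show ?case by (rule trig_poly.add[OF add(3,4)])
next
  case (mult f g)
  show ?case by (rule trig_poly_mult[OF assms(1) mult(3,4)])
qed

section \<open>Completeness of the system \<open>cas\<close> among integrable functions\<close>

lemma set_integrable_scaleR_bounded:
  fixes f :: "'b \<Rightarrow> 'a::euclidean_space" and h :: "'b \<Rightarrow> real"
  assumes f: "set_integrable M S f" and h: "h \<in> borel_measurable M"
    and B: "\<And>x. \<bar>h x\<bar> \<le> B"
  shows "set_integrable M S (\<lambda>x. h x *\<^sub>R f x)"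
  unfolding set_integrable_def
proof (rule Bochner_Integration.integrable_bound)
  show "integrable M (\<lambda>x. B *\<^sub>R (indicator S x *\<^sub>R f x))"
    using f unfolding set_integrable_def by (intro integrable_scaleR_right)
  have "(\<lambda>x. h x *\<^sub>R (indicat_real S x *\<^sub>R f x)) \<in> borel_measurable M"
    by (rule borel_measurable_scaleR[OF h borel_measurable_integrable[OF f[unfolded set_integrable_def]]])
  then show "(\<lambda>x. indicat_real S x *\<^sub>R h x *\<^sub>R f x) \<in> borel_measurable M"
    by (simp add: mult.commute)
  show "AE x in M. norm (indicat_real S x *\<^sub>R h x *\<^sub>R f x) \<le> norm (B *\<^sub>R indicat_real S x *\<^sub>R f x)"
  proof (rule AE_I2)
    fix x
    have "\<bar>h x\<bar> * norm (f x) \<le> \<bar>B\<bar> * norm (f x)" by (intro mult_right_mono) (use B[of x] in auto)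
    then show "norm (indicat_real S x *\<^sub>R h x *\<^sub>R f x) \<le> norm (B *\<^sub>R indicat_real S x *\<^sub>R f x)"
      by (simp add: indicator_def)
  qed
qed

context
  fixes T :: real and f :: "real \<Rightarrow> 'a::euclidean_space"
  assumes T: "T > 0" and int: "set_integrable lborel {0..T} f"
    and zero: "\<And>n. (LBINT x:{0..T}. cas T n x *\<^sub>R f x) = 0"
begin

lemma trig_poly_orthogonal:
  assumes "trig_poly T h"
  shows "set_integrable lborel {0..T} (\<lambda>x. h x *\<^sub>R f x) \<and> (LBINT x:{0..T}. h x *\<^sub>R f x) = 0"
  using assms
proof induction
  case (cas n)
  show ?case using set_integrable_scaleR_bounded[OF int _ abs_cas_le[OF T]] zero by auto
next
  case (cmul g a)
  then have "set_integrable lborel {0..T} (\<lambda>x. a *\<^sub>R (g x *\<^sub>R f x))" "(LBINT x:{0..T}. a *\<^sub>R (g x *\<^sub>R f x)) = 0"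
    by (simp_all only: set_integral_scaleR_right set_integrable_scaleR_right scaleR_zero_right)
  then show ?case by (simp only: scaleR_scaleR)
next
  case (add g h)
  then show ?case by (simp add: scaleR_left_distrib)
qed

text \<open>Pulling functions back from the circle builds in the periodicity and makes the domain
  compact. As f is merely integrable, the approximation by polynomials has to be uniform: the error
  is then at most e times the integral of |f|.\<close>

lemma circle_continuous_orthogonal:
  fixes H :: "complex \<Rightarrow> real"
  assumes H: "continuous_on (sphere 0 1) H"
  shows "set_integrable lborel {0..T} (\<lambda>x. H (cis (freq T 1 * x)) *\<^sub>R f x)"
    and "(LBINT x:{0..T}. H (cis (freq T 1 * x)) *\<^sub>R f x) = 0"
proof -
  define h where "h = (\<lambda>x. H (cis (freq T 1 * x)))"
  have cont: "continuous_on UNIV h" unfolding h_def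
    by (rule continuous_on_compose2[OF H]) (use T in \<open>auto intro!: continuous_intros\<close>)
  then have m: "h \<in> borel_measurable borel" by (rule borel_measurable_continuous_onI)
  have "bounded (H ` sphere 0 1)" using compact_continuous_image[OF H] by (simp add: compact_imp_bounded)
  then obtain B where "\<forall>y\<in>H ` sphere 0 1. norm y \<le> B" unfolding bounded_iff by blast
  then have B: "\<bar>H z\<bar> \<le> B" if "z \<in> sphere 0 1" for z using that by simp
  have ih: "set_integrable lborel {0..T} (\<lambda>x. h x *\<^sub>R f x)"
    by (rule set_integrable_scaleR_bounded[OF int, of _ B]) (use m B in \<open>auto simp: h_def\<close>)
  then show "set_integrable lborel {0..T} (\<lambda>x. H (cis (freq T 1 * x)) *\<^sub>R f x)"
    by (simp add: h_def)
  have le: "norm (LBINT x:{0..T}. h x *\<^sub>R f x) \<le> e * (LBINT x:{0..T}. norm (f x))" if "e > 0" for e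
  proof -
    obtain g where g: "real_polynomial_function g" "\<And>x. x \<in> sphere 0 1 \<Longrightarrow> \<bar>H x - g x\<bar> < e"
      using Stone_Weierstrass_real_polynomial_function[OF compact_sphere H \<open>e > 0\<close>] by metis
    define q where "q = (\<lambda>x. g (cis (freq T 1 * x)))"
    have q: "trig_poly T q" unfolding q_def by (rule trig_poly_polynomial[OF T g(1)])
    note qq = trig_poly_orthogonal[OF q]
    have d: "set_integrable lborel {0..T} (\<lambda>x. (h x - q x) *\<^sub>R f x)"
      using ih qq by (simp add: scaleR_left_diff_distrib)
    have "(LBINT x:{0..T}. h x *\<^sub>R f x) = (LBINT x:{0..T}. (h x - q x) *\<^sub>R f x)"
      using ih qq by (simp add: scaleR_left_diff_distrib)
    also have "norm \<dots> \<le> (LBINT x:{0..T}. norm ((h x - q x) *\<^sub>R f x))"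
      by (rule set_integral_norm_bound[OF d])
    also have "\<dots> \<le> (LBINT x:{0..T}. e * norm (f x))"
    proof (rule set_integral_mono)
      show "set_integrable lborel {0..T} (\<lambda>x. norm ((h x - q x) *\<^sub>R f x))"
        using d by (rule set_integrable_norm)
      show "set_integrable lborel {0..T} (\<lambda>x. e * norm (f x))"
        using set_integrable_norm[OF int] by simp
      show "norm ((h x - q x) *\<^sub>R f x) \<le> e * norm (f x)" for x
        using mult_right_mono[OF less_imp_le[OF g(2)[of "cis (freq T 1 * x)"]] norm_ge_zero[of "f x"]]
        by (simp add: h_def q_def)
    qed
    finally show ?thesis by simp
  qed
  have "norm (LBINT x:{0..T}. h x *\<^sub>R f x) \<le> 0"
  proof (rule field_le_epsilon)
    fix e :: real assume e: "e > 0"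
    define C where "C = (LBINT x:{0..T}. norm (f x))"
    have C: "C \<ge> 0" unfolding C_def set_lebesgue_integral_def by (intro integral_nonneg_AE) auto
    \<comment> \<open>\<open>C\<close> may be 0, hence the division by \<open>C + 1\<close>.\<close>
    have "norm (LBINT x:{0..T}. h x *\<^sub>R f x) \<le> e / (C + 1) * C"
      unfolding C_def[symmetric] by (rule le[of "e / (C+1)", folded C_def]) (use e C in auto)
    also have "\<dots> \<le> e" using e C by (simp add: field_simps)
    finally show "norm (LBINT x:{0..T}. h x *\<^sub>R f x) \<le> 0 + e" by simp
  qed
  then show "(LBINT x:{0..T}. H (cis (freq T 1 * x)) *\<^sub>R f x) = 0" by (simp add: h_def)
qed

text \<open>One of the two points is taken strictly inside the interval because 0 and
  \<open>T\<close> have the same image on the circle.\<close>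

lemma cis_inj_period:
  assumes "0 < x" "x < T" "y \<in> {0..T}" "cis (freq T 1 * x) = cis (freq T 1 * y)"
  shows "x = y"
proof -
  have "sin (freq T 1 * y) = sin (freq T 1 * x) \<and> cos (freq T 1 * y) = cos (freq T 1 * x)"
    using assms(4) by (auto simp: complex_eq_iff)
  then obtain n :: int where "freq T 1 * y = freq T 1 * x + 2 * pi * n"
    by (auto simp: sin_cos_eq_iff)
  then have "2 * pi / T * (y - x - T * n) = 0" using T by (simp add: field_simps)
  then have *: "y - x = T * n" using T by simp
  have "\<bar>y - x\<bar> < T" using assms by auto
  then have "T * \<bar>real_of_int n\<bar> < T * 1" using T by (simp add: * abs_mult)
  then have "n = 0" using T by (subst (asm) mult_less_cancel_left_pos) auto
  then show ?thesis using * by simp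
qed

text \<open>The image A of the closed set on the circle is compact, and the tent functions max 0 (1
  - n dist(z, A)) decrease to its indicator, so dominated convergence carries orthogonality to the
  limit. Only the endpoints 0 and \<open>T\<close> can spoil the pull-back to the line, and they
  form a null set.\<close>

lemma closed_integral_zero:
  assumes "closed C"
  shows "(LBINT x:C. indicator {0..T} x *\<^sub>R f x) = 0"
\<comment> \<open>\<open>infdist\<close> to the empty set is 0 by convention, so the tent functions
  below would be constantly 1; this case is settled directly.\<close>
proof (cases "C \<inter> {0..T} = {}")
  case True
  then have "indicator C x *\<^sub>R indicator {0..T} x *\<^sub>R f x = 0" for x by (auto simp: indicator_def)
  then show ?thesis unfolding set_lebesgue_integral_def by (simp only: integral_zero)
next
  case False
  define \<gamma> where "\<gamma> = (\<lambda>x. cis (freq T 1 * x))"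
  define A where "A = \<gamma> ` (C \<inter> {0..T})"
  have "compact (C \<inter> {0..T})" using assms by (simp add: closed_Int_compact)
  then have A: "compact A" "A \<noteq> {}" unfolding A_def \<gamma>_def using False T
    by (auto intro!: compact_continuous_image continuous_intros)
  define H where "H = (\<lambda>n::nat. \<lambda>z. max 0 (1 - n * infdist z A))"
  have lim: "(\<lambda>n. H n z) \<longlonglongrightarrow> indicator A z" for z
  proof (cases "z \<in> A")
    case True
    then show ?thesis by (simp add: H_def)
  next
    case False
    then have pos: "infdist z A > 0"
      using A compact_imp_closed[OF A(1)] in_closed_iff_infdist_zero[of A z] infdist_nonneg[of z A]
      by (metis less_eq_real_def)
    obtain N :: nat where N: "N * infdist z A > 1" using pos reals_Archimedean3 by blast
    have "H n z = 0" if "n \<ge> N" for n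
    proof -
      have "real n * infdist z A \<ge> N * infdist z A" using that pos by simp
      then show ?thesis using N unfolding H_def by simp
    qed
    then have "eventually (\<lambda>n. H n z = 0) sequentially" by (auto simp: eventually_sequentially)
    then show ?thesis using False by (simp add: tendsto_eventually)
  qed
  let ?i = "\<lambda>x. indicat_real {0..T} x"
  have mf: "(\<lambda>x. ?i x *\<^sub>R f x) \<in> borel_measurable lborel"
    using int by (auto simp: set_integrable_def)
  have "(\<lambda>n. LBINT x:{0..T}. H n (\<gamma> x) *\<^sub>R f x) \<longlonglongrightarrow> (LBINT x:{0..T}. indicator A (\<gamma> x) *\<^sub>R f x)"
    unfolding set_lebesgue_integral_def
  proof (rule integral_dominated_convergence)
    show "integrable lborel (\<lambda>x. norm (?i x *\<^sub>R f x))"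
      using int unfolding set_integrable_def by (rule integrable_norm)
    show "AE x in lborel. (\<lambda>n. ?i x *\<^sub>R H n (\<gamma> x) *\<^sub>R f x) \<longlonglongrightarrow> ?i x *\<^sub>R indicat_real A (\<gamma> x) *\<^sub>R f x"
      by (intro AE_I2 tendsto_intros lim)
    show "AE x in lborel. norm (?i x *\<^sub>R H n (\<gamma> x) *\<^sub>R f x) \<le> norm (?i x *\<^sub>R f x)" for n
      by (intro AE_I2) (auto simp: H_def max_def infdist_nonneg indicator_def intro!: mult_left_le_one_le)
    have "(\<lambda>x. H n (\<gamma> x)) \<in> borel_measurable borel" for n
      unfolding H_def \<gamma>_def by (intro borel_measurable_continuous_onI continuous_intros) (use T in auto)
    then show "(\<lambda>x. ?i x *\<^sub>R H n (\<gamma> x) *\<^sub>R f x) \<in> borel_measurable lborel" for n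
      using borel_measurable_scaleR[OF _ mf, of "\<lambda>x. H n (\<gamma> x)"] by (simp add: mult.commute)
    have "\<gamma> \<in> borel_measurable borel" unfolding \<gamma>_def
      by (intro borel_measurable_continuous_onI continuous_intros) (use T in auto)
    then have "(\<lambda>x. indicat_real A (\<gamma> x)) \<in> borel_measurable borel"
      by (rule measurable_compose[OF _ borel_measurable_indicator])
        (use borel_closed[OF compact_imp_closed[OF A(1)]] in auto)
    then show "(\<lambda>x. ?i x *\<^sub>R indicat_real A (\<gamma> x) *\<^sub>R f x) \<in> borel_measurable lborel"
      using borel_measurable_scaleR[OF _ mf, of "\<lambda>x. indicat_real A (\<gamma> x)"] by (simp add: mult.commute)
  qed
  moreover have "(LBINT x:{0..T}. H n (\<gamma> x) *\<^sub>R f x) = 0" for n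
    unfolding \<gamma>_def H_def by (rule circle_continuous_orthogonal(2)) (auto intro!: continuous_intros)
  ultimately have "(LBINT x:{0..T}. indicator A (\<gamma> x) *\<^sub>R f x) = 0"
    by (simp add: LIMSEQ_const_iff)
  moreover have "(LBINT x:{0..T}. indicator A (\<gamma> x) *\<^sub>R f x) = (LBINT x:C. ?i x *\<^sub>R f x)"
    unfolding set_lebesgue_integral_def
  proof (rule integral_cong_AE)
    have "AE x in lborel. x \<noteq> 0 \<and> x \<noteq> T"
      by (rule AE_conjI[OF AE_lborel_singleton AE_lborel_singleton])
    then show "AE x in lborel. ?i x *\<^sub>R indicat_real A (\<gamma> x) *\<^sub>R f x = indicat_real C x *\<^sub>R ?i x *\<^sub>R f x"
    proof eventually_elim
      case (elim x)
      have "\<gamma> x \<in> A \<longleftrightarrow> x \<in> C" if "x \<in> {0..T}"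
      proof
        assume "\<gamma> x \<in> A"
        then obtain y where y: "y \<in> C" "y \<in> {0..T}" "\<gamma> x = \<gamma> y" unfolding A_def by blast
        have "x = y" by (rule cis_inj_period) (use y elim that in \<open>auto simp: \<gamma>_def\<close>)
        then show "x \<in> C" using y by simp
      qed (use that in \<open>auto simp: A_def\<close>)
      then show ?case by (auto simp: indicator_def)
    qed
    have "\<gamma> \<in> borel_measurable borel" unfolding \<gamma>_def
      by (intro borel_measurable_continuous_onI continuous_intros) (use T in auto)
    then have "(\<lambda>x. indicat_real A (\<gamma> x)) \<in> borel_measurable borel"
      by (rule measurable_compose[OF _ borel_measurable_indicator])
        (use borel_closed[OF compact_imp_closed[OF A(1)]] in auto)
    then show "(\<lambda>x. ?i x *\<^sub>R indicat_real A (\<gamma> x) *\<^sub>R f x) \<in> borel_measurable lborel"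
      using borel_measurable_scaleR[OF _ mf, of "\<lambda>x. indicat_real A (\<gamma> x)"] by (simp add: mult.commute)
    show "(\<lambda>x. indicat_real C x *\<^sub>R ?i x *\<^sub>R f x) \<in> borel_measurable lborel"
      using borel_closed[OF assms] by (intro borel_measurable_scaleR mf) auto
  qed
  ultimately show ?thesis by simp
qed

text \<open>The sets over which f integrates to 0 are closed under complements and countable
  disjoint unions and contain the closed sets, an intersection-stable generator of the Borel sets. A
  function with vanishing integral over every Borel set is 0 almost everywhere.\<close>

lemma cas_complete: "AE x in lborel. x \<in> {0..T} \<longrightarrow> f x = 0"
proof -
  let ?g = "\<lambda>x. indicat_real {0..T} x *\<^sub>R f x"
  have ig: "integrable lborel ?g" using int by (simp add: set_integrable_def)
  have UNIV0: "(LBINT x:UNIV. ?g x) = 0" by (rule closed_integral_zero) auto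
  have "AE x in lborel. ?g x = 0"
  proof (rule sigma_finite_measure.density_zero[OF sigma_finite_lborel ig])
    fix A assume "A \<in> sets (lborel :: real measure)"
    then have *: "A \<in> sigma_sets UNIV (Collect closed)" by (simp add: borel_eq_closed)
    have "Int_stable (Collect closed :: real set set)" by (auto intro!: Int_stableI)
    moreover have "Collect closed \<subseteq> Pow (UNIV :: real set)" by auto
    moreover note *
    ultimately show "(LBINT x:A. ?g x) = 0"
    proof (induction rule: sigma_sets_induct_disjoint)
      case (basic A)
      then show ?case using closed_integral_zero by simp
    next
      case empty
      then show ?case by (simp add: set_lebesgue_integral_def)
    next
      case (compl A)
      then have A: "A \<in> sets lborel" by (simp add: borel_eq_closed)
      have s: "set_integrable lborel B ?g" if "B \<in> sets lborel" for B
        using integrable_mult_indicator[OF that ig] by (simp add: set_integrable_def)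
      have "(LBINT x:(A \<union> (UNIV - A)). ?g x) = (LBINT x:A. ?g x) + (LBINT x:UNIV - A. ?g x)"
        by (rule set_integral_Un) (use s A in auto)
      then show ?case using compl UNIV0 by simp
    next
      case (union A)
      have "A i \<in> sets lborel" for i using union(2) by (auto simp: borel_eq_closed)
      then have "(LBINT x:(\<Union>i. A i). ?g x) = (\<Sum>i. LBINT x:A i. ?g x)"
        using union(1) integrable_mult_indicator[OF _ ig, of "\<Union>i. A i"]
        by (intro lebesgue_integral_countable_add) (auto simp: disjoint_family_on_def set_integrable_def)
      then show ?case using union by simp
    qed
  qed
  then show ?thesis by eventually_elim (auto simp: indicator_def)
qed

end

section \<open>Bessel's inequality, Sobolev embedding and Parseval\<close>

lemma L2_perD:
  assumes "f \<in> L2_per T"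
  shows "f \<in> borel_measurable borel" "\<And>x. f (x + T) = f x"
    "set_integrable lborel {0..T} (\<lambda>x. (norm (f x))\<^sup>2)"
  using assms by (auto simp: L2_per_def)

lemma set_integrable_const_Icc: "set_integrable lborel {0..T::real} (\<lambda>x. c :: 'a::euclidean_space)"
  by (rule borel_integrable_atLeastAtMost') auto

lemma set_integrable_bound':
  fixes f :: "real \<Rightarrow> 'a::euclidean_space" and g :: "real \<Rightarrow> real"
  assumes "set_integrable lborel {0..T} g" "f \<in> borel_measurable borel"
    and "AE x in lborel. x \<in> {0..T} \<longrightarrow> norm (f x) \<le> g x"
  shows "set_integrable lborel {0..T} f"
  by (rule set_integrable_bound[OF assms(1)])
    (use assms(2,3) in \<open>auto simp: set_borel_measurable_def elim!: eventually_mono\<close>)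

lemma L2_per_integrable:
  assumes "f \<in> L2_per T" shows "set_integrable lborel {0..T} f"
proof (rule set_integrable_bound')
  show "set_integrable lborel {0..T} (\<lambda>x. 1 + (norm (f x))\<^sup>2)"
    by (intro set_integral_add(1) set_integrable_const_Icc L2_perD assms)
  have "y \<le> 1 + y\<^sup>2" for y :: real
  proof -
    have "2 * y \<le> y\<^sup>2 + 1" using sum_squares_bound[of y 1] by simp
    moreover have "0 \<le> y\<^sup>2" by simp
    ultimately show ?thesis by linarith
  qed
  then show "AE x in lborel. x \<in> {0..T} \<longrightarrow> norm (f x) \<le> 1 + (norm (f x))\<^sup>2" by simp
qed (use L2_perD[OF assms] in auto)

lemma L2_per_add:
  assumes "f \<in> L2_per T" "g \<in> L2_per T" shows "(\<lambda>x. f x + g x) \<in> L2_per T"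
proof -
  have "set_integrable lborel {0..T} (\<lambda>x. (norm (f x + g x))\<^sup>2)"
  proof (rule set_integrable_bound')
    show "set_integrable lborel {0..T} (\<lambda>x. 2 * (norm (f x))\<^sup>2 + 2 * (norm (g x))\<^sup>2)"
      using L2_perD[OF assms(1)] L2_perD[OF assms(2)] by simp
    have "(norm (f x + g x))\<^sup>2 \<le> 2 * (norm (f x))\<^sup>2 + 2 * (norm (g x))\<^sup>2" for x
    proof -
      have "(norm (f x + g x))\<^sup>2 \<le> (norm (f x) + norm (g x))\<^sup>2"
        by (intro power_mono norm_triangle_ineq) auto
      then show ?thesis using sum_squares_bound[of "norm (f x)" "norm (g x)"] by (simp add: power2_sum)
    qed
    then show "AE x in lborel. x \<in> {0..T} \<longrightarrow> norm ((norm (f x + g x))\<^sup>2)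
         \<le> 2 * (norm (f x))\<^sup>2 + 2 * (norm (g x))\<^sup>2" by auto
  qed (use L2_perD[OF assms(1)] L2_perD[OF assms(2)] in auto)
  then show ?thesis using L2_perD[OF assms(1)] L2_perD[OF assms(2)] by (auto simp: L2_per_def)
qed

lemma L2_per_uminus:
  assumes "f \<in> L2_per T" shows "(\<lambda>x. - f x) \<in> L2_per T"
  using L2_perD[OF assms] by (auto simp: L2_per_def)

lemma L2_per_diff:
  assumes "f \<in> L2_per T" "g \<in> L2_per T" shows "(\<lambda>x. f x - g x) \<in> L2_per T"
  using L2_per_add[OF assms(1) L2_per_uminus[OF assms(2)]] by simp

lemma L2_norm_sq: "(L2_norm T f)\<^sup>2 = (LBINT x:{0..T}. (norm (f x))\<^sup>2)"
  unfolding L2_norm_def set_lebesgue_integral_def by (simp add: integral_nonneg_AE)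

lemma L2_norm_nonneg: "L2_norm T f \<ge> 0"
  unfolding L2_norm_def set_lebesgue_integral_def by (simp add: integral_nonneg_AE)

lemma
  fixes f :: "'i \<Rightarrow> 'b \<Rightarrow> 'a::euclidean_space"
  assumes "\<And>i. i \<in> I \<Longrightarrow> set_integrable M S (f i)"
  shows set_integrable_finite_sum: "set_integrable M S (\<lambda>x. \<Sum>i\<in>I. f i x)"
    and set_integral_finite_sum: "(LINT x:S|M. \<Sum>i\<in>I. f i x) = (\<Sum>i\<in>I. LINT x:S|M. f i x)"
  using assms by (simp_all add: set_integrable_def set_lebesgue_integral_def scaleR_sum_right)

definition fcoef :: "real \<Rightarrow> (real \<Rightarrow> 'a::euclidean_space) \<Rightarrow> int \<Rightarrow> 'a" where
  "fcoef T f n = (LBINT x:{0..T}. cas T n x *\<^sub>R f x)"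

lemma set_integrable_cas_scaleR:
  fixes f :: "real \<Rightarrow> 'a::euclidean_space"
  assumes "T > 0" "set_integrable lborel {0..T} f"
  shows "set_integrable lborel {0..T} (\<lambda>x. cas T n x *\<^sub>R f x)"
  by (rule set_integrable_scaleR_bounded[OF assms(2) _ abs_cas_le[OF assms(1)]]) auto

lemma fcoef_diff:
  fixes f :: "real \<Rightarrow> 'a::euclidean_space"
  assumes "T > 0" "set_integrable lborel {0..T} f" "set_integrable lborel {0..T} g"
  shows "fcoef T (\<lambda>x. f x - g x) n = fcoef T f n - fcoef T g n"
  using assms by (simp add: fcoef_def scaleR_right_diff_distrib set_integrable_cas_scaleR)

lemma norm_fcoef_le:
  fixes f :: "real \<Rightarrow> 'a::euclidean_space"
  assumes "T > 0" "set_integrable lborel {0..T} f"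
  shows "norm (fcoef T f n) \<le> (LBINT x:{0..T}. norm (cas T n x *\<^sub>R f x))"
  unfolding fcoef_def by (rule set_integral_norm_bound[OF set_integrable_cas_scaleR[OF assms]])

text \<open>Pythagoras for the orthonormal system. It is used twice: the left side is nonnegative,
  which gives Bessel, and for H^1 functions it becomes small, which gives the converse
  inequality.\<close>

lemma norm_diff_partial_sum:
  fixes f :: "real \<Rightarrow> 'a::euclidean_space"
  assumes T: "T > 0" and f: "f \<in> L2_per T" and A: "finite A"
  shows "(LBINT x:{0..T}. (norm (f x - (\<Sum>n\<in>A. cas T n x *\<^sub>R fcoef T f n)))\<^sup>2)
     = (L2_norm T f)\<^sup>2 - (\<Sum>n\<in>A. (norm (fcoef T f n))\<^sup>2)"
proof -
  let ?c = "fcoef T f"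
  have i1: "set_integrable lborel {0..T} (\<lambda>x. (norm (f x))\<^sup>2)" by (rule L2_perD[OF f])
  have icas: "set_integrable lborel {0..T} (\<lambda>x. cas T n x *\<^sub>R f x)" for n
    by (rule set_integrable_cas_scaleR[OF T L2_per_integrable[OF f]])
  have i2: "set_integrable lborel {0..T} (\<lambda>x. (cas T n x *\<^sub>R f x) \<bullet> ?c n)" for n
    using integrable_inner_left[OF icas[unfolded set_integrable_def, of n], of "?c n"]
    by (simp add: set_integrable_def mult.assoc)
  have e2: "(LBINT x:{0..T}. (cas T n x *\<^sub>R f x) \<bullet> ?c n) = (norm (?c n))\<^sup>2" for n
  proof -
    have "(LBINT x:{0..T}. (cas T n x *\<^sub>R f x) \<bullet> ?c n) = (LBINT x:{0..T}. cas T n x *\<^sub>R f x) \<bullet> ?c n"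
      using integral_inner_left[OF icas[unfolded set_integrable_def, of n], of "?c n"]
      by (simp add: set_lebesgue_integral_def mult.assoc)
    then show ?thesis by (simp add: fcoef_def power2_norm_eq_inner)
  qed
  have i3: "set_integrable lborel {0..T} (\<lambda>x. cas T n x * cas T m x)" for n m
    by (intro borel_integrable_atLeastAtMost' continuous_intros)
  have "(norm (f x - (\<Sum>n\<in>A. cas T n x *\<^sub>R ?c n)))\<^sup>2 =
     (norm (f x))\<^sup>2 - (\<Sum>n\<in>A. 2 * ((cas T n x *\<^sub>R f x) \<bullet> ?c n))
       + (\<Sum>n\<in>A. \<Sum>m\<in>A. (?c n \<bullet> ?c m) * (cas T n x * cas T m x))" for x
  proof -
    define S where "S = (\<Sum>n\<in>A. cas T n x *\<^sub>R ?c n)"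
    have fS: "f x \<bullet> S = (\<Sum>n\<in>A. (cas T n x *\<^sub>R f x) \<bullet> ?c n)"
      by (simp add: S_def inner_sum_right)
    have SS: "S \<bullet> S = (\<Sum>n\<in>A. \<Sum>m\<in>A. (?c n \<bullet> ?c m) * (cas T n x * cas T m x))"
      by (simp add: S_def inner_sum_left inner_sum_right sum_distrib_left mult_ac)
        (intro sum.cong refl, simp add: inner_commute)
    have "(norm (f x - S))\<^sup>2 = (norm (f x))\<^sup>2 - 2 * (f x \<bullet> S) + S \<bullet> S"
      by (simp add: power2_norm_eq_inner inner_diff_left inner_diff_right inner_commute)
    then show ?thesis unfolding fS SS by (simp add: S_def sum_distrib_left)
  qed
  then have "(LBINT x:{0..T}. (norm (f x - (\<Sum>n\<in>A. cas T n x *\<^sub>R ?c n)))\<^sup>2)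
    = (LBINT x:{0..T}. (norm (f x))\<^sup>2 - (\<Sum>n\<in>A. 2 * ((cas T n x *\<^sub>R f x) \<bullet> ?c n))
       + (\<Sum>n\<in>A. \<Sum>m\<in>A. (?c n \<bullet> ?c m) * (cas T n x * cas T m x)))" by simp
  also have "\<dots> = (L2_norm T f)\<^sup>2 - (\<Sum>n\<in>A. 2 * (norm (?c n))\<^sup>2)
       + (\<Sum>n\<in>A. \<Sum>m\<in>A. (?c n \<bullet> ?c m) * (if n = m then 1 else 0))"
    using A i1 i2 i3 
    by (simp add: set_integral_finite_sum set_integrable_finite_sum L2_norm_sq e2[unfolded inner_scaleR_left] cas_orthonormal[OF T])
  also have "(\<Sum>n\<in>A. \<Sum>m\<in>A. (?c n \<bullet> ?c m) * (if n = m then 1 else 0)) = (\<Sum>n\<in>A. (norm (?c n))\<^sup>2)"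
    using A by (simp add: power2_norm_eq_inner if_distrib[of "\<lambda>y. _ * y"] cong: if_cong)
  finally show ?thesis by (simp add: sum_distrib_left[symmetric])
qed

lemma bessel:
  fixes f :: "real \<Rightarrow> 'a::euclidean_space"
  assumes "T > 0" "f \<in> L2_per T" "finite A"
  shows "(\<Sum>n\<in>A. (norm (fcoef T f n))\<^sup>2) \<le> (L2_norm T f)\<^sup>2"
proof -
  have "0 \<le> (LBINT x:{0..T}. (norm (f x - (\<Sum>n\<in>A. cas T n x *\<^sub>R fcoef T f n)))\<^sup>2)"
    unfolding set_lebesgue_integral_def by (intro integral_nonneg_AE) auto
  then show ?thesis unfolding norm_diff_partial_sum[OF assms] by simp
qed

lemma has_weak_deriv_fcoef:
  assumes "T > 0" "has_weak_deriv T f g"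
  shows "freq T n *\<^sub>R fcoef T f (- n) = - fcoef T g n"
proof -
  have "(LBINT x:{0..T}. deriv (cas T n) x *\<^sub>R f x) = - (LBINT x:{0..T}. cas T n x *\<^sub>R g x)"
    using assms cas_per_test unfolding has_weak_deriv_def by blast
  moreover have "(LBINT x:{0..T}. deriv (cas T n) x *\<^sub>R f x) = freq T n *\<^sub>R (LBINT x:{0..T}. cas T (-n) x *\<^sub>R f x)"
    unfolding deriv_cas by (simp flip: set_integral_scaleR_right)
  ultimately show ?thesis by (simp add: fcoef_def)
qed

lemma weak_deriv_spec:
  assumes "f \<in> H1_per T"
  shows "weak_deriv T f \<in> L2_per T" "has_weak_deriv T f (weak_deriv T f)"
proof -
  have "\<exists>g. g \<in> L2_per T \<and> has_weak_deriv T f g" using assms by (auto simp: H1_per_def)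
  from someI_ex[OF this] show "weak_deriv T f \<in> L2_per T" "has_weak_deriv T f (weak_deriv T f)"
    by (auto simp: weak_deriv_def)
qed

text \<open>\<open>weak_deriv\<close> is an arbitrary choice. By completeness a weak derivative is
  determined by its Fourier coefficients up to a null set, so \<open>H1_norm\<close> can be computed
  from a classical derivative.\<close>

lemma has_weak_deriv_unique:
  assumes T: "T > 0" and g: "g \<in> L2_per T" "has_weak_deriv T f g" and h: "h \<in> L2_per T" "has_weak_deriv T f h"
  shows "AE x in lborel. x \<in> {0..T} \<longrightarrow> g x = h x"
proof -
  note i = L2_per_integrable[OF g(1)] L2_per_integrable[OF h(1)]
  have "fcoef T g n = fcoef T h n" for n
    using has_weak_deriv_fcoef[OF T g(2), of n] has_weak_deriv_fcoef[OF T h(2), of n] by simp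
  then have "fcoef T (\<lambda>x. g x - h x) n = 0" for n by (simp add: fcoef_diff[OF T i])
  then have "AE x in lborel. x \<in> {0..T} \<longrightarrow> g x - h x = 0"
    by (intro cas_complete[OF T]) (use i in \<open>auto simp: fcoef_def\<close>)
  then show ?thesis by simp
qed

text \<open>The index 0 contributes 1 / 0 = 0. On symmetric intervals the bound 4 - 2 / N is
  inductive because 2 / (N + 1)^2 \<le> 2 / N - 2 / (N + 1).\<close>

lemma sum_inverse_squares_int:
  assumes "finite (A :: int set)"
  shows "(\<Sum>n\<in>A. 1 / (real_of_int n)\<^sup>2) \<le> 4"
proof -
  have *: "(\<Sum>n\<in>{- int N..int N}. 1 / (real_of_int n)\<^sup>2) \<le> 4 - 2 / (if N = 0 then 1 else real N)" for N
  proof (induction N)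
    case (Suc N)
    have "{- int (Suc N)..int (Suc N)} = insert (int (Suc N)) (insert (- int (Suc N)) {- int N..int N})" by auto
    then have "(\<Sum>n\<in>{- int (Suc N)..int (Suc N)}. 1 / (real_of_int n)\<^sup>2)
       = (\<Sum>n\<in>{- int N..int N}. 1 / (real_of_int n)\<^sup>2) + 2 / (real N + 1)\<^sup>2"
      by (simp add: power2_eq_square algebra_simps)
    also have "\<dots> \<le> 4 - 2 / (real N + 1)"
    proof (cases "N = 0")
      case False
      have "2 / (real N + 1)\<^sup>2 \<le> 2 / (real N * (real N + 1))"
        using False by (intro divide_left_mono) (auto simp: power2_eq_square)
      also have "\<dots> = 2 / real N - 2 / (real N + 1)" using False by (simp add: field_simps)
      finally show ?thesis using Suc False by simp
    qed simp
    finally show ?case by (simp add: add.commute)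
  qed simp
  have "finite (abs ` A)" using assms by simp
  define N where "N = nat (Max (insert 0 (abs ` A)))"
  have "A \<subseteq> {- int N..int N}"
  proof
    fix n assume "n \<in> A"
    then have "\<bar>n\<bar> \<le> Max (insert 0 (abs ` A))" using assms by (intro Max_ge) auto
    then show "n \<in> {- int N..int N}" unfolding N_def by auto
  qed
  then have "(\<Sum>n\<in>A. 1 / (real_of_int n)\<^sup>2) \<le> (\<Sum>n\<in>{- int N..int N}. 1 / (real_of_int n)\<^sup>2)"
    by (intro sum_mono2) auto
  also have "\<dots> \<le> 4" using *[of N] by (auto split: if_splits intro: order_trans)
  finally show ?thesis .
qed

text \<open>Up to reflection of the index, a coefficient of f is one of the weak derivative divided
  by the frequency. The inequality 2 x y \<le> x^2 + y^2 splits this product into Bessel for the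
  derivative and the convergent series of 1 / n^2. The bound comes out quadratic in the norm, which
  suffices where only boundedness is wanted.\<close>

lemma sum_norm_fcoef_le:
  fixes f :: "real \<Rightarrow> 'a::euclidean_space"
  assumes T: "T > 0" and f: "f \<in> H1_per T" and A: "finite A"
  shows "(\<Sum>n\<in>A. norm (fcoef T f n)) \<le> (1 + T\<^sup>2) + (H1_norm T f)\<^sup>2"
proof -
  let ?g = "weak_deriv T f"
  note w = weak_deriv_spec[OF f]
  have f2: "f \<in> L2_per T" using f by (simp add: H1_per_def)
  have young: "y \<le> 1/2 + y\<^sup>2 / 2" for y :: real using sum_squares_bound[of y 1] by simp
  have "norm (fcoef T f n) \<le> (norm (fcoef T ?g (- n)))\<^sup>2 / 2 + (T / (2 * pi))\<^sup>2 / 2 * (1 / (real_of_int n)\<^sup>2)"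
    if "n \<noteq> 0" for n
  proof -
    define \<mu> where "\<mu> = \<bar>freq T n\<bar>"
    have \<mu>: "\<mu> > 0" "1 / \<mu> = T / (2 * pi) * (1 / \<bar>real_of_int n\<bar>)" using that T by (auto simp: \<mu>_def abs_mult)
    have "norm (fcoef T ?g (- n)) = norm (freq T (- n) *\<^sub>R fcoef T f (- (- n)))"
      using has_weak_deriv_fcoef[OF T w(2), of "-n"] by (metis norm_minus_cancel)
    then have "norm (fcoef T ?g (- n)) = \<mu> * norm (fcoef T f n)" by (simp add: \<mu>_def)
    then have "norm (fcoef T f n) = norm (fcoef T ?g (- n)) * (1 / \<mu>)" using \<mu>(1) by simp
    also have "\<dots> \<le> (norm (fcoef T ?g (- n)))\<^sup>2 / 2 + (1 / \<mu>)\<^sup>2 / 2"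
      using sum_squares_bound[of "norm (fcoef T ?g (- n))" "1 / \<mu>"] by simp
    finally show ?thesis unfolding \<mu>(2) by (simp add: power_mult_distrib power_divide)
  qed
  then have "(\<Sum>n\<in>A-{0}. norm (fcoef T f n))
     \<le> (\<Sum>n\<in>A-{0}. (norm (fcoef T ?g (- n)))\<^sup>2 / 2 + (T / (2 * pi))\<^sup>2 / 2 * (1 / (real_of_int n)\<^sup>2))"
    by (intro sum_mono) auto
  also have "\<dots> = (\<Sum>n\<in>A-{0}. (norm (fcoef T ?g (- n)))\<^sup>2) / 2 + (T / (2 * pi))\<^sup>2 / 2 * (\<Sum>n\<in>A-{0}. 1 / (real_of_int n)\<^sup>2)"
    by (simp only: sum.distrib sum_divide_distrib[symmetric] sum_distrib_left[symmetric])
  also have "(\<Sum>n\<in>A-{0}. (norm (fcoef T ?g (- n)))\<^sup>2) = (\<Sum>n\<in>uminus ` (A-{0}). (norm (fcoef T ?g n))\<^sup>2)"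
    by (subst sum.reindex) (auto simp: inj_on_def)
  also have "\<dots> \<le> (L2_norm T ?g)\<^sup>2" by (rule bessel[OF T w(1)]) (use A in auto)
  also have "(\<Sum>n\<in>A-{0}. 1 / (real_of_int n)\<^sup>2) \<le> 4" by (rule sum_inverse_squares_int) (use A in auto)
  finally have 1: "(\<Sum>n\<in>A-{0}. norm (fcoef T f n)) \<le> (L2_norm T ?g)\<^sup>2 / 2 + (T / (2 * pi))\<^sup>2 / 2 * 4"
    by (simp add: mult_left_mono)
  have "(norm (fcoef T f 0))\<^sup>2 \<le> (L2_norm T f)\<^sup>2" using bessel[OF T f2, of "{0}"] by simp
  then have 2: "norm (fcoef T f 0) \<le> 1 / 2 + (L2_norm T f)\<^sup>2 / 2" using young[of "norm (fcoef T f 0)"] by linarith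
  have 3: "(T / (2 * pi))\<^sup>2 / 2 * 4 \<le> T\<^sup>2"
  proof -
    have "T / (2 * pi) \<le> T / 2" using T pi_gt3 by (intro divide_left_mono) auto
    then have "(T / (2 * pi))\<^sup>2 \<le> (T / 2)\<^sup>2" using T by (intro power_mono) auto
    also have "(T / 2)\<^sup>2 = T\<^sup>2 / 4" by (simp add: power_divide)
    finally show ?thesis using zero_le_power2[of T] by linarith
  qed
  have "(\<Sum>n\<in>A. norm (fcoef T f n)) \<le> (\<Sum>n\<in>insert 0 A. norm (fcoef T f n))"
    using A by (intro sum_mono2) auto
  also have "\<dots> = norm (fcoef T f 0) + (\<Sum>n\<in>A-{0}. norm (fcoef T f n))"
    using A by (simp add: sum.insert_remove)
  finally have "(\<Sum>n\<in>A. norm (fcoef T f n)) \<le> norm (fcoef T f 0) + (\<Sum>n\<in>A-{0}. norm (fcoef T f n))" .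
  moreover have "(H1_norm T f)\<^sup>2 = (L2_norm T f)\<^sup>2 + (L2_norm T ?g)\<^sup>2" by (simp add: H1_norm_def)
  ultimately show ?thesis
    using 1 2 3 zero_le_power2[of "L2_norm T f"] zero_le_power2[of "L2_norm T ?g"] by linarith
qed

text \<open>Absolute summability makes the series converge uniformly to a continuous g; uniform
  convergence gives g the coefficients of f, and completeness identifies the two. The limit runs
  along finite sets of indices, so the integers need no enumeration.\<close>

lemma H1_uniform_fourier:
  fixes f :: "real \<Rightarrow> 'a::euclidean_space"
  assumes T: "T > 0" and f: "f \<in> H1_per T"
  obtains g where "continuous_on UNIV g" "AE x in lborel. x \<in> {0..T} \<longrightarrow> f x = g x"
    "uniform_limit UNIV (\<lambda>A x. \<Sum>n\<in>A. cas T n x *\<^sub>R fcoef T f n) g (finite_subsets_at_top UNIV)"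
proof -
  let ?S = "\<lambda>A x. \<Sum>n\<in>A. cas T n x *\<^sub>R fcoef T f n" and ?F = "finite_subsets_at_top (UNIV :: int set)"
  define g where "g = (\<lambda>x. \<Sum>\<^sub>\<infinity>n\<in>UNIV. cas T n x *\<^sub>R fcoef T f n)"
  have f2: "f \<in> L2_per T" using f by (simp add: H1_per_def)
  have "(\<lambda>n. norm (fcoef T f n)) summable_on UNIV"
    by (rule nonneg_bdd_above_summable_on) (use sum_norm_fcoef_le[OF T f] in \<open>auto intro!: bdd_aboveI\<close>)
  then have "(\<lambda>n. 2 / sqrt T * norm (fcoef T f n)) summable_on UNIV" by (rule summable_on_cmult_right)
  then have ul: "uniform_limit UNIV ?S g ?F" unfolding g_def
    by (rule Weierstrass_m_test_general[rotated])
      (use mult_right_mono[OF abs_cas_le[OF T] norm_ge_zero] in simp)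
  have cS: "continuous_on UNIV (?S A)" for A by (intro continuous_intros)
  have cg: "continuous_on UNIV g"
    by (rule uniform_limit_theorem[OF _ ul]) (auto intro: always_eventually cS)
  have lim: "((\<lambda>A. fcoef T (?S A) n) \<longlongrightarrow> fcoef T g n) ?F" for n
  proof (rule tendstoI)
    fix e :: real assume e: "e > 0"
    define e' where "e' = e / (2 / sqrt T * T + 1)"
    have e': "e' > 0" using e T by (auto simp: e'_def add_pos_pos intro!: divide_pos_pos)
    have "\<forall>\<^sub>F A in ?F. \<forall>x\<in>UNIV. dist (?S A x) (g x) < e'" using ul e' by (rule uniform_limitD)
    then show "\<forall>\<^sub>F A in ?F. dist (fcoef T (?S A) n) (fcoef T g n) < e"
    proof eventually_elim
      case (elim A)
      have i: "set_integrable lborel {0..T} (?S A)" "set_integrable lborel {0..T} g"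
        by (rule borel_integrable_atLeastAtMost'[OF continuous_on_subset[OF cS subset_UNIV]],
            rule borel_integrable_atLeastAtMost'[OF continuous_on_subset[OF cg subset_UNIV]])
      have d: "fcoef T (?S A) n - fcoef T g n = fcoef T (\<lambda>x. ?S A x - g x) n"
        by (rule fcoef_diff[OF T i, symmetric])
      have "norm (fcoef T (\<lambda>x. ?S A x - g x) n) \<le> (LBINT x:{0..T}. norm (cas T n x *\<^sub>R (?S A x - g x)))"
        by (intro norm_fcoef_le T set_integral_diff(1) i)
      moreover have "\<dots> \<le> (LBINT x:{0..T}. 2 / sqrt T * e')"
      proof (rule set_integral_mono)
        show "set_integrable lborel {0..T} (\<lambda>x. norm (cas T n x *\<^sub>R (?S A x - g x)))"
          by (intro set_integrable_norm set_integrable_cas_scaleR T set_integral_diff(1) i)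
        show "norm (cas T n x *\<^sub>R (?S A x - g x)) \<le> 2 / sqrt T * e'" for x
          using elim[rule_format, of x] abs_cas_le[OF T, of n x] T e'
          unfolding norm_scaleR by (intro mult_mono) (auto simp: dist_norm)
      qed (rule set_integrable_const_Icc)
      moreover have "(LBINT x:{0..T}. 2 / sqrt T * e') = (2 / sqrt T * T) * e'"
        using T by (simp add: set_lebesgue_integral_def)
      moreover have "(2 / sqrt T * T) * e' < e"
        using T e unfolding e'_def by (simp add: field_simps add_pos_pos)
      ultimately show ?case unfolding dist_norm d by linarith
    qed
  qed
  have coefS: "fcoef T (?S A) n = (if n \<in> A then fcoef T f n else 0)" if "finite A" for A n
  proof -
    have "fcoef T (?S A) n = (LBINT x:{0..T}. \<Sum>m\<in>A. (cas T n x * cas T m x) *\<^sub>R fcoef T f m)"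
      by (simp add: fcoef_def scaleR_sum_right)
    also have "\<dots> = (\<Sum>m\<in>A. LBINT x:{0..T}. (cas T n x * cas T m x) *\<^sub>R fcoef T f m)"
      using that by (intro set_integral_finite_sum borel_integrable_atLeastAtMost' continuous_intros)
    also have "\<dots> = (\<Sum>m\<in>A. (if n = m then 1 else 0) *\<^sub>R fcoef T f m)"
    proof (intro sum.cong refl)
      fix m
      have "(LBINT x:{0..T}. (cas T n x * cas T m x) *\<^sub>R fcoef T f m) = (LBINT x:{0..T}. cas T n x * cas T m x) *\<^sub>R fcoef T f m"
      proof -
        have "set_integrable lborel {0..T} (\<lambda>x. cas T n x * cas T m x)"
          by (intro borel_integrable_atLeastAtMost' continuous_intros)
        then have "integrable lborel (\<lambda>x. indicat_real {0..T} x * (cas T n x * cas T m x))"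
          by (simp add: set_integrable_def)
        from integral_scaleR_left[OF this, of "fcoef T f m"] show ?thesis
          by (simp add: set_lebesgue_integral_def)
      qed
      then show "(LBINT x:{0..T}. (cas T n x * cas T m x) *\<^sub>R fcoef T f m) = (if n = m then 1 else 0) *\<^sub>R fcoef T f m"
        by (simp add: cas_orthonormal[OF T])
    qed
    also have "\<dots> = (if n \<in> A then fcoef T f n else 0)"
      using that by (simp add: if_distrib[of "\<lambda>y. y *\<^sub>R _"] cong: if_cong)
    finally show ?thesis .
  qed
  have "fcoef T g n = fcoef T f n" for n
  proof (rule tendsto_unique[OF _ lim])
    have "\<forall>\<^sub>F A in ?F. finite A \<and> {n} \<subseteq> A \<and> A \<subseteq> UNIV"
      unfolding eventually_finite_subsets_at_top by blast
    then have "\<forall>\<^sub>F A in ?F. fcoef T (?S A) n = fcoef T f n"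
      by eventually_elim (simp add: coefS)
    then show "((\<lambda>A. fcoef T (?S A) n) \<longlongrightarrow> fcoef T f n) ?F" by (rule tendsto_eventually)
  qed auto
  then have "fcoef T (\<lambda>x. f x - g x) n = 0" for n
    by (subst fcoef_diff[OF T L2_per_integrable[OF f2]])
      (auto intro!: borel_integrable_atLeastAtMost' continuous_on_subset[OF cg])
  then have "AE x in lborel. x \<in> {0..T} \<longrightarrow> f x - g x = 0"
    by (intro cas_complete[OF T] set_integral_diff(1) L2_per_integrable[OF f2] borel_integrable_atLeastAtMost'
       continuous_on_subset[OF cg]) (auto simp: fcoef_def)
  then show ?thesis using that cg ul by simp
qed

text \<open>The Sobolev embedding into bounded functions: each partial sum is at most 2 / sqrt T
  times the sum of the norms of the coefficients.\<close>

lemma H1_bounded: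
  fixes f :: "real \<Rightarrow> 'a::euclidean_space"
  assumes T: "T > 0" and f: "f \<in> H1_per T"
  shows "AE x in lborel. x \<in> {0..T} \<longrightarrow> norm (f x) \<le> 2 / sqrt T * (1 + T\<^sup>2 + (H1_norm T f)\<^sup>2)"
proof -
  let ?S = "\<lambda>A x. \<Sum>n\<in>A. cas T n x *\<^sub>R fcoef T f n" and ?F = "finite_subsets_at_top (UNIV :: int set)"
  obtain g where g: "AE x in lborel. x \<in> {0..T} \<longrightarrow> f x = g x" "uniform_limit UNIV ?S g ?F"
    by (rule H1_uniform_fourier[OF T f], rule that)
  have "norm (g x) \<le> 2 / sqrt T * (1 + T\<^sup>2 + (H1_norm T f)\<^sup>2)" for x
  proof (rule tendsto_le[OF _ tendsto_const])
    show "((\<lambda>A. norm (?S A x)) \<longlongrightarrow> norm (g x)) ?F"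
      by (intro tendsto_norm tendsto_uniform_limitI[OF g(2)]) auto
    have "\<forall>\<^sub>F A in ?F. finite A" by (auto simp: eventually_finite_subsets_at_top)
    then show "\<forall>\<^sub>F A in ?F. norm (?S A x) \<le> 2 / sqrt T * (1 + T\<^sup>2 + (H1_norm T f)\<^sup>2)"
    proof eventually_elim
      case (elim A)
      have "norm (?S A x) \<le> (\<Sum>n\<in>A. 2 / sqrt T * norm (fcoef T f n))"
        by (intro sum_norm_le) (simp only: norm_scaleR real_norm_def, intro mult_right_mono abs_cas_le[OF T] norm_ge_zero)
      also have "\<dots> = 2 / sqrt T * (\<Sum>n\<in>A. norm (fcoef T f n))" by (simp add: sum_distrib_left)
      also have "\<dots> \<le> 2 / sqrt T * (1 + T\<^sup>2 + (H1_norm T f)\<^sup>2)"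
        using sum_norm_fcoef_le[OF T f elim] T by (intro mult_left_mono) auto
      finally show ?case .
    qed
  qed auto
  then show ?thesis using g(1) by (auto elim!: eventually_mono)
qed

text \<open>Converse to \<open>bessel\<close>, phrased with finite sets of modes because the energy
  estimates will be available for finite sums. Uniform convergence of the Fourier series makes the
  remainder in \<open>norm_diff_partial_sum\<close> small.\<close>

lemma H1_parseval_le:
  fixes f :: "real \<Rightarrow> 'a::euclidean_space"
  assumes T: "T > 0" and f: "f \<in> H1_per T"
    and le: "\<And>A. finite A \<Longrightarrow> (\<Sum>n\<in>A. (norm (fcoef T f n))\<^sup>2) \<le> C"
  shows "(L2_norm T f)\<^sup>2 \<le> C"
proof (rule field_le_epsilon)
  fix e :: real assume e: "e > 0"
  let ?S = "\<lambda>A x. \<Sum>n\<in>A. cas T n x *\<^sub>R fcoef T f n" and ?F = "finite_subsets_at_top (UNIV :: int set)"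
  obtain g where g: "AE x in lborel. x \<in> {0..T} \<longrightarrow> f x = g x" "uniform_limit UNIV ?S g ?F"
    by (rule H1_uniform_fourier[OF T f], rule that)
  have f2: "f \<in> L2_per T" using f by (simp add: H1_per_def)
  have "\<forall>\<^sub>F A in ?F. \<forall>x\<in>UNIV. dist (?S A x) (g x) < sqrt (e / T)" using g(2) e T by (intro uniform_limitD) auto
  moreover have "\<forall>\<^sub>F A in ?F. finite A" by (auto simp: eventually_finite_subsets_at_top)
  ultimately have "\<forall>\<^sub>F A in ?F. finite A \<and> (\<forall>x. dist (?S A x) (g x) < sqrt (e / T))" by eventually_elim auto
  from eventually_happens[OF this] obtain A where A: "finite A" "\<And>x. dist (?S A x) (g x) < sqrt (e / T)"
    by auto
  have mS: "?S A \<in> borel_measurable borel" by measurable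
  have AE: "AE x in lborel. x \<in> {0..T} \<longrightarrow> norm ((norm (f x - ?S A x))\<^sup>2) \<le> e / T"
    using g(1)
  proof eventually_elim
    case (elim x)
    have "norm (g x - ?S A x) \<le> sqrt (e / T)" using A(2)[of x] by (simp add: dist_norm norm_minus_commute)
    then have "(norm (g x - ?S A x))\<^sup>2 \<le> (sqrt (e / T))\<^sup>2" by (intro power_mono) auto
    then show ?case using elim e T by simp
  qed
  have "(LBINT x:{0..T}. (norm (f x - ?S A x))\<^sup>2) \<le> (LBINT x:{0..T}. e / T)"
  proof (rule set_integral_mono_AE)
    show "set_integrable lborel {0..T} (\<lambda>x. (norm (f x - ?S A x))\<^sup>2)"
      by (rule set_integrable_bound'[OF set_integrable_const_Icc _ AE]) (use L2_perD(1)[OF f2] mS in measurable)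
  qed (use AE in \<open>auto intro: set_integrable_const_Icc\<close>)
  also have "(LBINT x:{0..T}. e / T) = e" using T by (simp add: set_lebesgue_integral_def)
  finally show "(L2_norm T f)\<^sup>2 \<le> C + e"
    using norm_diff_partial_sum[OF T f2 A(1)] le[OF A(1)] by linarith
qed

subsection \<open>Elliptic integrals and the dnoidal wave\<close>

abbreviation ell_integrand :: "real \<Rightarrow> real \<Rightarrow> real" where
  "ell_integrand k \<theta> \<equiv> 1 / sqrt (1 - k\<^sup>2 * (sin \<theta>)\<^sup>2)"

lemma modulus_sin_pos:
  assumes "0 \<le> k" "k < (1::real)"
  shows "0 < 1 - k\<^sup>2 * (sin \<theta>)\<^sup>2"
proof -
  have "k\<^sup>2 * (sin \<theta>)\<^sup>2 \<le> k\<^sup>2 * 1" by (intro mult_left_mono) (auto simp: abs_square_le_1)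
  also have "\<dots> < 1" using assms by (simp add: power_less_one_iff abs_square_less_1)
  finally show ?thesis by simp
qed

lemma continuous_on_ell_integrand:
  assumes "0 \<le> k" "k < 1" shows "continuous_on A (ell_integrand k)"
proof (intro continuous_intros ballI)
  show "sqrt (1 - k\<^sup>2 * (sin x)\<^sup>2) \<noteq> 0" for x using modulus_sin_pos[OF assms, of x] by simp
qed

lemma ell_integrand_ge_1:
  assumes "0 \<le> k" "k < 1" shows "1 \<le> ell_integrand k \<theta>"
proof -
  have "sqrt (1 - k\<^sup>2 * (sin \<theta>)\<^sup>2) \<le> sqrt 1" by (intro real_sqrt_le_mono) simp
  then show ?thesis using modulus_sin_pos[OF assms, of \<theta>] by (simp add: field_simps)
qed

lemma continuous_primitive:
  fixes f :: "real \<Rightarrow> real"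
  assumes f: "continuous_on UNIV f"
  shows "((\<lambda>x. LBINT y=(0::real)..x. f y) has_real_derivative f x) (at x)"
proof -
  define A where "A = {- \<bar>x\<bar> - 1..\<bar>x\<bar> + 1}"
  have "((\<lambda>u. LBINT y=(0::real)..u. f y) has_vector_derivative f x) (at x within A)"
    unfolding A_def by (rule interval_integral_FTC2) (auto intro: continuous_on_subset[OF f])
  moreover have "at x within A = at x" by (rule at_within_interior) (auto simp: A_def)
  ultimately show ?thesis by (simp add: has_real_derivative_iff_has_vector_derivative)
qed

lemma ellF_has_real_derivative:
  assumes "0 \<le> k" "k < 1"
  shows "(ellF k has_real_derivative ell_integrand k x) (at x within S)"
  using continuous_primitive[OF continuous_on_ell_integrand[OF assms], of x]
  by (simp add: ellF_def[abs_def] zero_ereal_def has_field_derivative_at_within)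

lemma ellF_0 [simp]: "ellF k 0 = 0"
  by (simp add: ellF_def zero_ereal_def[symmetric])

text \<open>The integrand is at least 1. This one expansion estimate yields injectivity and
  surjectivity of \<open>ellF k\<close> and makes the amplitude 1-Lipschitz.\<close>

lemma ellF_diff_ge:
  assumes "0 \<le> k" "k < 1" "a \<le> b"
  shows "b - a \<le> ellF k b - ellF k a"
proof -
  have "ellF k a - a \<le> ellF k b - b"
  proof (rule DERIV_nonneg_imp_nondecreasing[OF assms(3)])
    fix x
    have "((\<lambda>x. ellF k x - x) has_real_derivative ell_integrand k x - 1) (at x)"
      by (intro derivative_intros ellF_has_real_derivative assms)
    then show "\<exists>y. ((\<lambda>x. ellF k x - x) has_real_derivative y) (at x) \<and> 0 \<le> y"
      using ell_integrand_ge_1[OF assms(1,2), of x] by fastforce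
  qed
  then show ?thesis by simp
qed

lemma abs_ellF_diff_ge:
  assumes "0 \<le> k" "k < 1"
  shows "\<bar>b - a\<bar> \<le> \<bar>ellF k b - ellF k a\<bar>"
  using ellF_diff_ge[OF assms, of a b] ellF_diff_ge[OF assms, of b a] by linarith

lemma ex1_ellF:
  assumes "0 \<le> k" "k < 1"
  shows "\<exists>!\<phi>. ellF k \<phi> = x"
proof (rule ex_ex1I)
  have "ellF k (- \<bar>x\<bar>) \<le> x" "x \<le> ellF k \<bar>x\<bar>"
    using ellF_diff_ge[OF assms, of "- \<bar>x\<bar>" 0] ellF_diff_ge[OF assms, of 0 "\<bar>x\<bar>"] by auto
  moreover have "continuous_on {- \<bar>x\<bar>..\<bar>x\<bar>} (ellF k)"
    using ellF_has_real_derivative[OF assms] by (rule DERIV_continuous_on)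
  ultimately show "\<exists>\<phi>. ellF k \<phi> = x" using IVT'[of "ellF k" "- \<bar>x\<bar>" x "\<bar>x\<bar>"] by auto
next
  fix a b assume "ellF k a = x" "ellF k b = x"
  then show "a = b" using abs_ellF_diff_ge[OF assms, of b a] by simp
qed

lemma ellF_jacobi_am [simp]: "0 \<le> k \<Longrightarrow> k < 1 \<Longrightarrow> ellF k (jacobi_am k x) = x"
  unfolding jacobi_am_def by (rule theI'[OF ex1_ellF])

lemma jacobi_am_eqI: "0 \<le> k \<Longrightarrow> k < 1 \<Longrightarrow> ellF k \<phi> = x \<Longrightarrow> jacobi_am k x = \<phi>"
  using abs_ellF_diff_ge[of k "jacobi_am k x" \<phi>] by simp

lemma jacobi_am_lipschitz:
  assumes "0 \<le> k" "k < 1" shows "\<bar>jacobi_am k x - jacobi_am k y\<bar> \<le> \<bar>x - y\<bar>"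
  using abs_ellF_diff_ge[OF assms, of "jacobi_am k x" "jacobi_am k y"] assms by simp

lemma isCont_jacobi_am: assumes "0 \<le> k" "k < 1" shows "isCont (jacobi_am k) x"
  unfolding isCont_def
proof (rule LIM_I)
  fix r :: real assume "r > 0"
  then show "\<exists>s>0. \<forall>y. y \<noteq> x \<and> norm (y - x) < s \<longrightarrow> norm (jacobi_am k y - jacobi_am k x) < r"
    using jacobi_am_lipschitz[OF assms] by (intro exI[of _ r]) (auto intro: le_less_trans)
qed

lemma jacobi_dn_pos: assumes "0 \<le> k" "k < 1" shows "jacobi_dn k x > 0"
  using modulus_sin_pos[OF assms] by (simp add: jacobi_dn_def)

lemma jacobi_dn_sq: assumes "0 \<le> k" "k < 1"
  shows "(jacobi_dn k x)\<^sup>2 = 1 - k\<^sup>2 * (sin (jacobi_am k x))\<^sup>2"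
  using modulus_sin_pos[OF assms, of "jacobi_am k x"] by (simp add: jacobi_dn_def)

lemma jacobi_am_has_real_derivative:
  assumes "0 \<le> k" "k < 1"
  shows "(jacobi_am k has_real_derivative jacobi_dn k x) (at x)"
proof -
  have "(jacobi_am k has_real_derivative inverse (ell_integrand k (jacobi_am k x))) (at x)"
  proof (rule DERIV_inverse_function[where a = "x - 1" and b = "x + 1"])
    show "ell_integrand k (jacobi_am k x) \<noteq> 0" using ell_integrand_ge_1[OF assms, of "jacobi_am k x"] by linarith
  qed (use assms in \<open>auto intro: ellF_has_real_derivative isCont_jacobi_am\<close>)
  then show ?thesis by (simp add: jacobi_dn_def)
qed

lemma jacobi_dn_has_real_derivative:
  assumes "0 \<le> k" "k < 1"
  shows "(jacobi_dn k has_real_derivative - (k\<^sup>2 * sin (jacobi_am k x) * cos (jacobi_am k x))) (at x)"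
proof -
  note [derivative_intros] = DERIV_chain2[OF jacobi_am_has_real_derivative[OF assms]]
  have "(jacobi_dn k has_real_derivative
     inverse (sqrt (1 - k\<^sup>2 * (sin (jacobi_am k x))\<^sup>2)) / 2 * (- (k\<^sup>2 * (2 * sin (jacobi_am k x) * (cos (jacobi_am k x) * jacobi_dn k x))))) (at x)"
    unfolding jacobi_dn_def[abs_def]
    using modulus_sin_pos[OF assms, of "jacobi_am k x"]
    by (auto intro!: derivative_eq_intros simp: jacobi_dn_def)
  then show ?thesis using jacobi_dn_pos[OF assms, of x] unfolding jacobi_dn_def[symmetric]
    by (simp add: field_simps)
qed

text \<open>By periodicity of the integrand the increment over length pi is constant, and by its
  symmetry about pi / 2 that increment is twice the value at pi / 2. Both facts are read off from
  functions with derivative 0.\<close>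

lemma ellF_add_pi:
  assumes "0 \<le> k" "k < 1"
  shows "ellF k (\<phi> + pi) = ellF k \<phi> + 2 * ellF k (pi / 2)"
proof -
  note D = DERIV_chain2[OF ellF_has_real_derivative[OF assms]]
  have 1: "ellF k (\<phi> + pi) - ellF k \<phi> = ellF k (0 + pi) - ellF k 0"
  proof (rule DERIV_isconst_all[rule_format, where f = "\<lambda>\<phi>. ellF k (\<phi> + pi) - ellF k \<phi>"])
    show "((\<lambda>\<phi>. ellF k (\<phi> + pi) - ellF k \<phi>) has_real_derivative 0) (at x)" for x
      by (rule derivative_eq_intros D ellF_has_real_derivative refl assms)+ simp
  qed
  have 2: "ellF k 0 + ellF k (pi - 0) = ellF k (pi / 2) + ellF k (pi - pi / 2)"
  proof (rule DERIV_isconst_all[rule_format, where f = "\<lambda>\<phi>. ellF k \<phi> + ellF k (pi - \<phi>)"])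
    show "((\<lambda>\<phi>. ellF k \<phi> + ellF k (pi - \<phi>)) has_real_derivative 0) (at x)" for x
      by (rule derivative_eq_intros D ellF_has_real_derivative refl assms)+ simp
  qed
  show ?thesis using 1 2 by simp
qed

text \<open>Substitution t = sin x. The integrand in t is singular at 1, so the substitution rule
  for nonnegative integrands with one-sided limits at the ends is needed.\<close>

lemma ellK_eq_ellF:
  assumes "0 \<le> k" "k < 1" shows "ellK k = ellF k (pi / 2)"
proof -
  let ?f = "\<lambda>t. 1 / sqrt ((1 - t\<^sup>2) * (1 - k\<^sup>2 * t\<^sup>2))"
  have eq: "?f (sin x) * cos x = ell_integrand k x" if "0 < x" "x < pi / 2" for x
  proof -
    have "cos x > 0" using that by (intro cos_gt_zero_pi) auto
    then have "sqrt ((1 - (sin x)\<^sup>2) * (1 - k\<^sup>2 * (sin x)\<^sup>2)) = cos x * sqrt (1 - k\<^sup>2 * (sin x)\<^sup>2)"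
      by (simp add: cos_squared_eq[symmetric] real_sqrt_mult)
    then show ?thesis using \<open>cos x > 0\<close> by simp
  qed
  have ein: "einterval (ereal 0) (ereal (pi / 2)) = {0<..<pi/2}" by (auto simp: einterval_def)
  have "(LBINT t=ereal 0..ereal 1. ?f t) = (LBINT x=ereal 0..ereal (pi / 2). ?f (sin x) * cos x)"
  proof (rule interval_integral_substitution_nonneg)
    show "DERIV sin x :> cos x" for x :: real by (rule DERIV_sin)
    show "isCont ?f (sin x)" if "ereal 0 < ereal x" "ereal x < ereal (pi / 2)" for x
    proof -
      have "cos x > 0" using that by (intro cos_gt_zero_pi) auto
      then have "1 - (sin x)\<^sup>2 > 0" by (simp add: cos_squared_eq[symmetric])
      then show ?thesis using modulus_sin_pos[OF assms, of x] by (intro continuous_intros) auto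
    qed
    show "0 \<le> ?f (sin x)" for x
      using modulus_sin_pos[OF assms, of x] by (auto simp: abs_square_le_1)
    show "0 \<le> cos x" if "ereal 0 \<le> ereal x" "ereal x \<le> ereal (pi / 2)" for x
      using that by (intro cos_ge_zero) auto
    have "((\<lambda>x. ereal (sin x)) \<longlongrightarrow> ereal (sin y)) (at y within S)" for y S
      by (intro tendsto_intros)
    from this[of 0 "{0<..}"] this[of "pi/2" "{..<pi/2}"]
    show "((ereal \<circ> sin \<circ> real_of_ereal) \<longlongrightarrow> ereal 0) (at_right (ereal 0))"
      "((ereal \<circ> sin \<circ> real_of_ereal) \<longlongrightarrow> ereal 1) (at_left (ereal (pi / 2)))"
      unfolding ereal_tendsto_simps1 by (simp_all add: o_def)
    have "set_integrable lborel {0<..<pi/2} (ell_integrand k)"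
      by (rule set_integrable_subset[OF borel_integrable_atLeastAtMost'[OF continuous_on_ell_integrand[OF assms], of 0 "pi/2"]]) auto
    then show "set_integrable lborel (einterval (ereal 0) (ereal (pi / 2))) (\<lambda>x. ?f (sin x) * cos x)"
      unfolding ein by (subst set_integrable_cong[OF refl refl, of _ _ "ell_integrand k"]) (use eq in auto)
  qed (auto simp: isCont_cos)
  also have "\<dots> = (LBINT x=ereal 0..ereal (pi / 2). ell_integrand k x)"
    by (rule interval_integral_cong) (use eq ein in auto)
  finally show ?thesis by (simp add: ellK_def ellF_def zero_ereal_def one_ereal_def)
qed

lemma ellK_ge: assumes "0 \<le> k" "k < 1" shows "pi / 2 \<le> ellK k"
  using ellF_diff_ge[OF assms, of 0 "pi / 2"] by (simp add: ellK_eq_ellF[OF assms])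

lemma ellK_pos: assumes "0 \<le> k" "k < 1" shows "0 < ellK k"
  using ellK_ge[OF assms] pi_gt_zero by linarith

text \<open>The modulus 0 turns \<open>wave_speed_parameter\<close> into pi^2 / L^2, the threshold
  for c, and so serves as the left end in the intermediate value argument for the modulus.\<close>

lemma ellK_0: "ellK 0 = pi / 2"
proof -
  have "ellF 0 (pi / 2) - pi / 2 = ellF 0 0 - 0"
  proof (rule DERIV_isconst_all[rule_format, where f = "\<lambda>x. ellF 0 x - x"])
    show "((\<lambda>x. ellF 0 x - x) has_real_derivative 0) (at x)" for x
      by (rule derivative_eq_intros ellF_has_real_derivative refl | simp)+
  qed
  then show ?thesis by (simp add: ellK_eq_ellF)
qed

lemma jacobi_am_add_period:
  assumes "0 \<le> k" "k < 1" shows "jacobi_am k (x + 2 * ellK k) = jacobi_am k x + pi"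
  by (rule jacobi_am_eqI[OF assms]) (simp add: ellF_add_pi ellK_eq_ellF assms)

lemma jacobi_dn_add_period:
  assumes "0 \<le> k" "k < 1" shows "jacobi_dn k (x + 2 * ellK k) = jacobi_dn k x"
  by (simp add: jacobi_dn_def jacobi_am_add_period[OF assms])

lemma jacobi_dn_0: assumes "0 \<le> k" "k < 1" shows "jacobi_dn k 0 = 1"
  using jacobi_am_eqI[OF assms ellF_0] by (simp add: jacobi_dn_def)

lemma jacobi_dn_ellK: assumes "0 \<le> k" "k < 1" shows "jacobi_dn k (ellK k) = sqrt (1 - k\<^sup>2)"
  unfolding jacobi_dn_def jacobi_am_eqI[OF assms ellK_eq_ellF[OF assms, symmetric]] by simp

lemma continuous_on_ellF_modulus: "continuous_on {0..<1} (\<lambda>k. ellF k \<phi>)"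
proof -
  have c: "continuous_on ({0..<1} \<times> cbox a b) (\<lambda>(k, \<theta>). ell_integrand k \<theta>)" for a b
    unfolding split_beta
  proof (intro continuous_intros ballI)
    fix z :: "real \<times> real" assume "z \<in> {0..<1} \<times> cbox a b"
    then show "sqrt (1 - (fst z)\<^sup>2 * (sin (snd z))\<^sup>2) \<noteq> 0"
      using modulus_sin_pos[of "fst z" "snd z"] by auto
  qed
  have i: "set_integrable lborel {a..b} (ell_integrand k)" if "k \<in> {0..<1}" for k a b
    using that by (intro borel_integrable_atLeastAtMost' continuous_on_ell_integrand) auto
  show ?thesis
  proof (cases "0 \<le> \<phi>")
    case True
    have "ellF k \<phi> = integral (cbox 0 \<phi>) (ell_integrand k)" if "k \<in> {0..<1}" for k
      using interval_integral_eq_integral[OF True i[OF that]] by (simp add: ellF_def zero_ereal_def)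
    then show ?thesis
      using integral_continuous_on_param[OF c, of 0 \<phi>] by (subst continuous_on_cong[OF refl]) auto
  next
    case False
    have "ellF k \<phi> = - integral (cbox \<phi> 0) (ell_integrand k)" if "k \<in> {0..<1}" for k
      using interval_integral_eq_integral[OF _ i[OF that], of \<phi> 0] False
      by (simp add: ellF_def zero_ereal_def interval_integral_endpoints_reverse[of "ereal 0" "ereal \<phi>"])
    then show ?thesis
      using continuous_on_minus[OF integral_continuous_on_param[OF c, of \<phi> 0]]
      by (subst continuous_on_cong[OF refl]) auto
  qed
qed

lemma tendsto_ellF_modulus:
  assumes "\<kappa> \<longlonglongrightarrow> k" "0 \<le> k" "k < 1" "\<And>n. 0 \<le> \<kappa> n" "\<And>n. \<kappa> n < 1"
  shows "(\<lambda>n. ellF (\<kappa> n) \<phi>) \<longlonglongrightarrow> ellF k \<phi>"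
  by (rule continuous_on_tendsto_compose[OF continuous_on_ellF_modulus assms(1)]) (use assms in auto)

lemma tendsto_ellK:
  assumes "\<kappa> \<longlonglongrightarrow> k" "0 \<le> k" "k < 1" "\<And>n. 0 \<le> \<kappa> n" "\<And>n. \<kappa> n < 1"
  shows "(\<lambda>n. ellK (\<kappa> n)) \<longlonglongrightarrow> ellK k"
  using tendsto_ellF_modulus[OF assms, of "pi / 2"] assms by (simp add: ellK_eq_ellF)

text \<open>Joint continuity without differentiating in the modulus: since
  \<open>ellF (\<kappa> n)\<close> expands distances, the amplitude at x misses its limit by at most
  the error of \<open>ellF (\<kappa> n)\<close> at the limiting amplitude.\<close>

lemma tendsto_jacobi_am:
  assumes "\<kappa> \<longlonglongrightarrow> k" "0 \<le> k" "k < 1" "\<And>n. 0 \<le> \<kappa> n" "\<And>n. \<kappa> n < 1" "X \<longlonglongrightarrow> x"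
  shows "(\<lambda>n. jacobi_am (\<kappa> n) (X n)) \<longlonglongrightarrow> jacobi_am k x"
proof -
  have "(\<lambda>n. jacobi_am (\<kappa> n) (X n) - jacobi_am k x) \<longlonglongrightarrow> 0"
  proof (rule Lim_null_comparison)
    show "(\<lambda>n. \<bar>X n - x\<bar> + \<bar>x - ellF (\<kappa> n) (jacobi_am k x)\<bar>) \<longlonglongrightarrow> 0"
      using assms tendsto_ellF_modulus[OF assms(1-5), of "jacobi_am k x"]
      by (auto intro!: tendsto_eq_intros)
    have "\<bar>jacobi_am (\<kappa> n) (X n) - jacobi_am k x\<bar> \<le> \<bar>X n - x\<bar> + \<bar>x - ellF (\<kappa> n) (jacobi_am k x)\<bar>" for n
      using jacobi_am_lipschitz[of "\<kappa> n" "X n" x] abs_ellF_diff_ge[of "\<kappa> n" "jacobi_am (\<kappa> n) x" "jacobi_am k x"] assms(4,5)[of n]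
      by simp
    then show "\<forall>\<^sub>F n in sequentially. norm (jacobi_am (\<kappa> n) (X n) - jacobi_am k x)
        \<le> \<bar>X n - x\<bar> + \<bar>x - ellF (\<kappa> n) (jacobi_am k x)\<bar>" by simp
  qed
  then show ?thesis by (simp add: LIM_zero_iff)
qed

text \<open>The map that \<open>dnoidal_modulus\<close> inverts: it sends a modulus to the c whose
  dnoidal wave has that modulus, and the profile then solves D'' = 2 C D - 2 D^3 with C this value.
  The velocity of the travelling waves is a different quantity, \<open>tw_speed\<close>.\<close>

definition wave_speed_parameter :: "real \<Rightarrow> real \<Rightarrow> real" where
  "wave_speed_parameter L k = 2 * (ellK k)\<^sup>2 / L\<^sup>2 * (2 - k\<^sup>2)"

section \<open>Strict monotonicity of this parameter in the modulus\<close>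

lemma modulus_product_identity:
  fixes s w :: real
  assumes "s < 2"
  shows "(1 - s + s\<^sup>2 * w) / (2 - s)\<^sup>2 = (1 - (s / (2 - s))\<^sup>2 * (1 - 4 * w)) / 4"
proof -
  have "(1 - (s / (2 - s))\<^sup>2 * (1 - 4 * w)) / 4 = ((2 - s)\<^sup>2 - s\<^sup>2 * (1 - 4 * w)) / (4 * (2 - s)\<^sup>2)"
    using assms by (simp add: field_simps)
  also have "(2 - s)\<^sup>2 - s\<^sup>2 * (1 - 4 * w) = 4 * (1 - s + s\<^sup>2 * w)" by (simp add: power2_eq_square algebra_simps)
  also have "4 * (1 - s + s\<^sup>2 * w) / (4 * (2 - s)\<^sup>2) = (1 - s + s\<^sup>2 * w) / (2 - s)\<^sup>2"
    by (rule mult_divide_mult_cancel_left) simp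
  finally show ?thesis by (rule sym)
qed

text \<open>Adding the reflection of \<theta> at pi / 4 makes the integrand of K(k) sqrt (2 - k^2)
  monotone in k pointwise. With A = 1 - k^2 sin^2 and B = 1 - k^2 cos^2 one has A + B = 2 - k^2, and
  the symmetrised integrand sqrt (A + B) (1 / sqrt A + 1 / sqrt B) depends on sqrt (A B) / (A + B)
  alone.\<close>

definition sym_integrand :: "real \<Rightarrow> real \<Rightarrow> real" where
  "sym_integrand k \<theta> = sqrt (2 - k\<^sup>2) * (ell_integrand k \<theta> + ell_integrand k (pi / 2 - \<theta>))"

text \<open>This is sqrt (A B) / (A + B), written so that the modulus enters only through k^2 / (2 -
  k^2), which increases with k.\<close>

definition sym_product :: "real \<Rightarrow> real \<Rightarrow> real" where
  "sym_product k \<theta> = sqrt ((1 - (k\<^sup>2 / (2 - k\<^sup>2))\<^sup>2 * (1 - 4 * ((sin \<theta>)\<^sup>2 * (cos \<theta>)\<^sup>2))) / 4)"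

lemma sin_cos_product_le: "4 * ((sin \<theta>)\<^sup>2 * (cos \<theta>)\<^sup>2) \<le> (1::real)"
proof -
  have "4 * ((sin \<theta>)\<^sup>2 * (cos \<theta>)\<^sup>2) = (sin (2 * \<theta>))\<^sup>2" by (simp add: sin_double power_mult_distrib)
  then show ?thesis by (simp add: abs_square_le_1)
qed

lemma modulus_sq_less_1: "0 \<le> k \<Longrightarrow> k < 1 \<Longrightarrow> k\<^sup>2 < (1::real)"
  by (simp add: abs_square_less_1)

lemma sym_integrand_sq:
  assumes k: "0 \<le> k" "k < 1"
  shows "sym_product k \<theta> > 0" "(sym_integrand k \<theta>)\<^sup>2 = 1 / (sym_product k \<theta>)\<^sup>2 + 2 / sym_product k \<theta>"
proof -
  define A where "A = 1 - k\<^sup>2 * (sin \<theta>)\<^sup>2"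
  define B where "B = 1 - k\<^sup>2 * (cos \<theta>)\<^sup>2"
  have AB: "A > 0" "B > 0"
    using modulus_sin_pos[OF k, of \<theta>] modulus_sin_pos[OF k, of "pi / 2 - \<theta>"]
    by (simp_all add: A_def B_def sin_cos_eq[symmetric] sin_diff)
  have s: "2 - k\<^sup>2 > 0" using modulus_sq_less_1[OF k] by linarith
  have sum: "A + B = 2 - k\<^sup>2" 
  proof -
    have "A + B = 2 - k\<^sup>2 * ((sin \<theta>)\<^sup>2 + (cos \<theta>)\<^sup>2)" unfolding A_def B_def by algebra
    then show ?thesis by simp
  qed
  have prod: "A * B = 1 - k\<^sup>2 + (k\<^sup>2)\<^sup>2 * ((sin \<theta>)\<^sup>2 * (cos \<theta>)\<^sup>2)"
  proof -
    have "A * B = 1 - k\<^sup>2 * ((sin \<theta>)\<^sup>2 + (cos \<theta>)\<^sup>2) + (k\<^sup>2)\<^sup>2 * ((sin \<theta>)\<^sup>2 * (cos \<theta>)\<^sup>2)"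
      unfolding A_def B_def by algebra
    then show ?thesis by simp
  qed
  have "(1 - (k\<^sup>2 / (2 - k\<^sup>2))\<^sup>2 * (1 - 4 * ((sin \<theta>)\<^sup>2 * (cos \<theta>)\<^sup>2))) / 4 = A * B / (A + B)\<^sup>2"
    unfolding prod sum by (rule modulus_product_identity[symmetric]) (use s in simp)
  then have P: "sym_product k \<theta> = sqrt (A * B) / (A + B)"
    using AB by (simp add: sym_product_def real_sqrt_divide)
  show "sym_product k \<theta> > 0" unfolding P using AB by simp
  have G: "sym_integrand k \<theta> = sqrt (A + B) * (1 / sqrt A + 1 / sqrt B)"
    unfolding sum by (simp add: sym_integrand_def A_def B_def sin_diff)
  have "(1 / sqrt A + 1 / sqrt B)\<^sup>2 = (A + B) / (A * B) + 2 / sqrt (A * B)"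
    using AB by (simp add: power2_sum power_divide field_simps real_sqrt_mult)
  then have "(sym_integrand k \<theta>)\<^sup>2 = (A + B) * ((A + B) / (A * B) + 2 / sqrt (A * B))"
    unfolding G power_mult_distrib using AB by simp
  also have "\<dots> = 1 / (sym_product k \<theta>)\<^sup>2 + 2 / sym_product k \<theta>"
    unfolding P using AB by (simp add: power_divide field_simps power2_eq_square)
  finally show "(sym_integrand k \<theta>)\<^sup>2 = 1 / (sym_product k \<theta>)\<^sup>2 + 2 / sym_product k \<theta>" .
qed

lemma sym_integrand_nonneg: assumes "0 \<le> k" "k < 1" shows "0 \<le> sym_integrand k \<theta>"
  using ell_integrand_ge_1[OF assms, of \<theta>] ell_integrand_ge_1[OF assms, of "pi / 2 - \<theta>"] modulus_sq_less_1[OF assms]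
  unfolding sym_integrand_def by (intro mult_nonneg_nonneg) auto

lemma modulus_ratio_less:
  fixes k k' :: real
  assumes "0 \<le> k" "k < k'" "k' < 1"
  shows "(k\<^sup>2 / (2 - k\<^sup>2))\<^sup>2 < (k'\<^sup>2 / (2 - k'\<^sup>2))\<^sup>2"
proof -
  have 1: "k\<^sup>2 < k'\<^sup>2" "k'\<^sup>2 < 1" using assms by (auto intro: power_strict_mono modulus_sq_less_1)
  have "k\<^sup>2 / (2 - k\<^sup>2) < k'\<^sup>2 / (2 - k'\<^sup>2)"
    using 1 zero_le_power2[of k] by (intro frac_less) auto
  then show ?thesis using 1 by (intro power_strict_mono) auto
qed

text \<open>Where 4 sin^2 cos^2 = 1 the two sides agree, so strictness is recorded only where the
  product of sine and cosine is 0. The single point 0 then suffices for a strict inequality between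
  the integrals.\<close>

lemma sym_integrand_mono:
  assumes k: "0 \<le> k" "k < k'" "k' < 1"
  shows "sym_integrand k \<theta> \<le> sym_integrand k' \<theta>"
    and "(sin \<theta>)\<^sup>2 * (cos \<theta>)\<^sup>2 = 0 \<Longrightarrow> sym_integrand k \<theta> \<noteq> sym_integrand k' \<theta>"
proof -
  have k': "0 \<le> k'" "k < 1" using k by auto
  let ?w = "1 - 4 * ((sin \<theta>)\<^sup>2 * (cos \<theta>)\<^sup>2)"
  note P = sym_integrand_sq[OF k(1) k'(2), of \<theta>] sym_integrand_sq[OF k'(1) k(3), of \<theta>]
  note r = modulus_ratio_less[OF k]
  have w: "0 \<le> ?w" using sin_cos_product_le[of \<theta>] by simp
  have "sym_product k' \<theta> \<le> sym_product k \<theta>"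
    unfolding sym_product_def 
    by (intro real_sqrt_le_mono divide_right_mono diff_left_mono mult_right_mono less_imp_le[OF r] w) simp
  then have "(sym_integrand k \<theta>)\<^sup>2 \<le> (sym_integrand k' \<theta>)\<^sup>2"
    unfolding P using P(1,3) by (intro add_mono divide_left_mono power_mono mult_pos_pos zero_less_power) auto
  then show "sym_integrand k \<theta> \<le> sym_integrand k' \<theta>"
    using sym_integrand_nonneg[OF k'(1) k(3)] by (rule power2_le_imp_le)
  assume 0: "(sin \<theta>)\<^sup>2 * (cos \<theta>)\<^sup>2 = 0"
  have "sym_product k' \<theta> < sym_product k \<theta>"
    unfolding sym_product_def 0 
    by (intro real_sqrt_less_mono divide_strict_right_mono diff_strict_left_mono mult_strict_right_mono r) simp_all
  then have "(sym_integrand k \<theta>)\<^sup>2 < (sym_integrand k' \<theta>)\<^sup>2"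
    unfolding P using P(1,3) by (intro add_strict_mono divide_strict_left_mono power_strict_mono mult_pos_pos zero_less_power) auto
  then show "sym_integrand k \<theta> \<noteq> sym_integrand k' \<theta>" by auto
qed

lemma continuous_on_sym_integrand:
  assumes "0 \<le> k" "k < 1" shows "continuous_on A (sym_integrand k)"
proof -
  have "continuous_on A (\<lambda>\<theta>. ell_integrand k (pi / 2 - \<theta>))"
    by (rule continuous_on_compose2[OF continuous_on_ell_integrand[OF assms, of UNIV]]) (auto intro!: continuous_intros)
  then show ?thesis unfolding sym_integrand_def[abs_def]
    by (intro continuous_on_mult continuous_on_add continuous_on_const continuous_on_ell_integrand assms)
qed

lemma sym_integrand_has_integral:
  assumes "0 \<le> k" "k < 1"
  shows "(sym_integrand k has_integral 2 * (ellK k * sqrt (2 - k\<^sup>2))) {0..pi / 2}"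
proof -
  let ?F = "\<lambda>\<theta>. sqrt (2 - k\<^sup>2) * (ellF k \<theta> - ellF k (pi / 2 - \<theta>))"
  have "(sym_integrand k has_integral (?F (pi / 2) - ?F 0)) {0..pi / 2}"
  proof (rule fundamental_theorem_of_calculus)
    fix x
    have "(?F has_real_derivative sqrt (2 - k\<^sup>2) * (ell_integrand k x - ell_integrand k (pi / 2 - x) * (0 - 1))) (at x within {0..pi / 2})"
      by (intro DERIV_cmult DERIV_diff ellF_has_real_derivative assms DERIV_chain2[OF ellF_has_real_derivative[OF assms]] DERIV_const DERIV_ident)
    then show "(?F has_vector_derivative sym_integrand k x) (at x within {0..pi / 2})"
      by (simp add: sym_integrand_def has_real_derivative_iff_has_vector_derivative)
  qed simp
  then show ?thesis by (simp add: ellK_eq_ellF[OF assms])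
qed

lemma ellK_sqrt_strict_mono:
  assumes k: "0 \<le> k" "k < k'" "k' < 1"
  shows "ellK k * sqrt (2 - k\<^sup>2) < ellK k' * sqrt (2 - k'\<^sup>2)"
proof -
  have k': "0 \<le> k'" "k < 1" using k by auto
  let ?f = "\<lambda>\<theta>. sym_integrand k' \<theta> - sym_integrand k \<theta>"
  have i: "(?f has_integral (2 * (ellK k' * sqrt (2 - k'\<^sup>2)) - 2 * (ellK k * sqrt (2 - k\<^sup>2)))) {0..pi / 2}"
    by (intro has_integral_diff sym_integrand_has_integral k k')
  have "0 \<le> 2 * (ellK k' * sqrt (2 - k'\<^sup>2)) - 2 * (ellK k * sqrt (2 - k\<^sup>2))"
    by (rule has_integral_nonneg[OF i]) (use sym_integrand_mono(1)[OF k] in auto)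
  moreover have "2 * (ellK k' * sqrt (2 - k'\<^sup>2)) - 2 * (ellK k * sqrt (2 - k\<^sup>2)) \<noteq> 0"
  proof
    assume 0: "2 * (ellK k' * sqrt (2 - k'\<^sup>2)) - 2 * (ellK k * sqrt (2 - k\<^sup>2)) = 0"
    \<comment> \<open>A continuous nonnegative function with integral 0 vanishes everywhere, in
      particular at 0, where the inequality is strict.\<close>
    have "?f 0 = 0"
    proof (rule has_integral_0_cbox_imp_0[where f = ?f and a = 0 and b = "pi / 2"])
      show "continuous_on (cbox 0 (pi / 2)) ?f"
        by (intro continuous_on_diff continuous_on_sym_integrand k k')
      show "(?f has_integral 0) (cbox 0 (pi / 2))" using i 0 by simp
    qed (use sym_integrand_mono(1)[OF k] pi_gt_zero in \<open>auto simp: box_real simp del: pi_gt_zero\<close>)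
    then show False using sym_integrand_mono(2)[OF k, of 0] by simp
  qed
  ultimately show ?thesis by linarith
qed

lemma wave_speed_parameter_eq:
  assumes "0 \<le> k" "k < 1"
  shows "wave_speed_parameter L k = 2 / L\<^sup>2 * (ellK k * sqrt (2 - k\<^sup>2))\<^sup>2"
  using modulus_sq_less_1[OF assms] by (simp add: wave_speed_parameter_def power_mult_distrib)

lemma wave_speed_parameter_strict_mono:
  assumes "L > 0" "0 \<le> k" "k < k'" "k' < 1"
  shows "wave_speed_parameter L k < wave_speed_parameter L k'"
proof -
  have "(ellK k * sqrt (2 - k\<^sup>2))\<^sup>2 < (ellK k' * sqrt (2 - k'\<^sup>2))\<^sup>2"
    using ellK_sqrt_strict_mono[OF assms(2-4)] ellK_pos[of k] modulus_sq_less_1[of k] assms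
    by (intro power_strict_mono) auto
  then show ?thesis using assms by (simp add: wave_speed_parameter_eq divide_strict_right_mono)
qed

text \<open>K(k) diverges as k tends to 1. With d = sqrt (1 - k^2) and y = pi / 2 - x the radicand
  is d^2 + k^2 sin^2 y \<le> (d + y)^2, and 1 / (d + y) integrates to a logarithm. This yields an
  explicit modulus whose parameter exceeds a given c.\<close>

lemma ellK_ge_ln:
  assumes k: "0 \<le> k" "k < 1"
  shows "- ln (sqrt (1 - k\<^sup>2)) \<le> ellK k"
proof -
  define d where "d = sqrt (1 - k\<^sup>2)"
  have d: "d > 0" "d\<^sup>2 = 1 - k\<^sup>2" using modulus_sq_less_1[OF k] by (auto simp: d_def)
  have "ellF k 0 + ln (d + pi / 2 - 0) \<le> ellF k (pi / 2) + ln (d + pi / 2 - pi / 2)"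
  proof (rule DERIV_nonneg_imp_nondecreasing[where f = "\<lambda>x. ellF k x + ln (d + pi / 2 - x)"])
    fix x assume x: "0 \<le> x" "x \<le> pi / 2"
    define y where "y = pi / 2 - x"
    have y: "0 \<le> y" "y \<le> pi / 2" using x by (auto simp: y_def)
    have "((\<lambda>x. ellF k x + ln (d + pi / 2 - x)) has_real_derivative (ell_integrand k x - 1 / (d + y))) (at x)"
      using x d by (auto intro!: derivative_eq_intros ellF_has_real_derivative k simp: y_def add_pos_nonneg)
    moreover have "1 / (d + y) \<le> ell_integrand k x"
    proof (rule divide_left_mono)
      have "sin x = cos y" by (simp add: y_def cos_diff)
      then have "1 - k\<^sup>2 * (sin x)\<^sup>2 = d\<^sup>2 + k\<^sup>2 * (sin y)\<^sup>2" unfolding d(2) by (simp add: cos_squared_eq algebra_simps)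
      also have "k\<^sup>2 * (sin y)\<^sup>2 \<le> 1 * y\<^sup>2"
        using modulus_sq_less_1[OF k] y sin_x_le_x[OF y(1)] by (intro mult_mono power_mono) (auto intro!: sin_ge_zero)
      also have "d\<^sup>2 + 1 * y\<^sup>2 \<le> (d + y)\<^sup>2" using d y by (simp add: power2_sum)
      finally show "sqrt (1 - k\<^sup>2 * (sin x)\<^sup>2) \<le> d + y" using d y by (intro real_le_lsqrt) auto
      show "0 < (d + y) * sqrt (1 - k\<^sup>2 * (sin x)\<^sup>2)" using modulus_sin_pos[OF k, of x] d y by (intro mult_pos_pos) auto
    qed simp
    ultimately show "\<exists>D. ((\<lambda>x. ellF k x + ln (d + pi / 2 - x)) has_real_derivative D) (at x) \<and> 0 \<le> D"
      by (intro exI[of _ "ell_integrand k x - 1 / (d + y)"]) simp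
  qed (use pi_gt_zero in simp)
  moreover have "0 \<le> ln (d + pi / 2)" using d pi_gt3 by (intro ln_ge_zero) auto
  ultimately show ?thesis by (simp add: ellK_eq_ellF[OF k] d_def)
qed

lemma wave_speed_parameter_continuous: "continuous_on {0..<1} (wave_speed_parameter L)"
proof -
  have "continuous_on {0..<1} ellK"
    using continuous_on_ellF_modulus[of "pi / 2"] by (subst continuous_on_cong[OF refl]) (auto simp: ellK_eq_ellF)
  then show ?thesis unfolding wave_speed_parameter_def[abs_def] divide_inverse by (intro continuous_intros)
qed

lemma dnoidal_modulus_ex1:
  assumes L: "L > 0" and c: "c > pi\<^sup>2 / L\<^sup>2"
  shows "\<exists>!k. 0 < k \<and> k < 1 \<and> c = 2 * (ellK k)\<^sup>2 / L\<^sup>2 * (2 - k\<^sup>2)"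
proof (rule ex_ex1I)
  have c0: "c > 0" using c L by (auto intro: le_less_trans[rotated])
  \<comment> \<open>The modulus \<open>\<kappa>\<close> is chosen with sqrt (1 - \<kappa>^2) = exp
    (- M). The logarithmic bound then gives K(\<kappa>) \<ge> M = L sqrt c, so that the parameter at
    \<open>\<kappa>\<close> is at least 2 c.\<close>
  define M where "M = L * sqrt c"
  have M: "M > 0" using L c0 by (simp add: M_def)
  define \<kappa> where "\<kappa> = sqrt (1 - exp (- 2 * M))"
  have \<kappa>: "0 \<le> \<kappa>" "\<kappa> < 1" "1 - \<kappa>\<^sup>2 = exp (- 2 * M)" using M by (auto simp: \<kappa>_def real_less_lsqrt)
  have "sqrt (1 - \<kappa>\<^sup>2) = exp (- M)" unfolding \<kappa>(3) by (rule real_sqrt_unique) (auto simp: power2_eq_square exp_add[symmetric])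
  then have K: "M \<le> ellK \<kappa>" using ellK_ge_ln[OF \<kappa>(1,2)] by simp
  have "c \<le> 2 * M\<^sup>2 / L\<^sup>2 * 1" using L c0 by (simp add: M_def power_mult_distrib)
  also have "\<dots> \<le> wave_speed_parameter L \<kappa>" unfolding wave_speed_parameter_def
    using M K L modulus_sq_less_1[OF \<kappa>(1,2)] by (intro mult_mono divide_right_mono power_mono mult_left_mono) auto
  finally have up: "c \<le> wave_speed_parameter L \<kappa>" .
  have lo: "wave_speed_parameter L 0 = pi\<^sup>2 / L\<^sup>2" by (simp add: wave_speed_parameter_def ellK_0 power_divide)
  have "continuous_on {0..\<kappa>} (wave_speed_parameter L)"
    by (rule continuous_on_subset[OF wave_speed_parameter_continuous]) (use \<kappa> in auto)
  then obtain k where k: "0 \<le> k" "k \<le> \<kappa>" "wave_speed_parameter L k = c"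
    using IVT'[of "wave_speed_parameter L" 0 c \<kappa>] lo c up \<kappa> by auto
  moreover have "k \<noteq> 0" using k lo c by auto
  ultimately show "\<exists>k. 0 < k \<and> k < 1 \<and> c = 2 * (ellK k)\<^sup>2 / L\<^sup>2 * (2 - k\<^sup>2)"
    using \<kappa> by (intro exI[of _ k]) (auto simp: wave_speed_parameter_def)
next
  fix k k' assume kk: "0 < k \<and> k < 1 \<and> c = 2 * (ellK k)\<^sup>2 / L\<^sup>2 * (2 - k\<^sup>2)"
    "0 < k' \<and> k' < 1 \<and> c = 2 * (ellK k')\<^sup>2 / L\<^sup>2 * (2 - k'\<^sup>2)"
  then have "wave_speed_parameter L k = wave_speed_parameter L k'"
    unfolding wave_speed_parameter_def by linarith
  then show "k = k'" using kk wave_speed_parameter_strict_mono[OF L, of k k'] wave_speed_parameter_strict_mono[OF L, of k' k]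
    by (cases k k' rule: linorder_cases) auto
qed

lemma dnoidal_modulus:
  assumes "L > 0" "c > pi\<^sup>2 / L\<^sup>2"
  shows "0 < dnoidal_modulus L c" "dnoidal_modulus L c < 1"
    "wave_speed_parameter L (dnoidal_modulus L c) = c"
  using theI'[OF dnoidal_modulus_ex1[OF assms]] unfolding dnoidal_modulus_def[symmetric] wave_speed_parameter_def by auto

lemma tendsto_wave_speed_parameter:
  assumes "\<kappa> \<longlonglongrightarrow> k" "0 \<le> k" "k < 1" "\<And>n. 0 \<le> \<kappa> n" "\<And>n. \<kappa> n < 1"
  shows "(\<lambda>n. wave_speed_parameter L (\<kappa> n)) \<longlonglongrightarrow> wave_speed_parameter L k"
  unfolding wave_speed_parameter_def divide_inverse by (intro tendsto_intros tendsto_ellK assms)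

section \<open>The dnoidal wave as a function of its modulus\<close>

definition dn_wave :: "real \<Rightarrow> real \<Rightarrow> real \<Rightarrow> real" where
  "dn_wave L k x = 2 * ellK k / L * jacobi_dn k (2 * ellK k / L * x)"

definition dn_wave' :: "real \<Rightarrow> real \<Rightarrow> real \<Rightarrow> real" where
  "dn_wave' L k x = - ((2 * ellK k / L)\<^sup>2 * k\<^sup>2 *
     sin (jacobi_am k (2 * ellK k / L * x)) * cos (jacobi_am k (2 * ellK k / L * x)))"

text \<open>The travelling waves keep c fixed and let the modulus move away from
  \<open>dnoidal_modulus L c\<close>, which is why profiles are indexed by k instead of c.\<close>

lemma dnoidal_wave_eq: "dnoidal_wave L c = dn_wave L (dnoidal_modulus L c)"
  by (rule ext) (simp add: dnoidal_wave_def dn_wave_def Let_def)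

context
  fixes L k :: real
  assumes L: "L > 0" and k: "0 \<le> k" "k < 1"
begin

lemma eta_pos: "2 * ellK k / L > 0" using L ellK_pos[OF k] by simp

lemma dn_wave_has_real_derivative: "(dn_wave L k has_real_derivative dn_wave' L k x) (at x)"
proof -
  have "((\<lambda>x. 2 * ellK k / L * jacobi_dn k (2 * ellK k / L * x)) has_real_derivative dn_wave' L k x) (at x)"
    by (rule derivative_eq_intros DERIV_chain2[OF jacobi_dn_has_real_derivative[OF k]] refl)+
       (simp add: dn_wave'_def power2_eq_square)
  then show ?thesis by (simp add: dn_wave_def[abs_def])
qed

lemma dn_wave'_has_real_derivative:
  "(dn_wave' L k has_real_derivative 2 * wave_speed_parameter L k * dn_wave L k x - 2 * (dn_wave L k x) ^ 3) (at x)"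
proof -
  define \<eta> where "\<eta> = 2 * ellK k / L"
  define D where "D = jacobi_dn k (\<eta> * x)"
  define s where "s = sin (jacobi_am k (\<eta> * x))"
  define c where "c = cos (jacobi_am k (\<eta> * x))"
  have d: "((\<lambda>x. jacobi_am k (\<eta> * x)) has_real_derivative D * \<eta>) (at x)"
    unfolding D_def by (rule derivative_eq_intros DERIV_chain2[OF jacobi_am_has_real_derivative[OF k]] refl)+ simp
  have "((\<lambda>x. - (\<eta>\<^sup>2 * k\<^sup>2 * sin (jacobi_am k (\<eta> * x)) * cos (jacobi_am k (\<eta> * x)))) has_real_derivative
      - (\<eta>\<^sup>2 * k\<^sup>2 * (c * (D * \<eta>)) * c - \<eta>\<^sup>2 * k\<^sup>2 * s * (s * (D * \<eta>)))) (at x)"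
    by (rule derivative_eq_intros d refl)+ (simp add: s_def c_def)
  also have "- (\<eta>\<^sup>2 * k\<^sup>2 * (c * (D * \<eta>)) * c - \<eta>\<^sup>2 * k\<^sup>2 * s * (s * (D * \<eta>))) = \<eta>^3 * D * (2 * (k\<^sup>2 * s\<^sup>2) - k\<^sup>2)"
  proof -
    have c2: "c\<^sup>2 = 1 - s\<^sup>2" by (simp add: c_def s_def cos_squared_eq)
    have "- (\<eta>\<^sup>2 * k\<^sup>2 * (c * (D * \<eta>)) * c - \<eta>\<^sup>2 * k\<^sup>2 * s * (s * (D * \<eta>))) = \<eta>^3 * D * k\<^sup>2 * (s\<^sup>2 - c\<^sup>2)"
      by (simp add: power2_eq_square power3_eq_cube algebra_simps)
    then show ?thesis by (simp add: c2 algebra_simps)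
  qed
  also have "k\<^sup>2 * s\<^sup>2 = 1 - D\<^sup>2" using jacobi_dn_sq[OF k, of "\<eta> * x"] by (simp add: D_def s_def)
  also have "\<eta>^3 * D * (2 * (1 - D\<^sup>2) - k\<^sup>2) = 2 * wave_speed_parameter L k * (\<eta> * D) - 2 * (\<eta> * D) ^ 3"
  proof -
    have "2 * wave_speed_parameter L k = \<eta>\<^sup>2 * (2 - k\<^sup>2)" by (simp add: wave_speed_parameter_def \<eta>_def power_divide power_mult_distrib)
    then show ?thesis by (simp only:) (simp add: power2_eq_square power3_eq_cube algebra_simps)
  qed
  finally show ?thesis by (simp add: dn_wave'_def[abs_def] dn_wave_def \<eta>_def D_def)
qed

text \<open>The first integral of the profile equation, factored with the extreme values of D^2 as
  roots. In this form it can be matched with the radicand of \<open>tw_flux\<close>.\<close>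

lemma dn_wave'_sq:
  "(dn_wave' L k x)\<^sup>2 = ((2 * ellK k / L)\<^sup>2 - (dn_wave L k x)\<^sup>2) * ((dn_wave L k x)\<^sup>2 - (2 * ellK k / L)\<^sup>2 * (1 - k\<^sup>2))"
proof -
  define \<eta> where "\<eta> = 2 * ellK k / L"
  define D where "D = jacobi_dn k (\<eta> * x)"
  define s where "s = sin (jacobi_am k (\<eta> * x))"
  define c where "c = cos (jacobi_am k (\<eta> * x))"
  have 1: "D\<^sup>2 = 1 - k\<^sup>2 * s\<^sup>2" using jacobi_dn_sq[OF k, of "\<eta> * x"] by (simp add: D_def s_def)
  have 2: "c\<^sup>2 = 1 - s\<^sup>2" by (simp add: c_def s_def cos_squared_eq)
  have "(dn_wave' L k x)\<^sup>2 = (\<eta>\<^sup>2)\<^sup>2 * (k\<^sup>2)\<^sup>2 * s\<^sup>2 * c\<^sup>2"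
    by (simp add: dn_wave'_def \<eta>_def[symmetric] s_def c_def power_mult_distrib)
  moreover have "dn_wave L k x = \<eta> * D" by (simp add: dn_wave_def \<eta>_def D_def)
  moreover have "(\<eta>\<^sup>2)\<^sup>2 * (k\<^sup>2)\<^sup>2 * s\<^sup>2 * c\<^sup>2 = (\<eta>\<^sup>2 - (\<eta> * D)\<^sup>2) * ((\<eta> * D)\<^sup>2 - \<eta>\<^sup>2 * (1 - k\<^sup>2))"
    unfolding 2 power_mult_distrib 1 by algebra
  ultimately show ?thesis by (simp add: \<eta>_def[symmetric])
qed

lemma dn_wave_pos: "dn_wave L k x > 0"
  unfolding dn_wave_def by (intro mult_pos_pos eta_pos jacobi_dn_pos k)

lemma dn_wave_sq_bounds:
  "(2 * ellK k / L)\<^sup>2 * (1 - k\<^sup>2) \<le> (dn_wave L k x)\<^sup>2" "(dn_wave L k x)\<^sup>2 \<le> (2 * ellK k / L)\<^sup>2"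
proof -
  have "k\<^sup>2 * (sin y)\<^sup>2 \<le> k\<^sup>2 * 1" for y by (intro mult_left_mono) (auto simp: abs_square_le_1)
  then have "1 - k\<^sup>2 \<le> (jacobi_dn k y)\<^sup>2 \<and> (jacobi_dn k y)\<^sup>2 \<le> 1" for y
    by (simp add: jacobi_dn_sq[OF k])
  then show "(2 * ellK k / L)\<^sup>2 * (1 - k\<^sup>2) \<le> (dn_wave L k x)\<^sup>2" "(dn_wave L k x)\<^sup>2 \<le> (2 * ellK k / L)\<^sup>2"
    unfolding dn_wave_def power_mult_distrib by (auto intro!: mult_left_mono mult_left_le)
qed

lemma dn_wave_le: "dn_wave L k x \<le> 2 * ellK k / L"
  using power2_le_imp_le[OF dn_wave_sq_bounds(2)] eta_pos by simp

lemma abs_dn_wave'_le: "\<bar>dn_wave' L k x\<bar> \<le> (2 * ellK k / L)\<^sup>2"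
proof -
  let ?a = "jacobi_am k (2 * ellK k / L * x)"
  have "\<bar>dn_wave' L k x\<bar> = (2 * ellK k / L)\<^sup>2 * (k\<^sup>2 * (\<bar>sin ?a\<bar> * \<bar>cos ?a\<bar>))"
    by (simp add: dn_wave'_def abs_mult)
  also have "\<dots> \<le> (2 * ellK k / L)\<^sup>2 * (1 * (1 * 1))"
    using modulus_sq_less_1[OF k] by (intro mult_mono) auto
  finally show ?thesis by simp
qed

lemma dn_wave_periodic: "dn_wave L k (x + L) = dn_wave L k x" "dn_wave' L k (x + L) = dn_wave' L k x"
proof -
  have "2 * ellK k / L * (x + L) = 2 * ellK k / L * x + 2 * ellK k" using L by (simp add: field_simps)
  then show "dn_wave L k (x + L) = dn_wave L k x" "dn_wave' L k (x + L) = dn_wave' L k x"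
    by (simp_all add: dn_wave_def dn_wave'_def jacobi_dn_add_period[OF k] jacobi_am_add_period[OF k])
qed

text \<open>The values are the minimum and the maximum of the wave, in the ratio sqrt (1 - k^2) <
  1.\<close>

lemma dn_wave_half_period: "0 < k \<Longrightarrow> dn_wave L k (L / 2) \<noteq> dn_wave L k 0"
proof -
  assume "0 < k"
  then have "sqrt (1 - k\<^sup>2) < 1" by simp
  moreover have "2 * ellK k / L * (L / 2) = ellK k" using L by simp
  ultimately show ?thesis using ellK_pos[OF k] L
    by (simp add: dn_wave_def jacobi_dn_0[OF k] jacobi_dn_ellK[OF k])
qed

end

lemma tendsto_dn_wave:
  assumes "\<kappa> \<longlonglongrightarrow> k" "0 \<le> k" "k < 1" "\<And>n. 0 \<le> \<kappa> n" "\<And>n. \<kappa> n < 1"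
  shows "(\<lambda>n. dn_wave L (\<kappa> n) x) \<longlonglongrightarrow> dn_wave L k x" "(\<lambda>n. dn_wave' L (\<kappa> n) x) \<longlonglongrightarrow> dn_wave' L k x"
proof -
  have "(\<lambda>n. 2 * ellK (\<kappa> n) / L * x) \<longlonglongrightarrow> 2 * ellK k / L * x"
    unfolding divide_inverse by (intro tendsto_intros tendsto_ellK assms)
  note am = tendsto_jacobi_am[OF assms this]
  show "(\<lambda>n. dn_wave L (\<kappa> n) x) \<longlonglongrightarrow> dn_wave L k x" "(\<lambda>n. dn_wave' L (\<kappa> n) x) \<longlonglongrightarrow> dn_wave' L k x"
    unfolding dn_wave_def dn_wave'_def jacobi_dn_def divide_inverse
    by (intro tendsto_intros tendsto_ellK assms am[unfolded divide_inverse])+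
qed

subsection \<open>Travelling waves\<close>

lemma continuous_periodic_L2_per:
  assumes "continuous_on UNIV f" "\<And>x. f (x + T) = f x"
  shows "f \<in> L2_per T"
proof -
  have "set_integrable lborel {0..T} (\<lambda>x. (norm (f x))\<^sup>2)"
    by (intro borel_integrable_atLeastAtMost' continuous_intros continuous_on_subset[OF assms(1)]) auto
  then show ?thesis using assms by (auto simp: L2_per_def intro: borel_measurable_continuous_onI)
qed

lemma
  assumes "\<theta> \<in> per_test T"
  shows per_test_periodic: "\<theta> (x + T) = \<theta> x"
    and per_test_has_real_derivative: "(\<theta> has_real_derivative deriv \<theta> x) (at x within S)"
    and per_test_deriv: "deriv \<theta> \<in> per_test T"
proof -
  have d: "(deriv ^^ n) \<theta> differentiable at x" for n x using assms by (auto simp: per_test_def)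
  have p: "\<theta> (x + T) = \<theta> x" for x using assms by (auto simp: per_test_def)
  then show "\<theta> (x + T) = \<theta> x" .
  have der: "(\<theta> has_real_derivative deriv \<theta> x) (at x)" for x
    using d[of 0 x] by (simp add: DERIV_deriv_iff_real_differentiable)
  then show "(\<theta> has_real_derivative deriv \<theta> x) (at x within S)"
    by (rule has_field_derivative_at_within)
  have "((\<lambda>y. \<theta> (y + T)) has_real_derivative deriv \<theta> (x + T)) (at x)" for x
    using der[of "x + T"] by (simp add: DERIV_shift)
  then have "(\<theta> has_real_derivative deriv \<theta> (x + T)) (at x)" for x by (simp add: p)
  then have "deriv \<theta> (x + T) = deriv \<theta> x" for x using der DERIV_unique by blast
  then show "deriv \<theta> \<in> per_test T"
    using d[of "Suc _"] by (simp add: per_test_def funpow_Suc_right del: funpow.simps)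
qed

lemma per_test_continuous: "\<theta> \<in> per_test T \<Longrightarrow> continuous_on S \<theta>"
  by (rule DERIV_continuous_on[OF per_test_has_real_derivative])

lemma periodic_integration_by_parts:
  fixes f f' :: "real \<Rightarrow> 'a::euclidean_space" and \<theta> \<theta>' :: "real \<Rightarrow> real"
  assumes "T \<ge> 0"
    and \<theta>: "\<And>x. (\<theta> has_real_derivative \<theta>' x) (at x)" "continuous_on UNIV \<theta>'" "\<theta> T = \<theta> 0"
    and f: "\<And>x. (f has_vector_derivative f' x) (at x)" "continuous_on UNIV f'" "f T = f 0"
  shows "(LBINT x:{0..T}. \<theta>' x *\<^sub>R f x) = - (LBINT x:{0..T}. \<theta> x *\<^sub>R f' x)"
proof -
  have c: "continuous_on A \<theta>" "continuous_on A f" "continuous_on A \<theta>'" "continuous_on A f'" for A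
  proof -
    show "continuous_on A \<theta>" by (rule DERIV_continuous_on[OF has_field_derivative_at_within[OF \<theta>(1)]])
    show "continuous_on A f" by (rule continuous_on_vector_derivative[OF has_vector_derivative_at_within[OF f(1)]])
  qed (use \<theta>(2) f(2) continuous_on_subset in blast)+
  have i: "set_integrable lborel {0..T} (\<lambda>x. \<theta>' x *\<^sub>R f x)" "set_integrable lborel {0..T} (\<lambda>x. \<theta> x *\<^sub>R f' x)"
    by (intro borel_integrable_atLeastAtMost' continuous_intros c)+
  have "(LBINT x:{0..T}. \<theta> x *\<^sub>R f' x + \<theta>' x *\<^sub>R f x) = \<theta> T *\<^sub>R f T - \<theta> 0 *\<^sub>R f 0"
    unfolding set_lebesgue_integral_def
  proof (rule integral_FTC_atLeastAtMost)
    show "((\<lambda>x. \<theta> x *\<^sub>R f x) has_vector_derivative \<theta> x *\<^sub>R f' x + \<theta>' x *\<^sub>R f x) (at x within {0..T})" for x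
      by (intro has_vector_derivative_scaleR has_field_derivative_at_within[OF \<theta>(1)] has_vector_derivative_at_within[OF f(1)])
  qed (use assms(1) in \<open>auto intro!: continuous_intros c\<close>)
  then show ?thesis using i \<theta>(3) f(3) by (simp add: eq_neg_iff_add_eq_0 add.commute)
qed

text \<open>For periodic C^1 functions the choice made by \<open>weak_deriv\<close> agrees almost
  everywhere with the classical derivative; the last claim is what makes H^1 distances between
  explicit waves computable.\<close>

lemma C1_periodic_H1:
  fixes f f' :: "real \<Rightarrow> 'a::euclidean_space"
  assumes T: "T > 0" and f: "\<And>x. (f has_vector_derivative f' x) (at x)" "continuous_on UNIV f'"
    "\<And>x. f (x + T) = f x" "\<And>x. f' (x + T) = f' x"
  shows "f \<in> L2_per T" "f' \<in> L2_per T" "has_weak_deriv T f f'" "f \<in> H1_per T"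
    "(H1_norm T f)\<^sup>2 = (L2_norm T f)\<^sup>2 + (L2_norm T f')\<^sup>2"
proof -
  have c: "continuous_on UNIV f"
    by (rule continuous_on_vector_derivative[OF has_vector_derivative_at_within[OF f(1)]])
  show 1: "f \<in> L2_per T" by (rule continuous_periodic_L2_per[OF c f(3)])
  show 2: "f' \<in> L2_per T" by (rule continuous_periodic_L2_per[OF f(2,4)])
  show 3: "has_weak_deriv T f f'"
    unfolding has_weak_deriv_def
  proof
    fix \<theta> assume \<theta>: "\<theta> \<in> per_test T"
    show "(LBINT x:{0..T}. deriv \<theta> x *\<^sub>R f x) = - (LBINT x:{0..T}. \<theta> x *\<^sub>R f' x)"
      using T f(3)[of 0] per_test_periodic[OF \<theta>, of 0]
      by (intro periodic_integration_by_parts per_test_has_real_derivative[OF \<theta>] f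
          per_test_continuous[OF per_test_deriv[OF \<theta>]]) auto
  qed
  show 4: "f \<in> H1_per T" using 1 2 3 by (auto simp: H1_per_def)
  have "AE x in lborel. x \<in> {0..T} \<longrightarrow> weak_deriv T f x = f' x"
    by (rule has_weak_deriv_unique[OF T weak_deriv_spec[OF 4] 2 3])
  then have "(LBINT x:{0..T}. (norm (weak_deriv T f x))\<^sup>2) = (LBINT x:{0..T}. (norm (f' x))\<^sup>2)"
    using L2_perD(1)[OF weak_deriv_spec(1)[OF 4]] L2_perD(1)[OF 2]
    unfolding set_lebesgue_integral_def
    by (intro integral_cong_AE) (auto elim!: eventually_mono simp: indicator_def)
  then show "(H1_norm T f)\<^sup>2 = (L2_norm T f)\<^sup>2 + (L2_norm T f')\<^sup>2"
    by (simp add: H1_norm_def L2_norm_def)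
qed

lemma set_integral_leibniz:
  fixes f ft :: "real \<Rightarrow> real \<Rightarrow> 'a::euclidean_space"
  assumes d: "\<And>s x. ((\<lambda>s. f s x) has_vector_derivative ft s x) (at s)"
    and cf: "\<And>s. continuous_on UNIV (f s)" and cft: "continuous_on UNIV (\<lambda>(s, x). ft s x)"
  shows "((\<lambda>s. LBINT x:{0..T}. f s x) has_vector_derivative (LBINT x:{0..T}. ft t x)) (at t)"
proof -
  have ct: "continuous_on UNIV (ft s)" for s
  proof -
    have "continuous_on UNIV (\<lambda>x. (\<lambda>(s, x). ft s x) (s, x))"
      by (rule continuous_on_compose2[OF cft]) (auto intro!: continuous_intros)
    then show ?thesis by simp
  qed
  have i: "set_integrable lborel {0..T} g" if "continuous_on UNIV g" for g :: "real \<Rightarrow> 'a"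
    by (rule borel_integrable_atLeastAtMost'[OF continuous_on_subset[OF that subset_UNIV]])
  have "((\<lambda>s. integral (cbox 0 T) (f s)) has_vector_derivative integral (cbox 0 T) (ft t)) (at t within UNIV)"
  proof (rule leibniz_rule_vector_derivative)
    show "((\<lambda>s. f s x) has_vector_derivative ft s x) (at s within UNIV)" for s x using d by simp
    show "f s integrable_on cbox 0 T" for s
      using set_borel_integral_eq_integral(1)[OF i[OF cf]] by simp
    show "continuous_on (UNIV \<times> cbox 0 T) (\<lambda>(x, t). ft x t)"
      by (rule continuous_on_subset[OF cft]) auto
  qed auto
  then show ?thesis using set_borel_integral_eq_integral(2)[OF i[OF cf]] set_borel_integral_eq_integral(2)[OF i[OF ct]]
    by simp
qed

text \<open>Inserting u = exp (i \<omega> t) R (x - a t) and v = D (x - a t) into the system leaves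
  R'' = 2 (\<omega> R + i a R' - D^2 R) and (a^2 - 1) D'' + m^2 D = 2 |R|^2 D. The derivatives of R
  and D are carried along as functions of their own, so that all regularity is classical.\<close>

locale travelling_profile =
  fixes L m a \<omega> :: real and R R' :: "real \<Rightarrow> complex" and D D' :: "real \<Rightarrow> real"
  assumes L: "L > 0"
    and R: "\<And>x. (R has_vector_derivative R' x) (at x)"
    and R': "\<And>x. (R' has_vector_derivative 2 * (\<omega> * R x + \<i> * a * R' x - (D x)\<^sup>2 * R x)) (at x)"
    and D: "\<And>x. (D has_vector_derivative D' x) (at x)"
    and D'': "\<And>x. \<exists>D2. (D' has_vector_derivative D2) (at x) \<and> (a\<^sup>2 - 1) * D2 + m\<^sup>2 * D x = 2 * (cmod (R x))\<^sup>2 * D x"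
    and D''_cont: "continuous_on UNIV (\<lambda>x. deriv D' x)"
    and per: "\<And>x. R (x + 2 * L) = R x" "\<And>x. R' (x + 2 * L) = R' x" "\<And>x. D (x + 2 * L) = D x" "\<And>x. D' (x + 2 * L) = D' x"
begin

definition "u t x = cis (\<omega> * t) * R (x - a * t)"
definition "v t x = D (x - a * t)"
definition "w t x = - a * D' (x - a * t)"

lemma D': "(D' has_vector_derivative deriv D' x) (at x)"
  and D'_eq: "(a\<^sup>2 - 1) * deriv D' x + m\<^sup>2 * D x = 2 * (cmod (R x))\<^sup>2 * D x"
proof -
  obtain D2 where D2: "(D' has_vector_derivative D2) (at x)" "(a\<^sup>2 - 1) * D2 + m\<^sup>2 * D x = 2 * (cmod (R x))\<^sup>2 * D x"
    using D'' by blast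
  then have "deriv D' x = D2" by (intro DERIV_imp_deriv) (simp add: has_real_derivative_iff_has_vector_derivative)
  then show "(D' has_vector_derivative deriv D' x) (at x)"
    "(a\<^sup>2 - 1) * deriv D' x + m\<^sup>2 * D x = 2 * (cmod (R x))\<^sup>2 * D x" using D2 by auto
qed

lemma continuous:
  "continuous_on A R" "continuous_on A R'" "continuous_on A D" "continuous_on A D'"
  by (rule continuous_on_vector_derivative[OF has_vector_derivative_at_within], rule R R' D D')+

lemma continuous_shift: "continuous_on UNIV f \<Longrightarrow> continuous_on UNIV (\<lambda>x. f (x - a * t))"
  for f :: "real \<Rightarrow> 'a::topological_space"
  by (erule continuous_on_compose2) (auto intro!: continuous_intros)

lemma continuous_joint: "continuous_on UNIV f \<Longrightarrow> continuous_on UNIV (\<lambda>z. f (snd z - a * fst z))"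
  for f :: "real \<Rightarrow> 'a::topological_space"
  by (erule continuous_on_compose2) (auto intro!: continuous_intros)

lemma shift_x:
  fixes f :: "real \<Rightarrow> 'a::real_normed_vector"
  assumes "(f has_vector_derivative f') (at (x - a * t))"
  shows "((\<lambda>x. f (x - a * t)) has_vector_derivative f') (at x)"
proof -
  have "((\<lambda>x. x - a * t) has_vector_derivative 1) (at x)"
    unfolding has_real_derivative_iff_has_vector_derivative[symmetric] by (auto intro!: derivative_eq_intros)
  then show ?thesis
    using assms vector_diff_chain_at[of "\<lambda>x. x - a * t" 1 x f f'] by (simp add: o_def)
qed

lemma shift_t:
  fixes f :: "real \<Rightarrow> 'a::real_normed_vector"
  assumes "(f has_vector_derivative f') (at (x - a * t))"
  shows "((\<lambda>t. f (x - a * t)) has_vector_derivative (- a) *\<^sub>R f') (at t)"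
proof -
  have "((\<lambda>t. x - a * t) has_vector_derivative - a) (at t)"
    unfolding has_real_derivative_iff_has_vector_derivative[symmetric] by (auto intro!: derivative_eq_intros)
  then show ?thesis
    using assms vector_diff_chain_at[of "\<lambda>t. x - a * t" "- a" t f f'] by (simp add: o_def)
qed

lemma u_x: "((u t) has_vector_derivative cis (\<omega> * t) * R' (x - a * t)) (at x)"
  unfolding u_def[abs_def] by (intro derivative_intros shift_x R)

lemma v_x: "((v t) has_vector_derivative D' (x - a * t)) (at x)"
  unfolding v_def[abs_def] by (intro shift_x D)

lemma periodic_shift:
  "u t (x + 2 * L) = u t x" "v t (x + 2 * L) = v t x" "w t (x + 2 * L) = w t x"
  "R' (x + 2 * L - a * t) = R' (x - a * t)" "D' (x + 2 * L - a * t) = D' (x - a * t)"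
  unfolding u_def v_def w_def
  using per(1)[of "x - a * t"] per(2)[of "x - a * t"] per(3)[of "x - a * t"] per(4)[of "x - a * t"]
  by (simp_all add: algebra_simps)

lemma uv_H1: "u t \<in> H1_per (2 * L)" "v t \<in> H1_per (2 * L)" "w t \<in> L2_per (2 * L)"
proof -
  show "u t \<in> H1_per (2 * L)"
    by (rule C1_periodic_H1(4)[OF _ u_x]) (use L in \<open>auto intro!: continuous_intros continuous_shift continuous simp: periodic_shift\<close>)
  show "v t \<in> H1_per (2 * L)"
    by (rule C1_periodic_H1(4)[OF _ v_x]) (use L in \<open>auto intro!: continuous_intros continuous_shift continuous simp: periodic_shift\<close>)
  show "w t \<in> L2_per (2 * L)"
    by (rule continuous_periodic_L2_per[where f = "w t", OF _ periodic_shift(3)])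
      (auto simp: w_def[abs_def] intro!: continuous_intros continuous_shift continuous)
qed

lemma double_ibp:
  fixes f f' f'' :: "real \<Rightarrow> 'a::euclidean_space"
  assumes \<theta>: "\<theta> \<in> per_test (2 * L)"
    and f: "\<And>x. (f has_vector_derivative f' x) (at x)" "\<And>x. (f' has_vector_derivative f'' x) (at x)"
      "continuous_on UNIV f''" "\<And>x. f (x + 2 * L) = f x" "\<And>x. f' (x + 2 * L) = f' x"
  shows "(LBINT x:{0..2*L}. deriv (deriv \<theta>) x *\<^sub>R f x) = (LBINT x:{0..2*L}. \<theta> x *\<^sub>R f'' x)"
proof -
  note \<theta>' = per_test_deriv[OF \<theta>]
  note \<theta>'' = per_test_deriv[OF \<theta>']
  have c: "continuous_on UNIV f'"
    by (rule continuous_on_vector_derivative[OF has_vector_derivative_at_within[OF f(2)]])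
  have "(LBINT x:{0..2*L}. deriv (deriv \<theta>) x *\<^sub>R f x) = - (LBINT x:{0..2*L}. deriv \<theta> x *\<^sub>R f' x)"
    using L f(4)[of 0] per_test_periodic[OF \<theta>', of 0]
    by (intro periodic_integration_by_parts per_test_has_real_derivative[OF \<theta>'] per_test_continuous[OF \<theta>''] f c) auto
  also have "(LBINT x:{0..2*L}. deriv \<theta> x *\<^sub>R f' x) = - (LBINT x:{0..2*L}. \<theta> x *\<^sub>R f'' x)"
    using L f(5)[of 0] per_test_periodic[OF \<theta>, of 0]
    by (intro periodic_integration_by_parts per_test_has_real_derivative[OF \<theta>] per_test_continuous[OF \<theta>'] f) auto
  finally show ?thesis by simp
qed

lemma test_leibniz:
  fixes f ft :: "real \<Rightarrow> real \<Rightarrow> 'a::euclidean_space"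
  assumes \<theta>: "\<theta> \<in> per_test (2 * L)"
    and d: "\<And>s x. ((\<lambda>s. f s x) has_vector_derivative ft s x) (at s)"
    and cf: "\<And>s. continuous_on UNIV (f s)" and cft: "continuous_on UNIV (\<lambda>z. ft (fst z) (snd z))"
  shows "((\<lambda>s. LBINT x:{0..2*L}. \<theta> x *\<^sub>R f s x) has_vector_derivative (LBINT x:{0..2*L}. \<theta> x *\<^sub>R ft t x)) (at t)"
proof (rule set_integral_leibniz)
  show "((\<lambda>s. \<theta> x *\<^sub>R f s x) has_vector_derivative \<theta> x *\<^sub>R ft s x) (at s)" for s x
    using has_vector_derivative_scaleR[OF DERIV_const d, of "\<theta> x"] by simp
  have "continuous_on UNIV (\<lambda>z. \<theta> (snd z))"
    by (rule continuous_on_compose2[OF per_test_continuous[OF \<theta>, of UNIV]]) (auto intro!: continuous_intros)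
  then show "continuous_on UNIV (\<lambda>(s, x). \<theta> x *\<^sub>R ft s x)"
    unfolding split_beta by (intro continuous_on_scaleR cft)
qed (intro continuous_on_scaleR per_test_continuous[OF \<theta>] cf)

lemma continuous_test_integrable:
  fixes f :: "real \<Rightarrow> 'a::euclidean_space"
  assumes "\<theta> \<in> per_test (2 * L)" "continuous_on UNIV f"
  shows "set_integrable lborel {0..2*L} (\<lambda>x. \<theta> x *\<^sub>R f x)"
  by (intro borel_integrable_atLeastAtMost' continuous_on_scaleR per_test_continuous[OF assms(1)]
      continuous_on_subset[OF assms(2)]) auto

text \<open>Time derivatives pass under the integral and space derivatives return from the test
  function by two integrations by parts; what remains are the profile equations at x - a t,
  multiplied by the test function.\<close>

lemma system: "system_at L m u v w t"
  unfolding system_at_def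
proof (intro ballI conjI)
  fix \<theta> assume \<theta>: "\<theta> \<in> per_test (2 * L)"
  let ?u1 = "\<lambda>x. cis (\<omega> * t) * R' (x - a * t)"
  let ?ut = "\<lambda>t x. \<i> * \<omega> * u t x - a * (cis (\<omega> * t) * R' (x - a * t))"
  let ?u2 = "\<lambda>x. 2 * (\<omega> * u t x + \<i> * a * (cis (\<omega> * t) * R' (x - a * t)) - (v t x)\<^sup>2 * u t x)"
  have cis_t: "((\<lambda>t. cis (\<omega> * t)) has_vector_derivative \<i> * \<omega> * cis (\<omega> * t)) (at t)" for t
  proof -
    have "((\<lambda>z. exp (\<i> * \<omega> * z)) has_field_derivative \<i> * \<omega> * exp (\<i> * \<omega> * of_real t)) (at (of_real t))"
      by (auto intro!: derivative_eq_intros)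
    from has_vector_derivative_real_field[OF this] show ?thesis by (simp add: cis_conv_exp mult.assoc)
  qed
  have cu: "continuous_on UNIV (u t)" "continuous_on UNIV (v t)" "continuous_on UNIV (w t)" for t
    unfolding u_def[abs_def] v_def[abs_def] w_def[abs_def] by (intro continuous_intros continuous_shift continuous)+
  have cu1: "continuous_on UNIV ?u1" by (intro continuous_intros continuous_shift continuous)
  have ut: "((\<lambda>s. LBINT x:{0..2*L}. \<theta> x *\<^sub>R u s x) has_vector_derivative (LBINT x:{0..2*L}. \<theta> x *\<^sub>R ?ut t x)) (at t)"
  proof (rule test_leibniz[OF \<theta>])
    show "((\<lambda>s. u s x) has_vector_derivative ?ut s x) (at s)" for s x
      unfolding u_def
      by (rule has_vector_derivative_eq_rhs, rule has_vector_derivative_mult[OF cis_t shift_t[OF R]])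
        (simp add: scaleR_conv_of_real algebra_simps)
    show "continuous_on UNIV (\<lambda>z. ?ut (fst z) (snd z))"
      unfolding u_def by (intro continuous_intros continuous_joint continuous)
  qed (rule cu)
  have u2: "(LBINT x:{0..2*L}. deriv (deriv \<theta>) x *\<^sub>R u t x) = (LBINT x:{0..2*L}. \<theta> x *\<^sub>R ?u2 x)"
  proof (rule double_ibp[OF \<theta> u_x])
    show "(?u1 has_vector_derivative ?u2 x) (at x)" for x
      unfolding u_def v_def
      by (rule has_vector_derivative_eq_rhs, rule has_vector_derivative_mult_right[OF shift_x[OF R']])
        (simp add: algebra_simps)
    show "continuous_on UNIV ?u2" by (intro continuous_intros cu cu1)
  qed (simp_all add: periodic_shift)
  show "\<exists>D. ((\<lambda>s. LBINT x:{0..2*L}. \<theta> x *\<^sub>R u s x) has_vector_derivative D) (at t) \<and>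
          \<i> * D + 1/2 * (LBINT x:{0..2*L}. deriv (deriv \<theta>) x *\<^sub>R u t x)
            = - (LBINT x:{0..2*L}. \<theta> x *\<^sub>R (of_real ((v t x)\<^sup>2) * u t x))"
  proof (intro exI conjI, rule ut)
    have i: "set_integrable lborel {0..2*L} (\<lambda>x. \<theta> x *\<^sub>R ?ut t x)" "set_integrable lborel {0..2*L} (\<lambda>x. \<theta> x *\<^sub>R ?u2 x)"
      by (rule continuous_test_integrable[OF \<theta>], intro continuous_intros cu cu1)+
    have "\<i> * (LBINT x:{0..2*L}. \<theta> x *\<^sub>R ?ut t x) + 1/2 * (LBINT x:{0..2*L}. \<theta> x *\<^sub>R ?u2 x)
      = (LBINT x:{0..2*L}. \<i> * (\<theta> x *\<^sub>R ?ut t x)) + (LBINT x:{0..2*L}. 1/2 * (\<theta> x *\<^sub>R ?u2 x))"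
      by (simp only: set_integral_mult_right)
    also have "\<dots> = (LBINT x:{0..2*L}. \<i> * (\<theta> x *\<^sub>R ?ut t x) + 1/2 * (\<theta> x *\<^sub>R ?u2 x))"
      using i by (intro set_integral_add(2)[symmetric] set_integrable_mult_right) auto
    also have "\<dots> = (LBINT x:{0..2*L}. - (\<theta> x *\<^sub>R (of_real ((v t x)\<^sup>2) * u t x)))"
    proof (rule arg_cong[where f = "set_lebesgue_integral lborel {0..2*L}"], rule ext)
      fix x
      show "\<i> * (\<theta> x *\<^sub>R ?ut t x) + 1/2 * (\<theta> x *\<^sub>R ?u2 x) = - (\<theta> x *\<^sub>R (of_real ((v t x)\<^sup>2) * u t x))"
        by (simp add: scaleR_conv_of_real algebra_simps)
    qed
    also have "\<dots> = - (LBINT x:{0..2*L}. \<theta> x *\<^sub>R (of_real ((v t x)\<^sup>2) * u t x))"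
      by (rule set_integral_uminus, rule continuous_test_integrable[OF \<theta>]) (intro continuous_intros cu)
    finally show "\<i> * (LBINT x:{0..2*L}. \<theta> x *\<^sub>R ?ut t x) + 1/2 * (LBINT x:{0..2*L}. deriv (deriv \<theta>) x *\<^sub>R u t x)
            = - (LBINT x:{0..2*L}. \<theta> x *\<^sub>R (of_real ((v t x)\<^sup>2) * u t x))" unfolding u2 .
  qed
  have "((\<lambda>s. LBINT x:{0..2*L}. \<theta> x *\<^sub>R v s x) has_vector_derivative (LBINT x:{0..2*L}. \<theta> x *\<^sub>R w t x)) (at t)"
  proof (rule test_leibniz[OF \<theta>])
    show "((\<lambda>s. v s x) has_vector_derivative w s x) (at s)" for s x
      unfolding v_def w_def using shift_t[OF D] by simp
    show "continuous_on UNIV (\<lambda>z. w (fst z) (snd z))"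
      unfolding w_def by (intro continuous_intros continuous_joint continuous)
  qed (rule cu)
  then show "((\<lambda>s. LBINT x:{0..2*L}. \<theta> x * v s x) has_vector_derivative (LBINT x:{0..2*L}. \<theta> x * w t x)) (at t)"
    unfolding real_scaleR_def .
  let ?v2 = "\<lambda>t x. deriv D' (x - a * t)"
  have wt: "((\<lambda>s. LBINT x:{0..2*L}. \<theta> x *\<^sub>R w s x) has_vector_derivative (LBINT x:{0..2*L}. \<theta> x *\<^sub>R (a\<^sup>2 * ?v2 t x))) (at t)"
  proof (rule test_leibniz[OF \<theta>])
    show "((\<lambda>s. w s x) has_vector_derivative a\<^sup>2 * ?v2 s x) (at s)" for s x
      unfolding w_def
      by (rule has_vector_derivative_eq_rhs, rule has_vector_derivative_mult_right[OF shift_t[OF D']])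
        (simp add: power2_eq_square)
    show "continuous_on UNIV (\<lambda>z. a\<^sup>2 * ?v2 (fst z) (snd z))"
      by (intro continuous_intros continuous_joint D''_cont)
  qed (rule cu)
  have v2: "(LBINT x:{0..2*L}. deriv (deriv \<theta>) x *\<^sub>R v t x) = (LBINT x:{0..2*L}. \<theta> x *\<^sub>R ?v2 t x)"
    by (rule double_ibp[OF \<theta> v_x shift_x[OF D']]) (simp_all add: periodic_shift continuous_shift[OF D''_cont])
  have "\<exists>D. ((\<lambda>s. LBINT x:{0..2*L}. \<theta> x *\<^sub>R w s x) has_vector_derivative D) (at t) \<and>
          D - (LBINT x:{0..2*L}. deriv (deriv \<theta>) x *\<^sub>R v t x) + m\<^sup>2 * (LBINT x:{0..2*L}. \<theta> x *\<^sub>R v t x)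
            = 2 * (LBINT x:{0..2*L}. \<theta> x *\<^sub>R ((cmod (u t x))\<^sup>2 * v t x))"
  proof (intro exI conjI, rule wt)
    have c2: "continuous_on UNIV (?v2 t)" by (rule continuous_shift[OF D''_cont])
    have i: "set_integrable lborel {0..2*L} (\<lambda>x. \<theta> x *\<^sub>R (a\<^sup>2 * ?v2 t x))" "set_integrable lborel {0..2*L} (\<lambda>x. \<theta> x *\<^sub>R ?v2 t x)"
      "set_integrable lborel {0..2*L} (\<lambda>x. \<theta> x *\<^sub>R v t x)"
      by (rule continuous_test_integrable[OF \<theta>], intro continuous_intros c2 cu)+
    have "(LBINT x:{0..2*L}. \<theta> x *\<^sub>R (a\<^sup>2 * ?v2 t x)) - (LBINT x:{0..2*L}. \<theta> x *\<^sub>R ?v2 t x) + m\<^sup>2 * (LBINT x:{0..2*L}. \<theta> x *\<^sub>R v t x)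
       = (LBINT x:{0..2*L}. \<theta> x *\<^sub>R (a\<^sup>2 * ?v2 t x) - \<theta> x *\<^sub>R ?v2 t x + m\<^sup>2 * (\<theta> x *\<^sub>R v t x))"
      by (subst set_integral_add(2), intro set_integral_diff(1) i, intro set_integrable_mult_right i,
          subst set_integral_diff(2), rule i, rule i, simp only: set_integral_mult_right)
    also have "\<dots> = (LBINT x:{0..2*L}. 2 * (\<theta> x *\<^sub>R ((cmod (u t x))\<^sup>2 * v t x)))"
    proof (rule arg_cong[where f = "set_lebesgue_integral lborel {0..2*L}"], rule ext)
      fix x
      have e: "(a\<^sup>2 - 1) * ?v2 t x + m\<^sup>2 * v t x = 2 * (cmod (u t x))\<^sup>2 * v t x"
        using D'_eq[of "x - a * t"] by (simp add: u_def v_def norm_mult)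
      have "\<theta> x *\<^sub>R (a\<^sup>2 * ?v2 t x) - \<theta> x *\<^sub>R ?v2 t x + m\<^sup>2 * (\<theta> x *\<^sub>R v t x) = \<theta> x * ((a\<^sup>2 - 1) * ?v2 t x + m\<^sup>2 * v t x)"
        by (simp add: algebra_simps)
      then show "\<theta> x *\<^sub>R (a\<^sup>2 * ?v2 t x) - \<theta> x *\<^sub>R ?v2 t x + m\<^sup>2 * (\<theta> x *\<^sub>R v t x) = 2 * (\<theta> x *\<^sub>R ((cmod (u t x))\<^sup>2 * v t x))"
        unfolding e by simp
    qed
    also have "\<dots> = 2 * (LBINT x:{0..2*L}. \<theta> x *\<^sub>R ((cmod (u t x))\<^sup>2 * v t x))" by (rule set_integral_mult_right)
    finally show "(LBINT x:{0..2*L}. \<theta> x *\<^sub>R (a\<^sup>2 * ?v2 t x)) - (LBINT x:{0..2*L}. deriv (deriv \<theta>) x *\<^sub>R v t x)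
        + m\<^sup>2 * (LBINT x:{0..2*L}. \<theta> x *\<^sub>R v t x) = 2 * (LBINT x:{0..2*L}. \<theta> x *\<^sub>R ((cmod (u t x))\<^sup>2 * v t x))"
      unfolding v2 .
  qed
  then show "\<exists>D. ((\<lambda>s. LBINT x:{0..2*L}. \<theta> x * w s x) has_vector_derivative D) (at t) \<and>
          D - (LBINT x:{0..2*L}. deriv (deriv \<theta>) x * v t x) + m\<^sup>2 * (LBINT x:{0..2*L}. \<theta> x * v t x)
            = 2 * (LBINT x:{0..2*L}. \<theta> x * ((cmod (u t x))\<^sup>2 * v t x))"
    unfolding real_scaleR_def .
qed

end

subsection \<open>Uniqueness of bounded solutions\<close>

lemma fcoef_deriv2:
  fixes f :: "real \<Rightarrow> 'a::euclidean_space"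
  shows "(LBINT x:{0..T}. deriv (deriv (cas T n)) x *\<^sub>R f x) = - (freq T n)\<^sup>2 *\<^sub>R fcoef T f n"
  unfolding fcoef_def deriv_deriv_cas by (simp only: scaleR_scaleR[symmetric] set_integral_scaleR_right)

text \<open>\<open>cas\<close> is an admissible test function and an eigenfunction of the second
  derivative. Hence the weak system becomes, mode by mode, a linear ordinary differential equation
  forced by the coefficient of the nonlinearity.\<close>

lemma system_at_fcoef:
  assumes L: "L > 0" and s: "system_at L m u v w t"
  shows "((\<lambda>s. fcoef (2*L) (u s) n) has_vector_derivative
      \<i> * fcoef (2*L) (\<lambda>x. of_real ((v t x)\<^sup>2) * u t x) n - \<i> * ((freq (2*L) n)\<^sup>2 / 2) * fcoef (2*L) (u t) n) (at t)"
    and "((\<lambda>s. fcoef (2*L) (v s) n) has_vector_derivative fcoef (2*L) (w t) n) (at t)"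
    and "((\<lambda>s. fcoef (2*L) (w s) n) has_vector_derivative
      2 * fcoef (2*L) (\<lambda>x. (cmod (u t x))\<^sup>2 * v t x) n - ((freq (2*L) n)\<^sup>2 + m\<^sup>2) * fcoef (2*L) (v t) n) (at t)"
proof -
  have "cas (2*L) n \<in> per_test (2*L)" using L by (intro cas_per_test) simp
  note S = s[unfolded system_at_def, rule_format, OF this]
  from S obtain D where D: "((\<lambda>s. fcoef (2*L) (u s) n) has_vector_derivative D) (at t)"
    "\<i> * D + 1/2 * (- (freq (2*L) n)\<^sup>2 *\<^sub>R fcoef (2*L) (u t) n) = - fcoef (2*L) (\<lambda>x. of_real ((v t x)\<^sup>2) * u t x) n"
    unfolding fcoef_deriv2 fcoef_def by blast
  have "D = \<i> * fcoef (2*L) (\<lambda>x. of_real ((v t x)\<^sup>2) * u t x) n - \<i> * ((freq (2*L) n)\<^sup>2 / 2) * fcoef (2*L) (u t) n"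
  proof -
    have "D = - \<i> * (\<i> * D)" by simp
    also have "\<i> * D = - fcoef (2*L) (\<lambda>x. of_real ((v t x)\<^sup>2) * u t x) n - 1/2 * (- (freq (2*L) n)\<^sup>2 *\<^sub>R fcoef (2*L) (u t) n)"
      unfolding D(2)[symmetric] by simp
    finally show ?thesis by (simp add: scaleR_conv_of_real algebra_simps)
  qed
  then show "((\<lambda>s. fcoef (2*L) (u s) n) has_vector_derivative
      \<i> * fcoef (2*L) (\<lambda>x. of_real ((v t x)\<^sup>2) * u t x) n - \<i> * ((freq (2*L) n)\<^sup>2 / 2) * fcoef (2*L) (u t) n) (at t)"
    using D(1) by simp
  show "((\<lambda>s. fcoef (2*L) (v s) n) has_vector_derivative fcoef (2*L) (w t) n) (at t)"
    using S unfolding fcoef_def real_scaleR_def by blast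
  have e: "(LBINT x:{0..2*L}. deriv (deriv (cas (2*L) n)) x * v t x) = - (freq (2*L) n)\<^sup>2 * fcoef (2*L) (v t) n"
    using fcoef_deriv2[of "2*L" n "v t"] unfolding real_scaleR_def .
  from S[THEN conjunct2, THEN conjunct2, unfolded e] obtain D where D: "((\<lambda>s. fcoef (2*L) (w s) n) has_vector_derivative D) (at t)"
    "D - (- (freq (2*L) n)\<^sup>2 * fcoef (2*L) (v t) n) + m\<^sup>2 * fcoef (2*L) (v t) n
      = 2 * fcoef (2*L) (\<lambda>x. (cmod (u t x))\<^sup>2 * v t x) n"
    unfolding fcoef_def real_scaleR_def by blast
  then have "D = 2 * fcoef (2*L) (\<lambda>x. (cmod (u t x))\<^sup>2 * v t x) n - ((freq (2*L) n)\<^sup>2 + m\<^sup>2) * fcoef (2*L) (v t) n"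
    by (simp add: algebra_simps)
  then show "((\<lambda>s. fcoef (2*L) (w s) n) has_vector_derivative
      2 * fcoef (2*L) (\<lambda>x. (cmod (u t x))\<^sup>2 * v t x) n - ((freq (2*L) n)\<^sup>2 + m\<^sup>2) * fcoef (2*L) (v t) n) (at t)"
    using D(1) by simp
qed

lemma AE_bounded_L2_per:
  fixes f :: "real \<Rightarrow> 'a::euclidean_space"
  assumes "f \<in> borel_measurable borel" "\<And>x. f (x + T) = f x" "AE x in lborel. x \<in> {0..T} \<longrightarrow> norm (f x) \<le> B"
  shows "f \<in> L2_per T"
proof -
  have "set_integrable lborel {0..T} (\<lambda>x. (norm (f x))\<^sup>2)"
    by (rule set_integrable_bound'[OF set_integrable_const_Icc[of T "B\<^sup>2"]])
      (use assms in \<open>auto intro!: power_mono elim!: eventually_mono\<close>)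
  then show ?thesis using assms by (simp add: L2_per_def)
qed

lemma L2_norm_sq_le_AE:
  fixes f :: "real \<Rightarrow> 'a::euclidean_space"
  assumes f: "f \<in> L2_per T" and g: "set_integrable lborel {0..T} g"
    and le: "AE x in lborel. x \<in> {0..T} \<longrightarrow> (norm (f x))\<^sup>2 \<le> g x"
  shows "(L2_norm T f)\<^sup>2 \<le> (LBINT x:{0..T}. g x)"
  unfolding L2_norm_sq by (rule set_integral_mono_AE[OF L2_perD(3)[OF f] g]) (use le in auto)

lemma H1_per_diff:
  fixes f g :: "real \<Rightarrow> 'a::euclidean_space"
  assumes f: "f \<in> H1_per T" and g: "g \<in> H1_per T"
  shows "(\<lambda>x. f x - g x) \<in> H1_per T"
proof -
  have 2: "f \<in> L2_per T" "g \<in> L2_per T" using f g by (auto simp: H1_per_def)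
  note wf = weak_deriv_spec[OF f] and wg = weak_deriv_spec[OF g]
  have i: "set_integrable lborel {0..T} (\<lambda>x. \<theta> x *\<^sub>R h x)" if "\<theta> \<in> per_test T" "h \<in> L2_per T" for \<theta> and h :: "real \<Rightarrow> 'a"
  proof -
    have c: "continuous_on UNIV \<theta>" by (rule per_test_continuous[OF that(1)])
    have "bounded (\<theta> ` {0..T})"
      by (intro compact_imp_bounded compact_continuous_image continuous_on_subset[OF c]) auto
    then obtain B where B: "\<forall>y\<in>\<theta> ` {0..T}. norm y \<le> B" unfolding bounded_iff by blast
    show ?thesis
    proof (rule set_integrable_bound')
      show "set_integrable lborel {0..T} (\<lambda>x. B * norm (h x))"
        using set_integrable_norm[OF L2_per_integrable[OF that(2)]] by simp
      show "(\<lambda>x. \<theta> x *\<^sub>R h x) \<in> borel_measurable borel"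
        by (intro borel_measurable_scaleR borel_measurable_continuous_onI c L2_perD(1)[OF that(2)])
      show "AE x in lborel. x \<in> {0..T} \<longrightarrow> norm (\<theta> x *\<^sub>R h x) \<le> B * norm (h x)"
        using B by (auto intro!: mult_right_mono AE_I2)
    qed
  qed
  have "has_weak_deriv T (\<lambda>x. f x - g x) (\<lambda>x. weak_deriv T f x - weak_deriv T g x)"
    using wf wg 2 unfolding has_weak_deriv_def
    by (simp add: scaleR_right_diff_distrib set_integral_diff i per_test_deriv)
  then show ?thesis using L2_per_diff[OF 2] L2_per_diff[OF wf(1) wg(1)] by (auto simp: H1_per_def)
qed

text \<open>The couplings are cubic, hence Lipschitz on the ball of radius B with a constant of
  order B^2. With p and q the distances in z and y, telescoping gives B^2 (p + 2 q) and B^2 (4 p + 2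
  q); 40 is a generous bound for the resulting quadratic form.\<close>

lemma coupling_difference_bound:
  fixes z1 z2 :: complex and y1 y2 B :: real
  assumes "cmod z1 \<le> B" "cmod z2 \<le> B" "\<bar>y1\<bar> \<le> B" "\<bar>y2\<bar> \<le> B"
  shows "(cmod (of_real (y1\<^sup>2) * z1 - of_real (y2\<^sup>2) * z2))\<^sup>2 + (2 * ((cmod z1)\<^sup>2 * y1 - (cmod z2)\<^sup>2 * y2))\<^sup>2
    \<le> 40 * B ^ 4 * ((cmod (z1 - z2))\<^sup>2 + (y1 - y2)\<^sup>2)"
proof -
  have B: "0 \<le> B" using assms(3) by linarith
  define p where "p = cmod (z1 - z2)"
  define q where "q = \<bar>y1 - y2\<bar>"
  have pq: "0 \<le> p" "0 \<le> q" by (auto simp: p_def q_def)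
  have y12: "y1\<^sup>2 \<le> B\<^sup>2" "(cmod z1)\<^sup>2 \<le> B\<^sup>2" using power_mono[OF assms(3), of 2] power_mono[OF assms(1), of 2] by auto
  have "of_real (y1\<^sup>2) * z1 - of_real (y2\<^sup>2) * z2 = of_real (y1\<^sup>2) * (z1 - z2) + of_real ((y1 - y2) * (y1 + y2)) * z2"
    by (simp add: algebra_simps power2_eq_square)
  then have "cmod (of_real (y1\<^sup>2) * z1 - of_real (y2\<^sup>2) * z2) \<le> cmod (of_real (y1\<^sup>2) * (z1 - z2)) + cmod (of_real ((y1 - y2) * (y1 + y2)) * z2)"
    using norm_triangle_ineq by metis
  also have "\<dots> = y1\<^sup>2 * p + q * (\<bar>y1 + y2\<bar> * cmod z2)" by (simp add: norm_mult p_def q_def norm_power abs_mult mult.assoc flip: of_real_add of_real_diff)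
  also have "\<dots> \<le> B\<^sup>2 * p + q * ((2 * B) * B)"
    using assms pq y12 B by (intro add_mono mult_right_mono mult_left_mono mult_mono) auto
  finally have 1: "cmod (of_real (y1\<^sup>2) * z1 - of_real (y2\<^sup>2) * z2) \<le> B\<^sup>2 * (p + 2 * q)"
    by (simp add: power2_eq_square algebra_simps)
  have c: "\<bar>cmod z1 - cmod z2\<bar> \<le> p" unfolding p_def by (rule norm_triangle_ineq3)
  have "2 * ((cmod z1)\<^sup>2 * y1 - (cmod z2)\<^sup>2 * y2) = 2 * ((cmod z1)\<^sup>2 * (y1 - y2) + (cmod z1 - cmod z2) * ((cmod z1 + cmod z2) * y2))"
    by (simp add: algebra_simps power2_eq_square)
  then have "\<bar>2 * ((cmod z1)\<^sup>2 * y1 - (cmod z2)\<^sup>2 * y2)\<bar> \<le> 2 * (\<bar>(cmod z1)\<^sup>2 * (y1 - y2)\<bar> + \<bar>(cmod z1 - cmod z2) * ((cmod z1 + cmod z2) * y2)\<bar>)"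
  proof -
    have "\<bar>2 * (r + s)\<bar> \<le> 2 * (\<bar>r\<bar> + \<bar>s\<bar>)" for r s :: real
      unfolding abs_mult using abs_triangle_ineq[of r s] by simp
    then show "\<bar>2 * ((cmod z1)\<^sup>2 * y1 - (cmod z2)\<^sup>2 * y2)\<bar> \<le> 2 * (\<bar>(cmod z1)\<^sup>2 * (y1 - y2)\<bar> + \<bar>(cmod z1 - cmod z2) * ((cmod z1 + cmod z2) * y2)\<bar>)"
      if "2 * ((cmod z1)\<^sup>2 * y1 - (cmod z2)\<^sup>2 * y2) = 2 * ((cmod z1)\<^sup>2 * (y1 - y2) + (cmod z1 - cmod z2) * ((cmod z1 + cmod z2) * y2))"
      unfolding that .
  qed
  also have "\<dots> = 2 * ((cmod z1)\<^sup>2 * q + \<bar>cmod z1 - cmod z2\<bar> * ((cmod z1 + cmod z2) * \<bar>y2\<bar>))"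
    by (simp add: abs_mult q_def)
  also have "\<dots> \<le> 2 * (B\<^sup>2 * q + p * ((2 * B) * B))"
    using assms pq y12 B c by (intro mult_left_mono[of _ _ 2] add_mono mult_right_mono mult_mono) auto
  finally have 2: "\<bar>2 * ((cmod z1)\<^sup>2 * y1 - (cmod z2)\<^sup>2 * y2)\<bar> \<le> B\<^sup>2 * (4 * p + 2 * q)"
    by (simp add: power2_eq_square algebra_simps)
  have "(cmod (of_real (y1\<^sup>2) * z1 - of_real (y2\<^sup>2) * z2))\<^sup>2 + (2 * ((cmod z1)\<^sup>2 * y1 - (cmod z2)\<^sup>2 * y2))\<^sup>2
    \<le> (B\<^sup>2 * (p + 2 * q))\<^sup>2 + (B\<^sup>2 * (4 * p + 2 * q))\<^sup>2"
    using power_mono[OF 1, of 2] power_mono[OF 2, of 2] by simp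
  also have "\<dots> = B ^ 4 * ((p + 2 * q)\<^sup>2 + (4 * p + 2 * q)\<^sup>2)"
    unfolding power_mult_distrib[of "B\<^sup>2"] by (simp add: distrib_left flip: power_mult)
  also have "\<dots> \<le> B ^ 4 * (40 * (p\<^sup>2 + q\<^sup>2))"
  proof (rule mult_left_mono)
    have "(p + 2 * q)\<^sup>2 + (4 * p + 2 * q)\<^sup>2 = 17 * p\<^sup>2 + 8 * q\<^sup>2 + 10 * (2 * p * q)"
      by (simp add: power2_eq_square algebra_simps)
    also have "\<dots> \<le> 17 * p\<^sup>2 + 8 * q\<^sup>2 + 10 * (p\<^sup>2 + q\<^sup>2)"
      by (intro add_left_mono mult_left_mono sum_squares_bound) simp
    also have "\<dots> \<le> 40 * (p\<^sup>2 + q\<^sup>2)" by simp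
    finally show "(p + 2 * q)\<^sup>2 + (4 * p + 2 * q)\<^sup>2 \<le> 40 * (p\<^sup>2 + q\<^sup>2)" .
  qed simp
  also have "\<dots> = 40 * B ^ 4 * ((cmod (z1 - z2))\<^sup>2 + (y1 - y2)\<^sup>2)" by (simp add: p_def q_def)
  finally show ?thesis .
qed

text \<open>The uniform bound for t \<ge> 0 is what a solution near the orbit provides by the
  Sobolev embedding. Equality of the initial data is stated for Fourier coefficients, where the
  energy argument starts.\<close>

locale two_solutions =
  fixes L m B :: real and u1 u2 :: "real \<Rightarrow> real \<Rightarrow> complex" and v1 v2 w1 w2 :: "real \<Rightarrow> real \<Rightarrow> real"
  assumes L: "L > 0" and m: "m \<noteq> 0"
    and sys: "\<And>t. system_at L m u1 v1 w1 t" "\<And>t. system_at L m u2 v2 w2 t"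
    and H1: "\<And>t. u1 t \<in> H1_per (2 * L)" "\<And>t. u2 t \<in> H1_per (2 * L)" "\<And>t. v1 t \<in> H1_per (2 * L)" "\<And>t. v2 t \<in> H1_per (2 * L)"
    and bound: "\<And>t. 0 \<le> t \<Longrightarrow> AE x in lborel. x \<in> {0..2 * L} \<longrightarrow>
        cmod (u1 t x) \<le> B \<and> cmod (u2 t x) \<le> B \<and> \<bar>v1 t x\<bar> \<le> B \<and> \<bar>v2 t x\<bar> \<le> B"
    and init: "\<And>n. fcoef (2*L) (u1 0) n = fcoef (2*L) (u2 0) n" "\<And>n. fcoef (2*L) (v1 0) n = fcoef (2*L) (v2 0) n"
      "\<And>n. fcoef (2*L) (w1 0) n = fcoef (2*L) (w2 0) n"
begin

abbreviation "T \<equiv> 2 * L"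

definition "U t x = u1 t x - u2 t x"
definition "V t x = v1 t x - v2 t x"
definition "Uc n t = fcoef T (u1 t) n - fcoef T (u2 t) n"
definition "Vc n t = fcoef T (v1 t) n - fcoef T (v2 t) n"
definition "Wc n t = fcoef T (w1 t) n - fcoef T (w2 t) n"
definition "F t x = of_real ((v1 t x)\<^sup>2) * u1 t x - of_real ((v2 t x)\<^sup>2) * u2 t x"
definition "G t x = 2 * ((cmod (u1 t x))\<^sup>2 * v1 t x - (cmod (u2 t x))\<^sup>2 * v2 t x)"
definition "deviation t = (L2_norm T (U t))\<^sup>2 + (L2_norm T (V t))\<^sup>2"
text \<open>Mass of the Schroedinger mode plus energy of the Klein-Gordon mode. The linear flow
  conserves both, so only the couplings survive in the time derivative, without any power of the
  frequency.\<close>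

definition "mode_energy n t = (cmod (Uc n t))\<^sup>2 + (Wc n t)\<^sup>2 + ((freq T n)\<^sup>2 + m\<^sup>2) * (Vc n t)\<^sup>2"

lemma T: "T > 0" using L by simp

lemma L2: "u1 t \<in> L2_per T" "u2 t \<in> L2_per T" "v1 t \<in> L2_per T" "v2 t \<in> L2_per T"
  using H1 by (auto simp: H1_per_def)

lemma UV_H1: "U t \<in> H1_per T" "V t \<in> H1_per T"
  unfolding U_def[abs_def] V_def[abs_def] by (intro H1_per_diff H1)+

lemma UV_L2: "U t \<in> L2_per T" "V t \<in> L2_per T"
  using UV_H1 by (auto simp: H1_per_def)

lemma fcoef_UV: "fcoef T (U t) n = Uc n t" "fcoef T (V t) n = Vc n t"
  unfolding U_def[abs_def] V_def[abs_def] Uc_def Vc_def by (intro fcoef_diff T L2_per_integrable L2)+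

text \<open>Boundedness keeps the cubic terms square integrable, so that Bessel applies to the
  forcing.\<close>

lemma products_L2:
  assumes t: "0 \<le> t"
  shows "(\<lambda>x. complex_of_real ((v1 t x)\<^sup>2) * u1 t x) \<in> L2_per T" "(\<lambda>x. complex_of_real ((v2 t x)\<^sup>2) * u2 t x) \<in> L2_per T"
    "(\<lambda>x. (cmod (u1 t x))\<^sup>2 * v1 t x) \<in> L2_per T" "(\<lambda>x. (cmod (u2 t x))\<^sup>2 * v2 t x) \<in> L2_per T"
proof -
  have *: "(\<lambda>x. complex_of_real ((v x)\<^sup>2) * u x) \<in> L2_per T \<and> (\<lambda>x. (cmod (u x))\<^sup>2 * v x) \<in> L2_per T"
    if u: "u \<in> L2_per T" and v: "v \<in> L2_per T" and B: "AE x in lborel. x \<in> {0..T} \<longrightarrow> cmod (u x) \<le> B \<and> \<bar>v x\<bar> \<le> B" for u v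
  proof -
    note [measurable] = L2_perD(1)[OF u] L2_perD(1)[OF v]
    have 1: "cmod (complex_of_real (y\<^sup>2) * z) \<le> B\<^sup>2 * B" "\<bar>(cmod z)\<^sup>2 * y\<bar> \<le> B\<^sup>2 * B"
      if "cmod z \<le> B" "\<bar>y\<bar> \<le> B" for y z
      using that power_mono[OF that(1), of 2] power_mono[OF that(2), of 2]
      by (auto simp: norm_mult norm_power abs_mult intro!: mult_mono)
    have "(\<lambda>x. complex_of_real ((v x)\<^sup>2) * u x) \<in> L2_per T"
      by (rule AE_bounded_L2_per[where B = "B\<^sup>2 * B"])
        (use B 1(1) in \<open>auto simp del: of_real_power simp: L2_perD(2)[OF u] L2_perD(2)[OF v] elim!: eventually_mono\<close>)
    moreover have "(\<lambda>x. (cmod (u x))\<^sup>2 * v x) \<in> L2_per T"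
      by (rule AE_bounded_L2_per[where B = "B\<^sup>2 * B"])
        (use B 1(2) in \<open>auto simp: L2_perD(2)[OF u] L2_perD(2)[OF v] elim!: eventually_mono\<close>)
    ultimately show ?thesis ..
  qed
  have "AE x in lborel. x \<in> {0..T} \<longrightarrow> cmod (u1 t x) \<le> B \<and> \<bar>v1 t x\<bar> \<le> B"
    "AE x in lborel. x \<in> {0..T} \<longrightarrow> cmod (u2 t x) \<le> B \<and> \<bar>v2 t x\<bar> \<le> B"
    using bound[OF t] by (auto elim!: eventually_mono)
  from *[OF L2(1,3) this(1)] *[OF L2(2,4) this(2)]
  show "(\<lambda>x. complex_of_real ((v1 t x)\<^sup>2) * u1 t x) \<in> L2_per T" "(\<lambda>x. complex_of_real ((v2 t x)\<^sup>2) * u2 t x) \<in> L2_per T"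
    "(\<lambda>x. (cmod (u1 t x))\<^sup>2 * v1 t x) \<in> L2_per T" "(\<lambda>x. (cmod (u2 t x))\<^sup>2 * v2 t x) \<in> L2_per T" by auto
qed

lemma fcoef_FG:
  assumes t: "0 \<le> t"
  shows "fcoef T (F t) n = fcoef T (\<lambda>x. complex_of_real ((v1 t x)\<^sup>2) * u1 t x) n - fcoef T (\<lambda>x. complex_of_real ((v2 t x)\<^sup>2) * u2 t x) n"
    "fcoef T (G t) n = 2 * fcoef T (\<lambda>x. (cmod (u1 t x))\<^sup>2 * v1 t x) n - 2 * fcoef T (\<lambda>x. (cmod (u2 t x))\<^sup>2 * v2 t x) n"
    "F t \<in> L2_per T" "G t \<in> L2_per T"
proof -
  note p = products_L2[OF t]
  show "fcoef T (F t) n = fcoef T (\<lambda>x. complex_of_real ((v1 t x)\<^sup>2) * u1 t x) n - fcoef T (\<lambda>x. complex_of_real ((v2 t x)\<^sup>2) * u2 t x) n"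
    unfolding F_def[abs_def] by (intro fcoef_diff T L2_per_integrable p)
  show "F t \<in> L2_per T" unfolding F_def[abs_def] by (intro L2_per_diff p)
  have d: "(\<lambda>x. (cmod (u1 t x))\<^sup>2 * v1 t x - (cmod (u2 t x))\<^sup>2 * v2 t x) \<in> L2_per T" (is "?d \<in> _") by (intro L2_per_diff p)
  have G2: "G t = (\<lambda>x. ?d x + ?d x)" by (rule ext) (simp add: G_def)
  show "G t \<in> L2_per T" unfolding G2 by (intro L2_per_add d)
  have "fcoef T (G t) n = 2 * fcoef T ?d n"
    unfolding fcoef_def G_def[abs_def] real_scaleR_def by (simp only: mult.left_commute[of _ 2] set_integral_mult_right)
  also have "fcoef T ?d n = fcoef T (\<lambda>x. (cmod (u1 t x))\<^sup>2 * v1 t x) n - fcoef T (\<lambda>x. (cmod (u2 t x))\<^sup>2 * v2 t x) n"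
    by (intro fcoef_diff T L2_per_integrable p)
  finally show "fcoef T (G t) n = 2 * fcoef T (\<lambda>x. (cmod (u1 t x))\<^sup>2 * v1 t x) n - 2 * fcoef T (\<lambda>x. (cmod (u2 t x))\<^sup>2 * v2 t x) n"
    by simp
qed

lemma FG_bound:
  assumes t: "0 \<le> t"
  shows "(L2_norm T (F t))\<^sup>2 + (L2_norm T (G t))\<^sup>2 \<le> 40 * B ^ 4 * deviation t"
proof -
  note FG = fcoef_FG(3,4)[OF t]
  have "(L2_norm T (F t))\<^sup>2 + (L2_norm T (G t))\<^sup>2 = (LBINT x:{0..T}. (norm (F t x))\<^sup>2 + (norm (G t x))\<^sup>2)"
    unfolding L2_norm_sq using L2_perD(3)[OF FG(1)] L2_perD(3)[OF FG(2)] by (rule set_integral_add(2)[symmetric])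
  also have "\<dots> \<le> (LBINT x:{0..T}. 40 * B ^ 4 * ((norm (U t x))\<^sup>2 + (norm (V t x))\<^sup>2))"
  proof (rule set_integral_mono_AE)
    show "set_integrable lborel {0..T} (\<lambda>x. (norm (F t x))\<^sup>2 + (norm (G t x))\<^sup>2)"
      using L2_perD(3)[OF FG(1)] L2_perD(3)[OF FG(2)] by (rule set_integral_add(1))
    show "set_integrable lborel {0..T} (\<lambda>x. 40 * B ^ 4 * ((norm (U t x))\<^sup>2 + (norm (V t x))\<^sup>2))"
      by (intro set_integrable_mult_right set_integral_add(1) L2_perD(3) UV_L2)
    show "AE x \<in> {0..T} in lborel. (norm (F t x))\<^sup>2 + (norm (G t x))\<^sup>2 \<le> 40 * B ^ 4 * ((norm (U t x))\<^sup>2 + (norm (V t x))\<^sup>2)"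
      using bound[OF t]
    proof eventually_elim
      case (elim x)
      then show ?case using coupling_difference_bound[of "u1 t x" B "u2 t x" "v1 t x" "v2 t x"]
        by (simp add: F_def G_def U_def V_def)
    qed
  qed
  also have "\<dots> = 40 * B ^ 4 * deviation t"
    unfolding deviation_def L2_norm_sq set_integral_mult_right
    using L2_perD(3)[OF UV_L2(1)] L2_perD(3)[OF UV_L2(2)] by (subst set_integral_add(2)) auto
  finally show ?thesis .
qed

text \<open>The dispersive term is i times a real multiple of \<open>Uc n t\<close>, hence
  orthogonal to it, and the mixed terms of the oscillator pair (\<open>Vc\<close>,
  \<open>Wc\<close>) cancel. The forcing is split by 2 x y \<le> x^2 + y^2.\<close>

lemma mode_energy_deriv:
  assumes t: "0 \<le> t"
  obtains E' where "(mode_energy n has_real_derivative E') (at t)"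
    "E' \<le> mode_energy n t + ((cmod (fcoef T (F t) n))\<^sup>2 + (norm (fcoef T (G t) n))\<^sup>2)"
proof -
  define \<nu> where "\<nu> = (freq T n)\<^sup>2 + m\<^sup>2"
  define f where "f = fcoef T (F t) n"
  define g where "g = fcoef T (G t) n"
  have \<nu>: "0 \<le> \<nu>" by (simp add: \<nu>_def)
  note S1 = system_at_fcoef[OF L sys(1), of n t] and S2 = system_at_fcoef[OF L sys(2), of n t]
  have dU: "(Uc n has_vector_derivative \<i> * f - \<i> * ((freq T n)\<^sup>2 / 2) * Uc n t) (at t)"
    unfolding Uc_def[abs_def] f_def fcoef_FG(1)[OF t]
    by (rule has_vector_derivative_eq_rhs[OF has_vector_derivative_diff[OF S1(1) S2(1)]]) (simp add: algebra_simps)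
  have dV: "(Vc n has_vector_derivative Wc n t) (at t)"
    unfolding Vc_def[abs_def] Wc_def by (rule has_vector_derivative_diff[OF S1(2) S2(2)])
  have dW: "(Wc n has_vector_derivative g - \<nu> * Vc n t) (at t)"
    unfolding Wc_def[abs_def] Vc_def g_def fcoef_FG(2)[OF t] \<nu>_def
    by (rule has_vector_derivative_eq_rhs[OF has_vector_derivative_diff[OF S1(3) S2(3)]]) (simp add: algebra_simps)
  have dU2: "((\<lambda>t. (cmod (Uc n t))\<^sup>2) has_real_derivative 2 * (Uc n t \<bullet> (\<i> * f))) (at t)"
  proof -
    have "((\<lambda>t. Uc n t \<bullet> Uc n t) has_vector_derivative
       (Uc n t \<bullet> (\<i> * f - \<i> * ((freq T n)\<^sup>2 / 2) * Uc n t) + (\<i> * f - \<i> * ((freq T n)\<^sup>2 / 2) * Uc n t) \<bullet> Uc n t)) (at t)"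
      by (rule bounded_bilinear.has_vector_derivative[OF bounded_bilinear_inner dU dU])
    moreover have "Uc n t \<bullet> (\<i> * f - \<i> * ((freq T n)\<^sup>2 / 2) * Uc n t) = Uc n t \<bullet> (\<i> * f)"
      by (simp add: inner_complex_def algebra_simps flip: of_real_power)
    ultimately show ?thesis
      by (simp add: power2_norm_eq_inner has_real_derivative_iff_has_vector_derivative inner_commute)
  qed
  have "(mode_energy n has_real_derivative 2 * (Uc n t \<bullet> (\<i> * f)) + 2 * Wc n t * g) (at t)"
  proof -
    note d = dV[folded has_real_derivative_iff_has_vector_derivative] dW[folded has_real_derivative_iff_has_vector_derivative]
    have "((\<lambda>t. (Wc n t)\<^sup>2) has_real_derivative 2 * (Wc n t * (g - \<nu> * Vc n t))) (at t)"
      "((\<lambda>t. (Vc n t)\<^sup>2) has_real_derivative 2 * (Vc n t * Wc n t)) (at t)"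
      using d by (auto intro!: derivative_eq_intros)
    from DERIV_add[OF DERIV_add[OF dU2 this(1)] DERIV_cmult[OF this(2), of \<nu>]]
    have "(mode_energy n has_real_derivative
       2 * (Uc n t \<bullet> (\<i> * f)) + 2 * (Wc n t * (g - \<nu> * Vc n t)) + \<nu> * (2 * (Vc n t * Wc n t))) (at t)"
      unfolding mode_energy_def[abs_def] \<nu>_def[symmetric] .
    then show ?thesis by (simp add: algebra_simps)
  qed
  moreover have "2 * (Uc n t \<bullet> (\<i> * f)) + 2 * Wc n t * g \<le> mode_energy n t + ((cmod f)\<^sup>2 + (norm g)\<^sup>2)"
  proof -
    have "2 * (Uc n t \<bullet> (\<i> * f)) \<le> (cmod (Uc n t))\<^sup>2 + (cmod f)\<^sup>2"
      using norm_cauchy_schwarz[of "Uc n t" "\<i> * f"] sum_squares_bound[of "cmod (Uc n t)" "cmod f"] by (simp add: norm_mult)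
    moreover have "2 * Wc n t * g \<le> (Wc n t)\<^sup>2 + g\<^sup>2" by (rule sum_squares_bound)
    moreover have "0 \<le> \<nu> * (Vc n t)\<^sup>2" using \<nu> by simp
    ultimately show ?thesis unfolding mode_energy_def \<nu>_def[symmetric] by simp
  qed
  ultimately show ?thesis using that by (simp add: f_def g_def)
qed

lemma mode_energy_0: "mode_energy n 0 = 0"
  using init by (simp add: mode_energy_def Uc_def Vc_def Wc_def)

text \<open>Here m \<noteq> 0 enters: at frequency 0 the energy controls the coefficient of V only
  through m^2, whence the summand 1 / m^2.\<close>

lemma deviation_le:
  assumes "\<And>A. finite A \<Longrightarrow> (\<Sum>n\<in>A. mode_energy n t) \<le> Z"
  shows "deviation t \<le> (1 + 1 / m\<^sup>2) * Z"
proof -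
  have 1: "(cmod (Uc n t))\<^sup>2 \<le> mode_energy n t" "m\<^sup>2 * (Vc n t)\<^sup>2 \<le> mode_energy n t" for n
    by (simp_all add: mode_energy_def distrib_right)
  have "(\<Sum>n\<in>A. (norm (fcoef T (U t) n))\<^sup>2) \<le> Z" if "finite A" for A
    using assms[OF that] sum_mono[of A "\<lambda>n. (cmod (Uc n t))\<^sup>2" "\<lambda>n. mode_energy n t"] 1(1) by (simp add: fcoef_UV)
  then have a: "(L2_norm T (U t))\<^sup>2 \<le> Z" by (rule H1_parseval_le[OF T UV_H1(1)])
  have "(\<Sum>n\<in>A. (norm (fcoef T (V t) n))\<^sup>2) \<le> Z / m\<^sup>2" if "finite A" for A
  proof -
    have "(\<Sum>n\<in>A. m\<^sup>2 * (Vc n t)\<^sup>2) \<le> Z" using sum_mono[of A, OF 1(2)] assms[OF that] by (rule order_trans)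
    then have "m\<^sup>2 * (\<Sum>n\<in>A. (Vc n t)\<^sup>2) \<le> Z" by (simp only: sum_distrib_left)
    then show ?thesis using m by (simp only: fcoef_UV real_norm_def power2_abs) (simp add: pos_le_divide_eq mult.commute)
  qed
  then have b: "(L2_norm T (V t))\<^sup>2 \<le> Z / m\<^sup>2" by (rule H1_parseval_le[OF T UV_H1(2)])
  show ?thesis using a b by (simp add: deviation_def algebra_simps)
qed

lemma deviation_nonneg: "0 \<le> deviation t" by (simp add: deviation_def)

text \<open>The crude bound from which the halving starts: two differences, each at most 2 B in
  norm, over an interval of length \<open>T\<close>.\<close>

lemma deviation_bounded:
  assumes t: "0 \<le> t" shows "deviation t \<le> 8 * B\<^sup>2 * T"
proof -
  have "4 * B\<^sup>2 = (B + B)\<^sup>2" by (simp add: power2_eq_square)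
  then have *: "(norm (a - b))\<^sup>2 \<le> 4 * B\<^sup>2" if "norm a \<le> B" "norm b \<le> B" for a b :: "'a::real_normed_vector"
  proof -
    have "norm (a - b) \<le> B + B" using norm_triangle_ineq4[of a b] that by linarith
    then show ?thesis unfolding \<open>4 * B\<^sup>2 = (B + B)\<^sup>2\<close> by (intro power_mono) auto
  qed
  have int: "(LBINT x:{0..T}. 4 * B\<^sup>2) = T * (4 * B\<^sup>2)" using T by (simp add: set_lebesgue_integral_def)
  have "AE x in lborel. x \<in> {0..T} \<longrightarrow> (norm (U t x))\<^sup>2 \<le> 4 * B\<^sup>2"
    using bound[OF t] by eventually_elim (auto simp: U_def intro!: *)
  note U = L2_norm_sq_le_AE[OF UV_L2(1) set_integrable_const_Icc this, unfolded int]
  have "AE x in lborel. x \<in> {0..T} \<longrightarrow> (norm (V t x))\<^sup>2 \<le> 4 * B\<^sup>2"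
    using bound[OF t] by eventually_elim (auto simp: V_def simp del: real_norm_def intro!: *, auto)
  note V = L2_norm_sq_le_AE[OF UV_L2(2) set_integrable_const_Icc this, unfolded int]
  have "T * (4 * B\<^sup>2) + T * (4 * B\<^sup>2) = 8 * B\<^sup>2 * T" by simp
  then show ?thesis using add_mono[OF U V] by (simp only: deviation_def)
qed

text \<open>A Gronwall step in the weight \<open>exp (K * t)\<close>: for \<open>K\<close> large it halves the constant, so that
  iterating it forces the deviation to vanish.\<close>

lemma deviation_halving:
  fixes S :: real
  defines "M \<equiv> 40 * B ^ 4"
  defines "K \<equiv> 2 + 2 * ((1 + 1 / m\<^sup>2) * M)"
  assumes S: "0 \<le> S" and y: "\<And>t. 0 \<le> t \<Longrightarrow> deviation t \<le> S * exp (K * t)" and t: "0 \<le> t"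
  shows "deviation t \<le> S / 2 * exp (K * t)"
proof -
  have M: "0 \<le> M" by (simp add: M_def)
  then have K: "K > 1" 
  proof -
    have "0 \<le> (1 + 1 / m\<^sup>2) * M" using M by (intro mult_nonneg_nonneg) auto
    then show ?thesis unfolding K_def by linarith
  qed
  have "(\<Sum>n\<in>A. mode_energy n t) \<le> M * S / (K - 1) * exp (K * t)" if A: "finite A" for A
  proof -
    define \<phi> where "\<phi> = (\<lambda>t. \<Sum>n\<in>A. mode_energy n t)"
    define c where "c = M * S / (K - 1)"
    have c: "c * (K - 1) = M * S" "0 \<le> c" using K M S by (auto simp: c_def)
    \<comment> \<open>Integrating factor exp (- t); the subtracted exponential absorbs the forcing
      because c (K - 1) = M S.\<close>
    define \<psi> where "\<psi> = (\<lambda>t. exp (- t) * \<phi> t - c * exp ((K - 1) * t))"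
    have "\<psi> t \<le> \<psi> 0"
    proof (rule DERIV_nonpos_imp_nonincreasing[OF t])
      fix s assume s: "0 \<le> s" "s \<le> t"
      define E where "E = (\<lambda>n. SOME E'. (mode_energy n has_real_derivative E') (at s) \<and>
          E' \<le> mode_energy n s + ((cmod (fcoef T (F s) n))\<^sup>2 + (norm (fcoef T (G s) n))\<^sup>2))"
      have "\<exists>E'. (mode_energy n has_real_derivative E') (at s) \<and>
          E' \<le> mode_energy n s + ((cmod (fcoef T (F s) n))\<^sup>2 + (norm (fcoef T (G s) n))\<^sup>2)" for n
        using mode_energy_deriv[OF s(1), of n] by metis
      from someI_ex[OF this] have E: "(mode_energy n has_real_derivative E n) (at s)"
        "E n \<le> mode_energy n s + ((cmod (fcoef T (F s) n))\<^sup>2 + (norm (fcoef T (G s) n))\<^sup>2)" for n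
        unfolding E_def by blast+
      have d: "(\<phi> has_real_derivative (\<Sum>n\<in>A. E n)) (at s)"
        unfolding \<phi>_def by (intro DERIV_sum E)
      have "(\<Sum>n\<in>A. E n) \<le> \<phi> s + ((\<Sum>n\<in>A. (cmod (fcoef T (F s) n))\<^sup>2) + (\<Sum>n\<in>A. (norm (fcoef T (G s) n))\<^sup>2))"
        using sum_mono[of A E, OF E(2)] by (simp add: \<phi>_def sum.distrib)
      \<comment> \<open>The couplings mix all modes, so the inequality for a finite sum does not
        close on itself. Bessel passes to the full L^2 norms of the forcing, which the assumed bound
        on the deviation controls.\<close>
      also have "(\<Sum>n\<in>A. (cmod (fcoef T (F s) n))\<^sup>2) \<le> (L2_norm T (F s))\<^sup>2"
        by (rule bessel[OF T fcoef_FG(3)[OF s(1)] A])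
      also have "(\<Sum>n\<in>A. (norm (fcoef T (G s) n))\<^sup>2) \<le> (L2_norm T (G s))\<^sup>2"
        by (rule bessel[OF T fcoef_FG(4)[OF s(1)] A])
      also have "(L2_norm T (F s))\<^sup>2 + (L2_norm T (G s))\<^sup>2 \<le> M * deviation s"
        unfolding M_def by (rule FG_bound[OF s(1)])
      also have "M * deviation s \<le> M * (S * exp (K * s))" by (intro mult_left_mono y s M)
      finally have le: "(\<Sum>n\<in>A. E n) \<le> \<phi> s + M * (S * exp (K * s))" by simp
      have "(\<psi> has_real_derivative exp (- s) * ((\<Sum>n\<in>A. E n) - \<phi> s - M * (S * exp (K * s)))) (at s)"
      proof -
        have "(\<psi> has_real_derivative exp (- s) * (- 1) * \<phi> s + (\<Sum>n\<in>A. E n) * exp (- s) - c * (exp ((K - 1) * s) * (K - 1))) (at s)"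
          unfolding \<psi>_def by (rule derivative_eq_intros d refl | simp)+
        moreover have "c * (exp ((K - 1) * s) * (K - 1)) = exp (- s) * (M * (S * exp (K * s)))"
        proof -
          have "exp ((K - 1) * s) = exp (- s) * exp (K * s)" by (simp add: exp_add[symmetric] algebra_simps)
          then have "c * (exp ((K - 1) * s) * (K - 1)) = (c * (K - 1)) * (exp (- s) * exp (K * s))" by simp
          then show ?thesis unfolding c by simp
        qed
        ultimately show ?thesis by (simp add: algebra_simps)
      qed
      moreover have "exp (- s) * ((\<Sum>n\<in>A. E n) - \<phi> s - M * (S * exp (K * s))) \<le> 0"
        using le by (intro mult_nonneg_nonpos) auto
      ultimately show "\<exists>y. (\<psi> has_real_derivative y) (at s) \<and> y \<le> 0" by blast
    qed
    also have "\<psi> 0 \<le> 0" using c by (simp add: \<psi>_def \<phi>_def mode_energy_0)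
    finally have "exp (- t) * \<phi> t \<le> c * exp ((K - 1) * t)" by (simp add: \<psi>_def)
    then have "exp t * (exp (- t) * \<phi> t) \<le> exp t * (c * exp ((K - 1) * t))"
      by (rule mult_left_mono) simp
    also have "exp t * (exp (- t) * \<phi> t) = \<phi> t" by (simp add: mult.assoc[symmetric] exp_add[symmetric])
    also have "exp t * (c * exp ((K - 1) * t)) = M * S / (K - 1) * exp (K * t)"
    proof -
      have "exp (K * t) = exp t * exp ((K - 1) * t)" by (simp add: exp_add[symmetric] algebra_simps)
      then show ?thesis by (simp add: c_def)
    qed
    finally show ?thesis by (simp add: \<phi>_def)
  qed
  then have "deviation t \<le> (1 + 1 / m\<^sup>2) * (M * S / (K - 1) * exp (K * t))" by (rule deviation_le)
  also have "\<dots> = ((1 + 1 / m\<^sup>2) * M) / (K - 1) * (S * exp (K * t))" by simp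
  \<comment> \<open>K - 1 = 1 + 2 (1 + 1 / m^2) M, so the quotient is below 1 / 2.\<close>
  also have "\<dots> \<le> 1 / 2 * (S * exp (K * t))"
    using S K by (intro mult_right_mono) (auto simp: K_def field_simps)
  finally show ?thesis by simp
qed

text \<open>The rate K stays the same in every round while the constant is halved. The argument uses
  pointwise bounds in t alone: the deviation itself is never differentiated or integrated in
  time.\<close>

lemma deviation_zero:
  assumes t: "0 \<le> t" shows "deviation t = 0"
proof -
  define M where "M = 40 * B ^ 4"
  define K where "K = 2 + 2 * ((1 + 1 / m\<^sup>2) * M)"
  have K: "0 \<le> K" by (simp add: K_def M_def)
  define S where "S = 8 * B\<^sup>2 * T"
  have S: "0 \<le> S" using T by (simp add: S_def)
  have "\<forall>t\<ge>0. deviation t \<le> S / 2 ^ n * exp (K * t)" for n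
  proof (induction n)
    case 0
    have "S * 1 \<le> S * exp (K * t)" if "0 \<le> t" for t using S K that by (intro mult_left_mono) auto
    then show ?case using deviation_bounded by (fastforce simp: S_def)
  next
    case (Suc n)
    have "deviation t \<le> S / 2 ^ n / 2 * exp (K * t)" if "0 \<le> t" for t
      unfolding K_def M_def by (rule deviation_halving) (use Suc S that in \<open>auto simp: K_def M_def\<close>)
    then show ?case by (simp add: field_simps)
  qed
  then have le: "deviation t \<le> S / 2 ^ n * exp (K * t)" for n using t by blast
  have "(\<lambda>n. S / 2 ^ n * exp (K * t)) \<longlonglongrightarrow> 0 * exp (K * t)"
    by (intro tendsto_intros LIMSEQ_divide_realpow_zero) simp
  then have "deviation t \<le> 0 * exp (K * t)" by (rule LIMSEQ_le_const) (use le in auto)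
  then show ?thesis using deviation_nonneg[of t] by simp
qed

lemma unique:
  assumes "0 \<le> t" shows "AE x in lborel. x \<in> {0..2 * L} \<longrightarrow> v1 t x = v2 t x"
proof -
  have "L2_norm T (V t) = 0" using deviation_zero[OF assms] by (simp add: deviation_def add_nonneg_eq_0_iff)
  then have "fcoef T (V t) n = 0" for n using bessel[OF T UV_L2(2), of "{n}" t] by simp
  then have "AE x in lborel. x \<in> {0..T} \<longrightarrow> V t x = 0"
    by (intro cas_complete[OF T L2_per_integrable[OF UV_L2(2)]]) (simp add: fcoef_def)
  then show ?thesis by (simp add: V_def)
qed

end

subsection \<open>Explicit travelling waves\<close>

definition eta :: "real \<Rightarrow> real \<Rightarrow> real" where "eta L k = 2 * ellK k / L"

text \<open>Apart from the boost exp (i a x), the current |R|^2 times the derivative of the phase is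
  constant, equal to - (1 - a^2) j. The profile equation forces j^2: at the formal zero s = - q of
  the density q + s it leaves j^2 = q P(- q), where P(s) = (\<eta>^2 - s) (s - \<eta>^2 (1 - k^2))
  is the square of D' at D^2 = s.\<close>

definition tw_flux :: "real \<Rightarrow> real \<Rightarrow> real \<Rightarrow> real" where
  "tw_flux L k q = sqrt (- q * (q + (eta L k)\<^sup>2) * (q + (eta L k)\<^sup>2 * (1 - k\<^sup>2)))"

text \<open>Solves (1 - a^2) (q + C) = c for a \<ge> 0; this is the condition for D to satisfy the
  equation for v.\<close>

definition tw_speed :: "real \<Rightarrow> real \<Rightarrow> real \<Rightarrow> real \<Rightarrow> real" where
  "tw_speed L k c q = sqrt (1 - c / (q + wave_speed_parameter L k))"

definition tw_density :: "real \<Rightarrow> real \<Rightarrow> real \<Rightarrow> real \<Rightarrow> real" where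
  "tw_density L k q x = q + (dn_wave L k x)\<^sup>2"

definition tw_wavenumber :: "real \<Rightarrow> real \<Rightarrow> real \<Rightarrow> real \<Rightarrow> real \<Rightarrow> real" where
  "tw_wavenumber L k c q x = tw_speed L k c q - tw_flux L k q / tw_density L k q x"

definition tw_phase :: "real \<Rightarrow> real \<Rightarrow> real \<Rightarrow> real \<Rightarrow> real \<Rightarrow> real" where
  "tw_phase L k c q x = (LBINT y=(0::real)..x. tw_wavenumber L k c q y)"

definition tw_profile :: "real \<Rightarrow> real \<Rightarrow> real \<Rightarrow> real \<Rightarrow> real \<Rightarrow> complex" where
  "tw_profile L k c q x = of_real (sqrt ((1 - (tw_speed L k c q)\<^sup>2) * tw_density L k q x)) * cis (tw_phase L k c q x)"

definition tw_profile' :: "real \<Rightarrow> real \<Rightarrow> real \<Rightarrow> real \<Rightarrow> real \<Rightarrow> complex" where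
  "tw_profile' L k c q x = tw_profile L k c q x *
     Complex (dn_wave L k x * dn_wave' L k x / tw_density L k q x) (tw_wavenumber L k c q x)"

text \<open>Fixed by the constant term in the real part of the Riccati equation for R' / R.\<close>

definition tw_frequency :: "real \<Rightarrow> real \<Rightarrow> real \<Rightarrow> real \<Rightarrow> real" where
  "tw_frequency L k c q = ((tw_speed L k c q)\<^sup>2 + q + 2 * wave_speed_parameter L k) / 2"

text \<open>The conditions on q make the formulas meaningful: the first and the last give a real
  flux, the second a real speed, the last a positive density.\<close>

locale tw_parameters =
  fixes L k c q :: real
  assumes L: "L > 0" and k: "0 \<le> k" "k < 1" and c: "c > 0"
    and q: "q \<le> 0" "c \<le> q + wave_speed_parameter L k" "0 < q + (eta L k)\<^sup>2 * (1 - k\<^sup>2)"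
begin

abbreviation "D \<equiv> dn_wave L k"
abbreviation "D' \<equiv> dn_wave' L k"
abbreviation "C \<equiv> wave_speed_parameter L k"
abbreviation "\<eta> \<equiv> eta L k"
abbreviation "j \<equiv> tw_flux L k q"
abbreviation "a \<equiv> tw_speed L k c q"
abbreviation "g \<equiv> tw_density L k q"
abbreviation "\<Theta> \<equiv> tw_phase L k c q"
abbreviation "\<Theta>' \<equiv> tw_wavenumber L k c q"
abbreviation "R \<equiv> tw_profile L k c q"
abbreviation "R' \<equiv> tw_profile' L k c q"
abbreviation "\<omega> \<equiv> tw_frequency L k c q"

lemma eta_pos': "\<eta> > 0" using eta_pos[OF L k] by (simp add: eta_def)

lemma dn_bounds: "\<eta>\<^sup>2 * (1 - k\<^sup>2) \<le> (D x)\<^sup>2" "(D x)\<^sup>2 \<le> \<eta>\<^sup>2"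
  using dn_wave_sq_bounds[OF L k] by (simp_all add: eta_def)

lemma density_bounds: "q + \<eta>\<^sup>2 * (1 - k\<^sup>2) \<le> g x" "g x \<le> q + \<eta>\<^sup>2" "0 < g x"
  using dn_bounds[of x] q(3) by (auto simp: tw_density_def)

lemma flux_sq: "j\<^sup>2 = - q * (q + \<eta>\<^sup>2) * (q + \<eta>\<^sup>2 * (1 - k\<^sup>2))" "0 \<le> j"
proof -
  have "0 \<le> q + \<eta>\<^sup>2" using density_bounds[of 0] by linarith
  then have "0 \<le> - q * (q + \<eta>\<^sup>2) * (q + \<eta>\<^sup>2 * (1 - k\<^sup>2))" using q by (intro mult_nonneg_nonneg) auto
  then show "j\<^sup>2 = - q * (q + \<eta>\<^sup>2) * (q + \<eta>\<^sup>2 * (1 - k\<^sup>2))" "0 \<le> j" by (simp_all add: tw_flux_def)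
qed

lemma speed: "a\<^sup>2 = 1 - c / (q + C)" "0 \<le> a" "0 < 1 - a\<^sup>2" "(1 - a\<^sup>2) * (q + C) = c"
proof -
  have qC: "0 < q + C" using q c by linarith
  then have "c / (q + C) \<le> 1" using q by simp
  then show 1: "a\<^sup>2 = 1 - c / (q + C)" "0 \<le> a" by (simp_all add: tw_speed_def)
  then show "0 < 1 - a\<^sup>2" "(1 - a\<^sup>2) * (q + C) = c" using qC c by simp_all
qed

lemma D_deriv: "(D has_real_derivative D' x) (at x)" by (rule dn_wave_has_real_derivative[OF L k])

lemma D'_deriv: "(D' has_real_derivative 2 * C * D x - 2 * (D x) ^ 3) (at x)"
  by (rule dn_wave'_has_real_derivative[OF L k])

lemma continuous_D: "continuous_on A D" "continuous_on A D'" "continuous_on A g"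
proof -
  show D: "continuous_on A D" by (rule DERIV_continuous_on[OF has_field_derivative_at_within[OF D_deriv]])
  show "continuous_on A D'" by (rule DERIV_continuous_on[OF has_field_derivative_at_within[OF D'_deriv]])
  show "continuous_on A g" unfolding tw_density_def[abs_def] by (intro continuous_intros D)
qed

lemma continuous_wavenumber: "continuous_on A \<Theta>'"
  unfolding tw_wavenumber_def[abs_def]
  by (intro continuous_intros continuous_D) (use density_bounds(3) in \<open>auto simp: less_imp_neq[symmetric]\<close>)

lemma phase_deriv: "(\<Theta> has_real_derivative \<Theta>' x) (at x)"
  unfolding tw_phase_def[abs_def] by (rule continuous_primitive[OF continuous_wavenumber])

lemma profile_deriv: "(R has_vector_derivative R' x) (at x)"
proof -
  define S where "S = (\<lambda>x. sqrt ((1 - a\<^sup>2) * g x))"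
  have pos: "0 < (1 - a\<^sup>2) * g x" by (rule mult_pos_pos[OF speed(3) density_bounds(3)])
  have dg: "((\<lambda>x. (1 - a\<^sup>2) * g x) has_real_derivative (1 - a\<^sup>2) * (2 * (D x * D' x))) (at x)"
    unfolding tw_density_def[abs_def] by (auto intro!: derivative_eq_intros D_deriv)
  have "(S has_real_derivative inverse (S x) / 2 * ((1 - a\<^sup>2) * (2 * (D x * D' x)))) (at x)"
    unfolding S_def by (rule DERIV_chain2[OF DERIV_real_sqrt[OF pos] dg])
  also have "inverse (S x) / 2 * ((1 - a\<^sup>2) * (2 * (D x * D' x))) = S x * (D x * D' x / g x)"
  proof -
    have "S x * S x = (1 - a\<^sup>2) * g x" using pos by (simp add: S_def)
    then have e: "1 - a\<^sup>2 = S x * S x / g x" using density_bounds(3)[of x] by (simp add: eq_divide_eq)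
    have "S x > 0" using pos by (simp add: S_def)
    then show ?thesis unfolding e by simp
  qed
  finally have S: "(S has_vector_derivative S x * (D x * D' x / g x)) (at x)"
    by (simp add: has_real_derivative_iff_has_vector_derivative)
  have cis: "((\<lambda>x. cis (\<Theta> x)) has_vector_derivative \<Theta>' x *\<^sub>R (\<i> * cis (\<Theta> x))) (at x)"
  proof -
    have "((\<lambda>z. exp (\<i> * z)) has_field_derivative \<i> * exp (\<i> * of_real (\<Theta> x))) (at (of_real (\<Theta> x)))"
      by (auto intro!: derivative_eq_intros)
    then have "((\<lambda>t. exp (\<i> * of_real t)) has_vector_derivative \<i> * exp (\<i> * of_real (\<Theta> x))) (at (\<Theta> x))"
      by (rule has_vector_derivative_real_field)
    then have "(cis has_vector_derivative \<i> * cis (\<Theta> x)) (at (\<Theta> x))" by (simp add: cis_conv_exp[abs_def])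
    from vector_diff_chain_at[OF phase_deriv[unfolded has_real_derivative_iff_has_vector_derivative] this]
    show ?thesis by (simp add: o_def)
  qed
  have "((\<lambda>x. S x *\<^sub>R cis (\<Theta> x)) has_vector_derivative
      S x *\<^sub>R (\<Theta>' x *\<^sub>R (\<i> * cis (\<Theta> x))) + (S x * (D x * D' x / g x)) *\<^sub>R cis (\<Theta> x)) (at x)"
    by (rule has_vector_derivative_scaleR[OF S[folded has_real_derivative_iff_has_vector_derivative] cis])
  moreover have "S x *\<^sub>R (\<Theta>' x *\<^sub>R (\<i> * cis (\<Theta> x))) + (S x * (D x * D' x / g x)) *\<^sub>R cis (\<Theta> x) = R' x"
  proof -
    have "R x = S x *\<^sub>R cis (\<Theta> x)" by (simp add: tw_profile_def S_def scaleR_conv_of_real)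
    then show ?thesis by (simp add: tw_profile'_def Complex_eq scaleR_conv_of_real algebra_simps)
  qed
  ultimately show ?thesis
    by (simp add: tw_profile_def[abs_def] S_def scaleR_conv_of_real)
qed

text \<open>With Z = R' / R the second-order equation becomes the Riccati equation Z' + Z^2 = 2
  (\<omega> + i a Z - D^2). Its imaginary part expresses that the current is constant; its real part
  reduces to a polynomial identity in s = D^2.\<close>

lemma profile'_deriv: "(R' has_vector_derivative 2 * (\<omega> * R x + \<i> * a * R' x - (D x)\<^sup>2 * R x)) (at x)"
proof -
  define X where "X = (\<lambda>x. D x * D' x / g x)"
  have gx: "g x \<noteq> 0" for x using density_bounds(3)[of x] by simp
  have dg: "(g has_real_derivative 2 * (D x * D' x)) (at x)"
    unfolding tw_density_def[abs_def] by (auto intro!: derivative_eq_intros D_deriv)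
  define X1 where "X1 = ((D' x)\<^sup>2 + D x * (2 * C * D x - 2 * (D x) ^ 3)) / g x - 2 * (X x)\<^sup>2"
  have dX: "(X has_real_derivative X1) (at x)"
  proof -
    have "(X has_real_derivative ((D' x * D' x + (2 * C * D x - 2 * (D x) ^ 3) * D x) * g x - D x * D' x * (2 * (D x * D' x))) / (g x * g x)) (at x)"
      unfolding X_def by (rule DERIV_divide[OF DERIV_mult[OF D_deriv D'_deriv] dg gx])
    also have "((D' x * D' x + (2 * C * D x - 2 * (D x) ^ 3) * D x) * g x - D x * D' x * (2 * (D x * D' x))) / (g x * g x) = X1"
      unfolding X1_def X_def using gx[of x] by (simp add: field_simps power2_eq_square)
    finally show ?thesis .
  qed
  define Y1 where "Y1 = 2 * (j / g x) * X x"
  have dY: "(\<Theta>' has_real_derivative Y1) (at x)"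
  proof -
    have "(\<Theta>' has_real_derivative 0 - (0 * g x - j * (2 * (D x * D' x))) / (g x * g x)) (at x)"
      unfolding tw_wavenumber_def[abs_def]
      by (rule DERIV_diff[OF DERIV_const DERIV_divide[OF DERIV_const dg gx]])
    then show ?thesis by (simp add: Y1_def X_def mult_ac)
  qed
  define Z where "Z = (\<lambda>x. Complex (X x) (\<Theta>' x))"
  have dZ: "(Z has_vector_derivative Complex X1 Y1) (at x)"
    unfolding has_vector_derivative_complex_iff Z_def using dX dY
    by (simp add: has_real_derivative_iff_has_vector_derivative)
  have R'Z: "R' = (\<lambda>x. R x * Z x)" by (rule ext) (simp add: tw_profile'_def Z_def X_def)
  have "((\<lambda>x. R x * Z x) has_vector_derivative R x * Complex X1 Y1 + R' x * Z x) (at x)"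
    by (rule has_vector_derivative_mult[OF profile_deriv dZ])
  moreover have "Complex X1 Y1 + Z x * Z x = 2 * (\<omega> + \<i> * a * Z x - (D x)\<^sup>2)"
  proof -
    define s where "s = (D x)\<^sup>2"
    define E where "E = \<eta>\<^sup>2"
    define F where "F = \<eta>\<^sup>2 * (1 - k\<^sup>2)"
    define P where "P = (D' x)\<^sup>2"
    define G where "G = g x"
    have P: "P = (E - s) * (s - F)" using dn_wave'_sq[OF L k, of x] by (simp add: P_def E_def F_def s_def eta_def)
    have j2: "j\<^sup>2 = - q * (q + E) * (q + F)" using flux_sq by (simp add: E_def F_def)
    have C: "2 * C = E + F" 
    proof -
      have "wave_speed_parameter L k = 2 * ((ellK k)\<^sup>2 / L\<^sup>2) * (2 - k\<^sup>2)" "\<eta>\<^sup>2 = 4 * ((ellK k)\<^sup>2 / L\<^sup>2)"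
        by (simp_all add: wave_speed_parameter_def eta_def power_divide power_mult_distrib)
      then show ?thesis unfolding E_def F_def by algebra
    qed
    have G: "G = q + s" "G \<noteq> 0" using gx[of x] by (simp_all add: G_def tw_density_def s_def)
    have X2: "(X x)\<^sup>2 = s * P / G\<^sup>2" by (simp add: X_def s_def P_def G_def power_divide power_mult_distrib)
    have X1': "X1 = (P + (2 * C) * s - 2 * s\<^sup>2) / G - 2 * (s * P / G\<^sup>2)"
      unfolding X1_def X2 by (simp add: P_def s_def G_def power2_eq_square power3_eq_cube algebra_simps)
    \<comment> \<open>The real part cleared of denominators; the value of j^2 is what makes the left
      side divisible by G^2.\<close>
    have key: "(P + (E + F) * s - 2 * s\<^sup>2) * G - s * P - j\<^sup>2 = (q + (E + F) - 2 * s) * G\<^sup>2"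
      unfolding P j2 G(1) by algebra
    have "(P + (E + F) * s - 2 * s\<^sup>2) / G - s * P / G\<^sup>2 - j\<^sup>2 / G\<^sup>2
       = ((P + (E + F) * s - 2 * s\<^sup>2) * G - s * P - j\<^sup>2) / G\<^sup>2"
      using G(2) by (simp add: field_simps power2_eq_square)
    also have "\<dots> = q + (E + F) - 2 * s" unfolding key using G(2) by simp
    finally have key': "(P + (E + F) * s - 2 * s\<^sup>2) / G - s * P / G\<^sup>2 - j\<^sup>2 / G\<^sup>2 = q + (E + F) - 2 * s" .
    have \<omega>: "2 * \<omega> = a\<^sup>2 + q + (E + F)" unfolding C[symmetric] by (simp add: tw_frequency_def)
    have Y: "\<Theta>' x = a - j / G" by (simp add: tw_wavenumber_def G_def)
    have Re: "X1 + (X x * X x - \<Theta>' x * \<Theta>' x) = 2 * \<omega> - 2 * a * \<Theta>' x - 2 * s"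
    proof -
      have "X1 + (X x)\<^sup>2 - (\<Theta>' x)\<^sup>2 = ((P + (E + F) * s - 2 * s\<^sup>2) / G - s * P / G\<^sup>2 - j\<^sup>2 / G\<^sup>2) - a\<^sup>2 + 2 * a * (j / G)"
        unfolding X1' X2 C Y by (simp add: power2_diff power_divide)
      also have "\<dots> = 2 * \<omega> - 2 * a * \<Theta>' x - 2 * s"
        unfolding key' \<omega> Y by (simp add: algebra_simps power2_eq_square)
      finally show ?thesis by (simp add: power2_eq_square)
    qed
    have Im: "Y1 + (X x * \<Theta>' x + \<Theta>' x * X x) = 2 * a * X x"
      unfolding Y1_def Y G_def[symmetric] by (simp add: algebra_simps)
    show ?thesis
      using Re Im by (simp add: complex_eq_iff Z_def s_def flip: of_real_power)
  qed
  then have "R x * (Complex X1 Y1 + Z x * Z x) = R x * (2 * (\<omega> + \<i> * a * Z x - (D x)\<^sup>2))" by simp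
  then have "R x * Complex X1 Y1 + R' x * Z x = 2 * (\<omega> * R x + \<i> * a * R' x - (D x)\<^sup>2 * R x)"
    unfolding R'Z by (simp add: algebra_simps)
  ultimately show ?thesis by (simp add: R'Z)
qed

lemma profile_norm_sq: "(cmod (R x))\<^sup>2 = (1 - a\<^sup>2) * g x"
  using speed(3) density_bounds(3)[of x] by (simp add: tw_profile_def norm_mult)

lemma D'_equation: "(a\<^sup>2 - 1) * (2 * C * D x - 2 * (D x) ^ 3) + (2 * c) * D x = 2 * (cmod (R x))\<^sup>2 * D x"
proof -
  have c2: "2 * c = 2 * ((1 - a\<^sup>2) * (q + C))" using speed(4) by simp
  show ?thesis unfolding profile_norm_sq tw_density_def c2 by algebra
qed

lemma wavenumber_bound: "\<bar>\<Theta>' x\<bar> \<le> a + j / (q + \<eta>\<^sup>2 * (1 - k\<^sup>2))"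
proof -
  have "j / g x \<le> j / (q + \<eta>\<^sup>2 * (1 - k\<^sup>2))"
    using density_bounds[of x] q(3) flux_sq(2) by (intro divide_left_mono mult_pos_pos) auto
  moreover have "0 \<le> j / g x" using flux_sq(2) density_bounds(3)[of x] by simp
  ultimately show ?thesis using speed(2) unfolding tw_wavenumber_def by linarith
qed

text \<open>The factor vanishes with speed and flux, so along the approximating waves the phase
  tends to 0 at every point and the profile becomes real in the limit.\<close>

lemma phase_bound: "\<bar>\<Theta> x\<bar> \<le> (a + j / (q + \<eta>\<^sup>2 * (1 - k\<^sup>2))) * \<bar>x\<bar>"
proof -
  have "norm (\<Theta> x - \<Theta> 0) \<le> (a + j / (q + \<eta>\<^sup>2 * (1 - k\<^sup>2))) * norm (x - 0)"
    by (rule field_differentiable_bound[of UNIV]) (use phase_deriv wavenumber_bound in auto)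
  then show ?thesis by (simp add: tw_phase_def zero_ereal_def[symmetric])
qed

lemma profile_bound: "cmod (R x) \<le> \<eta>"
proof (rule power2_le_imp_le)
  have "(1 - a\<^sup>2) * g x \<le> 1 * (q + \<eta>\<^sup>2)" using speed(3) density_bounds[of x] by (intro mult_mono) auto
  then show "(cmod (R x))\<^sup>2 \<le> \<eta>\<^sup>2" using q(1) by (simp add: profile_norm_sq)
qed (use eta_pos' in simp)

lemma profile'_bound:
  "cmod (R' x) \<le> \<eta> * (\<eta> ^ 3 / (q + \<eta>\<^sup>2 * (1 - k\<^sup>2)) + (a + j / (q + \<eta>\<^sup>2 * (1 - k\<^sup>2))))"
proof -
  have "\<bar>D x * D' x\<bar> \<le> \<eta> * \<eta>\<^sup>2"
    using dn_wave_pos[OF L k, of x] dn_wave_le[OF L k, of x] abs_dn_wave'_le[OF L k, of x] eta_pos'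
    unfolding abs_mult by (intro mult_mono) (auto simp: eta_def)
  then have "\<bar>D x * D' x / g x\<bar> \<le> \<eta> ^ 3 / (q + \<eta>\<^sup>2 * (1 - k\<^sup>2))"
    using density_bounds[of x] q(3) unfolding abs_divide
    by (intro frac_le) (auto simp: power3_eq_cube power2_eq_square)
  moreover have "cmod (Complex (D x * D' x / g x) (\<Theta>' x)) \<le> \<bar>D x * D' x / g x\<bar> + \<bar>\<Theta>' x\<bar>"
    using cmod_le[of "Complex (D x * D' x / g x) (\<Theta>' x)"] by simp
  ultimately have "cmod (Complex (D x * D' x / g x) (\<Theta>' x)) \<le> \<eta> ^ 3 / (q + \<eta>\<^sup>2 * (1 - k\<^sup>2)) + (a + j / (q + \<eta>\<^sup>2 * (1 - k\<^sup>2)))"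
    using wavenumber_bound[of x] by linarith
  then show ?thesis unfolding tw_profile'_def norm_mult
    using profile_bound[of x] eta_pos' by (intro mult_mono) auto
qed

text \<open>Used where the speed is 0: there the flux is positive and this integral cannot balance L
  a = 0.\<close>

lemma integral_flux_ge: "L * (j / (q + \<eta>\<^sup>2)) \<le> integral {0..L} (\<lambda>x. j / g x)"
proof -
  have "integral {0..L} (\<lambda>x. j / (q + \<eta>\<^sup>2)) \<le> integral {0..L} (\<lambda>x. j / g x)"
  proof (rule integral_le)
    have "g x \<noteq> 0" for x using density_bounds(3)[of x] by simp
    then show "(\<lambda>x. j / g x) integrable_on {0..L}"
      by (intro integrable_continuous_interval continuous_intros continuous_D) auto
    show "j / (q + \<eta>\<^sup>2) \<le> j / g x" for x
      using density_bounds[of x] flux_sq(2) by (intro divide_left_mono mult_pos_pos) auto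
  qed auto
  then show ?thesis using L by simp
qed

text \<open>The hypothesis says that \<open>\<Theta>'\<close> has mean 0 over a period, so that the
  phase itself, not merely exp (i \<Theta>), is periodic.\<close>

lemma phase_period:
  assumes "integral {0..L} (\<lambda>x. j / g x) = L * a"
  shows "\<Theta> (x + L) = \<Theta> x"
proof -
  have gp: "\<Theta>' (x + L) = \<Theta>' x" for x
    by (simp add: tw_wavenumber_def tw_density_def dn_wave_periodic[OF L k])
  have "\<Theta> (x + L) - \<Theta> x = \<Theta> (0 + L) - \<Theta> 0"
  proof (rule DERIV_isconst_all[rule_format, where f = "\<lambda>x. \<Theta> (x + L) - \<Theta> x"])
    show "((\<lambda>x. \<Theta> (x + L) - \<Theta> x) has_real_derivative 0) (at x)" for x
      using DERIV_diff[OF DERIV_shift[THEN iffD1, OF phase_deriv[of "x + L"]] phase_deriv[of x]] by (simp add: gp)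
  qed
  also have "\<Theta> (0 + L) - \<Theta> 0 = integral {0..L} \<Theta>'"
  proof -
    have "\<Theta> L = integral {0..L} \<Theta>'"
      using L unfolding tw_phase_def
      by (intro interval_integral_eq_integral borel_integrable_atLeastAtMost' continuous_wavenumber) auto
    then show ?thesis by (simp add: tw_phase_def zero_ereal_def[symmetric])
  qed
  also have "integral {0..L} \<Theta>' = integral {0..L} (\<lambda>x. a) - integral {0..L} (\<lambda>x. j / g x)"
    unfolding tw_wavenumber_def[abs_def]
  proof (rule integral_diff)
    have "g x \<noteq> 0" for x using density_bounds(3)[of x] by simp
    then show "(\<lambda>x. j / g x) integrable_on {0..L}"
      by (intro integrable_continuous_interval continuous_intros continuous_D) auto
  qed auto
  also have "\<dots> = 0" using assms L by simp
  finally show ?thesis by simp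
qed

lemma travelling:
  assumes per: "integral {0..L} (\<lambda>x. j / g x) = L * a" and m: "m\<^sup>2 = 2 * c"
  shows "travelling_profile L m a \<omega> R R' D D'"
proof
  have dD': "deriv D' x = 2 * C * D x - 2 * (D x) ^ 3" for x by (rule DERIV_imp_deriv[OF D'_deriv])
  show "\<exists>D2. (D' has_vector_derivative D2) (at x) \<and> (a\<^sup>2 - 1) * D2 + m\<^sup>2 * D x = 2 * (cmod (R x))\<^sup>2 * D x" for x
    using D'_deriv[of x] D'_equation[of x] unfolding m has_real_derivative_iff_has_vector_derivative by blast
  show "continuous_on UNIV (\<lambda>x. deriv D' x)"
    unfolding dD' by (intro continuous_intros continuous_D)
  have 1: "D (x + L) = D x" "D' (x + L) = D' x" "g (x + L) = g x" "\<Theta>' (x + L) = \<Theta>' x" for x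
    by (simp_all add: tw_wavenumber_def tw_density_def dn_wave_periodic[OF L k])
  have 2: "R (x + L) = R x" for x by (simp add: tw_profile_def phase_period[OF per] 1)
  have 3: "R' (x + L) = R' x" for x by (simp add: tw_profile'_def 1 2)
  have "x + 2 * L = x + L + L" for x by simp
  then show "R (x + 2 * L) = R x" "R' (x + 2 * L) = R' x" "D (x + 2 * L) = D x" "D' (x + 2 * L) = D' x" for x
    by (simp_all only: 1 2 3)
qed (use L D_deriv profile_deriv profile'_deriv in \<open>simp_all add: has_real_derivative_iff_has_vector_derivative\<close>)

end

text \<open>At the left end of the range of \<open>q\<close> the speed vanishes, at the right end the flux does.\<close>

lemma tw_parameters_exist:
  assumes L: "L > 0" and k: "0 \<le> k" "k < 1" and c: "c > 0"
    and C: "c < wave_speed_parameter L k" "wave_speed_parameter L k - c < (eta L k)\<^sup>2 * (1 - k\<^sup>2)"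
  obtains q where "tw_parameters L k c q" "c - wave_speed_parameter L k \<le> q" "0 < tw_speed L k c q"
    "integral {0..L} (\<lambda>x. tw_flux L k q / tw_density L k q x) = L * tw_speed L k c q"
proof -
  let ?C = "wave_speed_parameter L k"
  \<comment> \<open>On this interval speed and flux are real, and the upper bound on C - c keeps the
    density positive down to the left end.\<close>
  let ?Q = "{c - ?C..0}"
  have par: "tw_parameters L k c q" if "q \<in> ?Q" for q
    by unfold_locales (use that L k c C in auto)
  define H where "H = (\<lambda>q. integral {0..L} (\<lambda>x. tw_flux L k q / tw_density L k q x) - L * tw_speed L k c q)"
  have "continuous_on (?Q \<times> cbox 0 L) (\<lambda>(q, x). tw_flux L k q / tw_density L k q x)"
    unfolding split_beta
  proof (intro continuous_on_divide ballI)
    have "continuous_on UNIV (dn_wave L k)"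
      using tw_parameters.continuous_D(1)[OF par[of 0]] C by auto
    then have "continuous_on (?Q \<times> cbox 0 L) (\<lambda>z. dn_wave L k (snd z))"
      by (rule continuous_on_compose2) (auto intro!: continuous_intros)
    then show "continuous_on (?Q \<times> cbox 0 L) (\<lambda>z. tw_density L k (fst z) (snd z))"
      unfolding tw_density_def by (intro continuous_intros)
    show "continuous_on (?Q \<times> cbox 0 L) (\<lambda>z. tw_flux L k (fst z))"
      unfolding tw_flux_def by (intro continuous_intros)
    show "tw_density L k (fst z) (snd z) \<noteq> 0" if "z \<in> ?Q \<times> cbox 0 L" for z
      using tw_parameters.density_bounds(3)[OF par[of "fst z"], of "snd z"] that by auto
  qed
  then have "continuous_on ?Q (\<lambda>q. integral (cbox 0 L) (\<lambda>x. tw_flux L k q / tw_density L k q x))"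
    by (rule integral_continuous_on_param)
  moreover have "continuous_on ?Q (tw_speed L k c)"
    unfolding tw_speed_def[abs_def] by (intro continuous_intros) (use c in auto)
  ultimately have cont: "continuous_on ?Q H"
    unfolding H_def by (intro continuous_on_diff continuous_on_mult continuous_on_const) simp_all
  have left: "0 < L * (tw_flux L k (c - ?C) / ((c - ?C) + (eta L k)\<^sup>2))" "tw_speed L k c (c - ?C) = 0"
  proof -
    interpret tw_parameters L k c "c - ?C" using par C by auto
    have "(c - ?C) + (eta L k)\<^sup>2 > 0" using density_bounds[of 0] by linarith
    moreover from this have "tw_flux L k (c - ?C) > 0"
      unfolding tw_flux_def using C q(3) by (intro real_sqrt_gt_zero mult_pos_pos) auto
    ultimately show "0 < L * (tw_flux L k (c - ?C) / ((c - ?C) + (eta L k)\<^sup>2))" using L by simp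
    show "tw_speed L k c (c - ?C) = 0" using c by (simp add: tw_speed_def)
  qed
  have "0 \<le> H (c - ?C)"
    using left tw_parameters.integral_flux_ge[OF par[of "c - ?C"]] C by (simp add: H_def)
  moreover have "H 0 \<le> 0"
    using tw_parameters.speed(2)[OF par[of 0]] C L by (simp add: H_def tw_flux_def)
  ultimately obtain q where q: "q \<in> ?Q" "H q = 0"
    using IVT2'[of H 0 0 "c - ?C"] cont C by auto
  \<comment> \<open>The speed is 0 only at the left end, where the flux is positive and H cannot
    vanish. A positive speed is what makes the wave drift.\<close>
  have "tw_speed L k c q \<noteq> 0"
  proof
    assume 0: "tw_speed L k c q = 0"
    have "c / (q + ?C) = 1" using tw_parameters.speed(1)[OF par[OF q(1)]] 0 by simp
    then have "q = c - ?C" using c by (simp add: field_simps split: if_splits)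
    then show False using left tw_parameters.integral_flux_ge[OF par[OF q(1)]] q(2) 0 by (simp add: H_def)
  qed
  then show ?thesis
    using that[OF par[OF q(1)]] q tw_parameters.speed(2)[OF par[OF q(1)]] by (auto simp: H_def)
qed

subsection \<open>Instability\<close>

lemma tendsto_L2_norm:
  fixes f :: "nat \<Rightarrow> real \<Rightarrow> 'a::euclidean_space"
  assumes lim: "\<And>x. (\<lambda>n. f n x) \<longlonglongrightarrow> g x" and meas: "\<And>n. continuous_on UNIV (f n)" "continuous_on UNIV g"
    and bound: "\<And>n x. norm (f n x) \<le> M"
  shows "(\<lambda>n. L2_norm T (f n)) \<longlonglongrightarrow> L2_norm T g"
proof -
  have [measurable]: "f n \<in> borel_measurable borel" "g \<in> borel_measurable borel" for n
    using meas by (auto intro: borel_measurable_continuous_onI)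
  have "(\<lambda>n. LBINT x:{0..T}. (norm (f n x))\<^sup>2) \<longlonglongrightarrow> (LBINT x:{0..T}. (norm (g x))\<^sup>2)"
    unfolding set_lebesgue_integral_def
  proof (rule integral_dominated_convergence)
    show "integrable lborel (\<lambda>x. indicat_real {0..T} x *\<^sub>R M\<^sup>2)"
      using set_integrable_const_Icc[of T "M\<^sup>2"] by (simp add: set_integrable_def)
    show "AE x in lborel. (\<lambda>n. indicat_real {0..T} x *\<^sub>R (norm (f n x))\<^sup>2) \<longlonglongrightarrow> indicat_real {0..T} x *\<^sub>R (norm (g x))\<^sup>2"
      by (intro AE_I2 tendsto_intros lim)
    show "AE x in lborel. norm (indicat_real {0..T} x *\<^sub>R (norm (f n x))\<^sup>2) \<le> indicat_real {0..T} x *\<^sub>R M\<^sup>2" for n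
      using bound[of n] by (intro AE_I2) (auto simp: indicator_def intro!: power_mono)
  qed measurable
  then show ?thesis unfolding L2_norm_def by (intro tendsto_real_sqrt)
qed

lemma tendsto_real_bounded:
  fixes X :: "nat \<Rightarrow> real"
  assumes "X \<longlonglongrightarrow> l"
  obtains K where "\<And>n. \<bar>X n\<bar> \<le> K"
proof -
  have "Bseq X" using assms by (intro convergent_imp_Bseq) (auto simp: convergent_def)
  then obtain K where "\<forall>n. norm (X n) \<le> K" by (rule BseqE)
  then show ?thesis by (intro that[of K]) simp
qed

lemma L2_norm_0: "L2_norm T (\<lambda>x. 0) = 0"
  by (simp add: L2_norm_def set_lebesgue_integral_def)

lemma H1_norm_nonneg: "0 \<le> H1_norm T f" by (simp add: H1_norm_def)

lemma L2_norm_le_H1_norm: "L2_norm T f \<le> H1_norm T f"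
  unfolding H1_norm_def by (rule real_le_rsqrt) simp

lemma Y_dist_components:
  "H1_norm (2*L) (\<lambda>x. u x - u' x) \<le> Y_dist L (u, v, w) (u', v', w')"
  "H1_norm (2*L) (\<lambda>x. v x - v' x) \<le> Y_dist L (u, v, w) (u', v', w')"
  "L2_norm (2*L) (\<lambda>x. w x - w' x) \<le> Y_dist L (u, v, w) (u', v', w')"
  by (auto simp: Y_dist_def intro!: real_le_rsqrt)

section \<open>Approximation of \<phi>_c by slow waves and the contradiction\<close>

locale dnoidal =
  fixes L c :: real
  assumes L: "L > 0" and c: "c > pi\<^sup>2 / L\<^sup>2"
begin

definition "k = dnoidal_modulus L c"

abbreviation "\<phi> \<equiv> dn_wave L k"
abbreviation "\<phi>' \<equiv> dn_wave' L k"

lemma k: "0 < k" "k < 1" "0 \<le> k" "wave_speed_parameter L k = c"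
  using dnoidal_modulus[OF L c] by (simp_all add: k_def)

lemma c_pos: "c > 0"
proof -
  have "0 \<le> pi\<^sup>2 / L\<^sup>2" by simp
  then show ?thesis using c by linarith
qed

lemma phi_deriv: "(\<phi> has_vector_derivative \<phi>' x) (at x)"
  using dn_wave_has_real_derivative[OF L k(3,2)] by (simp add: has_real_derivative_iff_has_vector_derivative)

lemma continuous_phi: "continuous_on A \<phi>" "continuous_on A \<phi>'"
proof -
  show "continuous_on A \<phi>"
    by (rule DERIV_continuous_on[OF has_field_derivative_at_within[OF dn_wave_has_real_derivative[OF L k(3,2)]]])
  show "continuous_on A \<phi>'"
    by (rule DERIV_continuous_on[OF has_field_derivative_at_within[OF dn_wave'_has_real_derivative[OF L k(3,2)]]])
qed

lemma phi_periodic: "\<phi> (x + 2 * L) = \<phi> x" "\<phi>' (x + 2 * L) = \<phi>' x"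
proof -
  have *: "x + 2 * L = x + L + L" by simp
  show "\<phi> (x + 2 * L) = \<phi> x" "\<phi>' (x + 2 * L) = \<phi>' x"
    unfolding * dn_wave_periodic[OF L k(3,2)] by simp_all
qed

lemma phi_bounds: "\<bar>\<phi> x\<bar> \<le> eta L k" "\<bar>\<phi>' x\<bar> \<le> (eta L k)\<^sup>2"
  using dn_wave_pos[OF L k(3,2), of x] dn_wave_le[OF L k(3,2), of x] abs_dn_wave'_le[OF L k(3,2), of x]
  by (auto simp: eta_def)

lemma approximating_parameters:
  obtains \<kappa> q where "\<And>n. tw_parameters L (\<kappa> n) c (q n)" "\<And>n. 0 < tw_speed L (\<kappa> n) c (q n)"
    "\<And>n. integral {0..L} (\<lambda>x. tw_flux L (\<kappa> n) (q n) / tw_density L (\<kappa> n) (q n) x) = L * tw_speed L (\<kappa> n) c (q n)"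
    "\<kappa> \<longlonglongrightarrow> k" "q \<longlonglongrightarrow> 0"
proof -
  \<comment> \<open>Moduli above k, so that monotonicity gives C > c; the denominator n + 2 keeps
    them below 1 already at n = 0.\<close>
  define \<kappa>0 where "\<kappa>0 = (\<lambda>n. k + (1 - k) / real (n + 2))"
  have 0: "k < \<kappa>0 n" "\<kappa>0 n < 1" "0 \<le> \<kappa>0 n" for n
  proof -
    define y where "y = (1 - k) / real (n + 2)"
    have "0 < y" using k by (simp add: y_def)
    moreover have "y \<le> (1 - k) / 2" unfolding y_def using k by (intro divide_left_mono) auto
    moreover have "\<kappa>0 n = k + y" by (simp add: \<kappa>0_def y_def)
    ultimately show "k < \<kappa>0 n" "\<kappa>0 n < 1" "0 \<le> \<kappa>0 n" using k(1,2) by auto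
  qed
  have lim0: "\<kappa>0 \<longlonglongrightarrow> k"
  proof -
    have "(\<lambda>n. (1 - k) / real (n + 2)) \<longlonglongrightarrow> 0"
      by (rule LIMSEQ_ignore_initial_segment[OF lim_const_over_n])
    from tendsto_add[OF tendsto_const[of k] this] show ?thesis by (simp add: \<kappa>0_def)
  qed
  have "(\<lambda>n. (eta L (\<kappa>0 n))\<^sup>2 * (1 - (\<kappa>0 n)\<^sup>2) - (wave_speed_parameter L (\<kappa>0 n) - c)) \<longlonglongrightarrow>
      (eta L k)\<^sup>2 * (1 - k\<^sup>2) - (wave_speed_parameter L k - c)"
    unfolding eta_def divide_inverse
    by (intro tendsto_intros tendsto_ellK tendsto_wave_speed_parameter lim0 k 0)
  moreover have "0 < (eta L k)\<^sup>2 * (1 - k\<^sup>2) - (wave_speed_parameter L k - c)"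
  proof -
    have "0 < (eta L k)\<^sup>2 * (1 - k\<^sup>2)"
      using modulus_sq_less_1[OF k(3,2)] eta_pos[OF L k(3,2)]
      by (intro mult_pos_pos zero_less_power) (simp_all add: eta_def)
    then show ?thesis by (simp add: k(4))
  qed
  ultimately have "\<forall>\<^sub>F n in sequentially. 0 < (eta L (\<kappa>0 n))\<^sup>2 * (1 - (\<kappa>0 n)\<^sup>2) - (wave_speed_parameter L (\<kappa>0 n) - c)"
    by (rule order_tendstoD(1))
  then obtain N where N: "\<And>n. n \<ge> N \<Longrightarrow> wave_speed_parameter L (\<kappa>0 n) - c < (eta L (\<kappa>0 n))\<^sup>2 * (1 - (\<kappa>0 n)\<^sup>2)"
    unfolding eventually_sequentially by force
  \<comment> \<open>The bound on C - c holds only from \<open>N\<close> on, being obtained from its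
    strict form in the limit; dropping an initial segment makes it hold for every index.\<close>
  define \<kappa> where "\<kappa> = (\<lambda>n. \<kappa>0 (n + N))"
  note \<kappa> = 0[of "_ + N", folded \<kappa>_def]
  have lim: "\<kappa> \<longlonglongrightarrow> k" unfolding \<kappa>_def by (rule LIMSEQ_ignore_initial_segment[OF lim0])
  have "\<exists>q. tw_parameters L (\<kappa> n) c q \<and> c - wave_speed_parameter L (\<kappa> n) \<le> q \<and> 0 < tw_speed L (\<kappa> n) c q \<and>
    integral {0..L} (\<lambda>x. tw_flux L (\<kappa> n) q / tw_density L (\<kappa> n) q x) = L * tw_speed L (\<kappa> n) c q" for n
  proof -
    have "0 \<le> \<kappa> n" "\<kappa> n < 1" "k < \<kappa> n" using 0[of "n + N"] by (auto simp: \<kappa>_def)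
    moreover have "c < wave_speed_parameter L (\<kappa> n)"
      using wave_speed_parameter_strict_mono[OF L k(3), of "\<kappa> n"] calculation k(4) by simp
    moreover have "wave_speed_parameter L (\<kappa> n) - c < (eta L (\<kappa> n))\<^sup>2 * (1 - (\<kappa> n)\<^sup>2)"
      using N[of "n + N"] by (simp add: \<kappa>_def)
    ultimately show ?thesis using tw_parameters_exist[OF L _ _ c_pos, of "\<kappa> n"] by metis
  qed
  then obtain q where q: "\<And>n. tw_parameters L (\<kappa> n) c (q n)" "\<And>n. c - wave_speed_parameter L (\<kappa> n) \<le> q n"
    "\<And>n. 0 < tw_speed L (\<kappa> n) c (q n)"
    "\<And>n. integral {0..L} (\<lambda>x. tw_flux L (\<kappa> n) (q n) / tw_density L (\<kappa> n) (q n) x) = L * tw_speed L (\<kappa> n) c (q n)"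
    by metis
  \<comment> \<open>q is squeezed between c - C and 0, and C tends to c by continuity in the
    modulus.\<close>
  have "q \<longlonglongrightarrow> 0"
  proof (rule tendsto_sandwich)
    have "(\<lambda>n. c - wave_speed_parameter L (\<kappa> n)) \<longlonglongrightarrow> c - wave_speed_parameter L k"
      using 0 by (intro tendsto_intros tendsto_wave_speed_parameter lim k) (auto simp: \<kappa>_def)
    then show "(\<lambda>n. c - wave_speed_parameter L (\<kappa> n)) \<longlonglongrightarrow> 0" by (simp add: k(4))
    show "\<forall>\<^sub>F n in sequentially. q n \<le> 0" using tw_parameters.q(1)[OF q(1)] by simp
  qed (use q in auto)
  then show ?thesis using that q lim by blast
qed

text \<open>Pointwise limits together with bounds uniform in n and x, so that dominated convergence
  applies. The first five give convergence of the initial data; the last, used with h = L / 2, gives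
  the distance produced by the drift.\<close>

lemma convergence:
  fixes \<kappa> q :: "nat \<Rightarrow> real"
  assumes par: "\<And>n. tw_parameters L (\<kappa> n) c (q n)" and lim: "\<kappa> \<longlonglongrightarrow> k" "q \<longlonglongrightarrow> 0"
  shows "(\<lambda>n. L2_norm T (\<lambda>x. tw_profile L (\<kappa> n) c (q n) x - of_real (\<phi> x))) \<longlonglongrightarrow> 0"
    and "(\<lambda>n. L2_norm T (\<lambda>x. tw_profile' L (\<kappa> n) c (q n) x - of_real (\<phi>' x))) \<longlonglongrightarrow> 0"
    and "(\<lambda>n. L2_norm T (\<lambda>x. dn_wave L (\<kappa> n) x - \<phi> x)) \<longlonglongrightarrow> 0"
    and "(\<lambda>n. L2_norm T (\<lambda>x. dn_wave' L (\<kappa> n) x - \<phi>' x)) \<longlonglongrightarrow> 0"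
    and "(\<lambda>n. L2_norm T (\<lambda>x. - tw_speed L (\<kappa> n) c (q n) * dn_wave' L (\<kappa> n) x - 0)) \<longlonglongrightarrow> 0"
    and "(\<lambda>n. L2_norm T (\<lambda>x. dn_wave L (\<kappa> n) (x - h) - \<phi> x)) \<longlonglongrightarrow> L2_norm T (\<lambda>x. \<phi> (x - h) - \<phi> x)"
proof -
  have \<kappa>: "0 \<le> \<kappa> n" "\<kappa> n < 1" for n using tw_parameters.k[OF par] by auto
  note lims = lim k(3) k(2) \<kappa>
  let ?\<eta> = "\<lambda>n. eta L (\<kappa> n)" and ?a = "\<lambda>n. tw_speed L (\<kappa> n) c (q n)" and ?j = "\<lambda>n. tw_flux L (\<kappa> n) (q n)"
  let ?\<gamma> = "\<lambda>n. q n + (?\<eta> n)\<^sup>2 * (1 - (\<kappa> n)\<^sup>2)"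
  let ?\<delta> = "\<lambda>n. ?a n + ?j n / ?\<gamma> n"
  have \<eta>: "?\<eta> \<longlonglongrightarrow> eta L k" unfolding eta_def divide_inverse
    by (intro tendsto_intros tendsto_ellK lims)
  have C: "(\<lambda>n. wave_speed_parameter L (\<kappa> n)) \<longlonglongrightarrow> c"
    using tendsto_wave_speed_parameter[OF lim(1) k(3) k(2) \<kappa>, of L] by (simp add: k(4))
  have "?a \<longlonglongrightarrow> sqrt (1 - c / (0 + c))"
    unfolding tw_speed_def by (intro tendsto_intros lim C) (use c_pos in simp)
  then have a: "?a \<longlonglongrightarrow> 0" using c_pos by simp
  have "?j \<longlonglongrightarrow> sqrt (- 0 * (0 + (eta L k)\<^sup>2) * (0 + (eta L k)\<^sup>2 * (1 - k\<^sup>2)))"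
    unfolding tw_flux_def by (intro tendsto_intros lim \<eta>)
  then have j: "?j \<longlonglongrightarrow> 0" by simp
  \<comment> \<open>The lower bound of the density stays away from 0 in the limit, which keeps all
    quotients convergent.\<close>
  have \<gamma>0: "0 + (eta L k)\<^sup>2 * (1 - k\<^sup>2) \<noteq> 0"
    using modulus_sq_less_1[OF k(3,2)] ellK_pos[OF k(3,2)] L by (simp add: eta_def)
  have "?\<delta> \<longlonglongrightarrow> 0 + 0 / (0 + (eta L k)\<^sup>2 * (1 - k\<^sup>2))" by (intro tendsto_intros a j lim \<eta> \<gamma>0)
  then have \<delta>: "?\<delta> \<longlonglongrightarrow> 0" by simp
  note D = tendsto_dn_wave[OF lim(1) k(3) k(2) \<kappa>, of L]
  have \<phi>0: "0 + (\<phi> x)\<^sup>2 \<noteq> 0" "0 \<le> \<phi> x" for x using dn_wave_pos[OF L k(3,2), of x] by auto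
  have g: "(\<lambda>n. tw_density L (\<kappa> n) (q n) x) \<longlonglongrightarrow> 0 + (\<phi> x)\<^sup>2" for x
    unfolding tw_density_def by (intro tendsto_intros lim D)
  have \<Theta>: "(\<lambda>n. tw_phase L (\<kappa> n) c (q n) x) \<longlonglongrightarrow> 0" for x
  proof (rule Lim_null_comparison)
    show "\<forall>\<^sub>F n in sequentially. norm (tw_phase L (\<kappa> n) c (q n) x) \<le> ?\<delta> n * \<bar>x\<bar>"
      using tw_parameters.phase_bound[OF par] by simp
    have "(\<lambda>n. ?\<delta> n * \<bar>x\<bar>) \<longlonglongrightarrow> 0 * \<bar>x\<bar>" by (intro tendsto_mult \<delta> tendsto_const)
    then show "(\<lambda>n. ?\<delta> n * \<bar>x\<bar>) \<longlonglongrightarrow> 0" by simp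
  qed
  have R: "(\<lambda>n. tw_profile L (\<kappa> n) c (q n) x) \<longlonglongrightarrow> of_real (\<phi> x)" for x
  proof -
    have "(\<lambda>n. tw_profile L (\<kappa> n) c (q n) x) \<longlonglongrightarrow> of_real (sqrt ((1 - 0\<^sup>2) * (0 + (\<phi> x)\<^sup>2))) * cis 0"
      unfolding tw_profile_def by (intro tendsto_intros tendsto_mult a g \<Theta> tendsto_of_real tendsto_cis)
    then show ?thesis using \<phi>0(2)[of x] by simp
  qed
  have R': "(\<lambda>n. tw_profile' L (\<kappa> n) c (q n) x) \<longlonglongrightarrow> of_real (\<phi>' x)" for x
  proof -
    have "(\<lambda>n. tw_profile' L (\<kappa> n) c (q n) x) \<longlonglongrightarrow>
        of_real (\<phi> x) * Complex (\<phi> x * \<phi>' x / (0 + (\<phi> x)\<^sup>2)) (0 - 0 / (0 + (\<phi> x)\<^sup>2))"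
      unfolding tw_profile'_def tw_wavenumber_def
      by (intro tendsto_intros R D g a j \<phi>0)
    moreover have "of_real (\<phi> x) * Complex (\<phi> x * \<phi>' x / (0 + (\<phi> x)\<^sup>2)) (0 - 0 / (0 + (\<phi> x)\<^sup>2)) = complex_of_real (\<phi>' x)"
      using \<phi>0(1)[of x] by (simp add: complex_eq_iff power2_eq_square)
    ultimately show ?thesis by simp
  qed
  obtain K1 where K1: "\<bar>?\<eta> n\<bar> \<le> K1" for n
    using tendsto_real_bounded[OF \<eta>] by blast
  have "(\<lambda>n. ?\<eta> n * ((?\<eta> n) ^ 3 / ?\<gamma> n + ?\<delta> n)) \<longlonglongrightarrow> eta L k * ((eta L k) ^ 3 / (0 + (eta L k)\<^sup>2 * (1 - k\<^sup>2)) + 0)"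
    by (intro tendsto_intros \<eta> lim \<delta> \<gamma>0)
  from tendsto_real_bounded[OF this] obtain K2 where K2: "\<bar>?\<eta> n * ((?\<eta> n) ^ 3 / ?\<gamma> n + ?\<delta> n)\<bar> \<le> K2" for n
    by blast
  have D1: "\<bar>dn_wave L (\<kappa> n) x\<bar> \<le> K1" "\<bar>dn_wave' L (\<kappa> n) x\<bar> \<le> K1\<^sup>2" for n x
  proof -
    have "0 < eta L (\<kappa> n)" using eta_pos[OF L \<kappa>, of n] by (simp add: eta_def)
    then show "\<bar>dn_wave L (\<kappa> n) x\<bar> \<le> K1"
      using dn_wave_pos[OF L \<kappa>, of n x] dn_wave_le[OF L \<kappa>, of n x, folded eta_def] K1[of n] by linarith
    have "\<bar>dn_wave' L (\<kappa> n) x\<bar> \<le> (eta L (\<kappa> n))\<^sup>2" using abs_dn_wave'_le[OF L \<kappa>, of n x] by (simp add: eta_def)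
    also have "\<dots> \<le> K1\<^sup>2" using K1[of n] by (intro power2_le_iff_abs_le[THEN iffD2]) auto
    finally show "\<bar>dn_wave' L (\<kappa> n) x\<bar> \<le> K1\<^sup>2" .
  qed
  have cD: "continuous_on UNIV (dn_wave L (\<kappa> n))" "continuous_on UNIV (dn_wave' L (\<kappa> n))" for n
    by (rule tw_parameters.continuous_D[OF par])+
  have cR: "continuous_on UNIV (tw_profile L (\<kappa> n) c (q n))" for n
    by (rule continuous_on_vector_derivative[OF has_vector_derivative_at_within[OF tw_parameters.profile_deriv[OF par]]])
  have cR': "continuous_on UNIV (tw_profile' L (\<kappa> n) c (q n))" for n
    by (rule continuous_on_vector_derivative[OF has_vector_derivative_at_within[OF tw_parameters.profile'_deriv[OF par]]])
  have phi_norm: "norm (complex_of_real (\<phi> x)) \<le> eta L k" "norm (complex_of_real (\<phi>' x)) \<le> (eta L k)\<^sup>2"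
      "norm (\<phi> x) \<le> eta L k" "norm (\<phi>' x) \<le> (eta L k)\<^sup>2" for x
    using phi_bounds[of x] by simp_all
  have zero: "(\<lambda>n. L2_norm T (\<lambda>x. f n x - f0 x)) \<longlonglongrightarrow> 0"
    if "\<And>x. (\<lambda>n. f n x) \<longlonglongrightarrow> f0 x" "\<And>n. continuous_on UNIV (f n)" "continuous_on UNIV f0"
      "\<And>n x. norm (f n x) \<le> M1" "\<And>x. norm (f0 x) \<le> M2"
    for f :: "nat \<Rightarrow> real \<Rightarrow> 'a::euclidean_space" and f0 M1 M2
  proof -
    have "(\<lambda>n. L2_norm T (\<lambda>x. f n x - f0 x)) \<longlonglongrightarrow> L2_norm T (\<lambda>x. f0 x - f0 x)"
      by (rule tendsto_L2_norm[where M = "M1 + M2"])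
        (intro tendsto_diff tendsto_const continuous_on_diff order_trans[OF norm_triangle_ineq4 add_mono] that)+
    then show ?thesis by (simp add: L2_norm_0)
  qed
  have bR: "norm (tw_profile L (\<kappa> n) c (q n) x) \<le> K1" for n x
    using tw_parameters.profile_bound[OF par, of n x] K1[of n] by linarith
  show "(\<lambda>n. L2_norm T (\<lambda>x. tw_profile L (\<kappa> n) c (q n) x - of_real (\<phi> x))) \<longlonglongrightarrow> 0"
    by (rule zero[OF R cR _ bR phi_norm(1)]) (intro continuous_intros continuous_phi)
  have bR': "norm (tw_profile' L (\<kappa> n) c (q n) x) \<le> K2" for n x
    using tw_parameters.profile'_bound[OF par, of n x] K2[of n] by linarith
  show "(\<lambda>n. L2_norm T (\<lambda>x. tw_profile' L (\<kappa> n) c (q n) x - of_real (\<phi>' x))) \<longlonglongrightarrow> 0"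
    by (rule zero[OF R' cR' _ bR' phi_norm(2)]) (intro continuous_intros continuous_phi)
  show "(\<lambda>n. L2_norm T (\<lambda>x. dn_wave L (\<kappa> n) x - \<phi> x)) \<longlonglongrightarrow> 0"
    by (rule zero[OF D(1) cD(1) continuous_phi(1) _ phi_norm(3)]) (unfold real_norm_def, rule D1(1))
  show "(\<lambda>n. L2_norm T (\<lambda>x. dn_wave' L (\<kappa> n) x - \<phi>' x)) \<longlonglongrightarrow> 0"
    by (rule zero[OF D(2) cD(2) continuous_phi(2) _ phi_norm(4)]) (unfold real_norm_def, rule D1(2))
  obtain K3 where K3: "\<bar>?a n\<bar> \<le> K3" for n
    using tendsto_real_bounded[OF a] by blast
  have aD: "\<bar>- ?a n * dn_wave' L (\<kappa> n) x\<bar> \<le> K3 * K1\<^sup>2" for n x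
    using K3[of n] D1(2)[of n x] by (auto simp: abs_mult intro!: mult_mono)
  have "(\<lambda>n. - ?a n * dn_wave' L (\<kappa> n) x) \<longlonglongrightarrow> - 0 * \<phi>' x" for x by (intro tendsto_intros a D)
  then have lim_aD: "(\<lambda>n. - ?a n * dn_wave' L (\<kappa> n) x) \<longlonglongrightarrow> 0" for x by simp
  show "(\<lambda>n. L2_norm T (\<lambda>x. - ?a n * dn_wave' L (\<kappa> n) x - 0)) \<longlonglongrightarrow> 0"
  proof (rule zero[OF lim_aD])
    show "norm (- ?a n * dn_wave' L (\<kappa> n) x) \<le> K3 * K1\<^sup>2" for n x unfolding real_norm_def by (rule aD)
    show "norm (0::real) \<le> 0" by simp
  qed (intro continuous_intros cD)+
  show "(\<lambda>n. L2_norm T (\<lambda>x. dn_wave L (\<kappa> n) (x - h) - \<phi> x)) \<longlonglongrightarrow> L2_norm T (\<lambda>x. \<phi> (x - h) - \<phi> x)"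
  proof (rule tendsto_L2_norm)
    have "\<bar>dn_wave L (\<kappa> n) (x - h) - \<phi> x\<bar> \<le> K1 + eta L k" for n x
      using D1(1)[of n "x - h"] phi_bounds(1)[of x] by linarith
    then show "norm (dn_wave L (\<kappa> n) (x - h) - \<phi> x) \<le> K1 + eta L k" for n x by simp
    have s: "continuous_on UNIV (\<lambda>x. f (x - h))" if "continuous_on UNIV f" for f :: "real \<Rightarrow> real"
      using that by (rule continuous_on_compose2) (auto intro!: continuous_intros)
    show "continuous_on UNIV (\<lambda>x. dn_wave L (\<kappa> n) (x - h) - \<phi> x)" "continuous_on UNIV (\<lambda>x. \<phi> (x - h) - \<phi> x)" for n
      by (intro continuous_on_diff s cD continuous_phi)+
  qed (intro tendsto_intros D)
qed

text \<open>At x = L / 2 the integrand compares the values of \<phi> at 0 and L / 2, which differ;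
  being continuous and nonnegative, it then has a positive integral.\<close>

lemma half_shift_distance_pos: "0 < L2_norm (2 * L) (\<lambda>x. \<phi> (x - L / 2) - \<phi> x)"
proof (rule ccontr)
  let ?f = "\<lambda>x. (norm (\<phi> (x - L / 2) - \<phi> x))\<^sup>2"
  assume "\<not> ?thesis"
  then have "L2_norm (2 * L) (\<lambda>x. \<phi> (x - L / 2) - \<phi> x) = 0"
    using L2_norm_nonneg[of "2 * L" "\<lambda>x. \<phi> (x - L / 2) - \<phi> x"] by linarith
  then have 0: "(LBINT x:{0..2*L}. ?f x) = 0" using L2_norm_sq[of "2*L" "\<lambda>x. \<phi> (x - L / 2) - \<phi> x"] by simp
  have "continuous_on UNIV (\<lambda>x. \<phi> (x - L / 2))"
    by (rule continuous_on_compose2[OF continuous_phi(1)[of UNIV]]) (auto intro!: continuous_intros)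
  then have cont: "continuous_on A ?f" for A
    by (intro continuous_intros continuous_phi) (auto intro: continuous_on_subset)
  have i: "set_integrable lborel {0..2*L} ?f" by (rule borel_integrable_atLeastAtMost'[OF cont])
  have "?f (L / 2) = 0"
  proof (rule has_integral_0_cbox_imp_0[where f = ?f and a = 0 and b = "2 * L"])
    show "(?f has_integral 0) (cbox 0 (2 * L))"
      using set_borel_integral_eq_integral[OF i] 0 by (simp add: has_integral_iff)
  qed (use L cont in \<open>auto simp: box_real\<close>)
  then show False using dn_wave_half_period[OF L k(3,2) k(1)] by simp
qed

lemma unstable:
  assumes m: "m\<^sup>2 = 2 * c"
  shows "orbitally_unstable L m ((\<lambda>x. complex_of_real (\<phi> x)), \<phi>, (\<lambda>x. 0))"
proof
  let ?\<Phi> = "((\<lambda>x. complex_of_real (\<phi> x)), \<phi>, (\<lambda>x. 0)) :: state"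
  let ?T = "2 * L"
  have T: "?T > 0" using L by simp
  assume stable: "orbitally_stable L m ?\<Phi>"
  \<comment> \<open>The limiting distance of the drifted waves from \<phi>. Stability is refuted at
    half of it, which the drifted wave exceeds for all large n.\<close>
  define d0 where "d0 = L2_norm ?T (\<lambda>x. \<phi> (x - L / 2) - \<phi> x)"
  have d0: "d0 > 0" using half_shift_distance_pos by (simp add: d0_def)
  obtain \<delta> where \<delta>: "\<delta> > 0" and st: "\<And>z0. z0 \<in> Y_space L \<Longrightarrow> Y_dist L z0 ?\<Phi> < \<delta> \<Longrightarrow>
      \<exists>z. global_solution L m z0 z \<and> (SUP t\<in>{0..}. INF s. ennreal (Y_dist L (z t) (phase s ?\<Phi>))) < ennreal (d0 / 2)"
    using stable d0 unfolding orbitally_stable_def by (metis half_gt_zero)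
  obtain \<kappa> q where par: "\<And>n. tw_parameters L (\<kappa> n) c (q n)" and sp: "\<And>n. 0 < tw_speed L (\<kappa> n) c (q n)"
    and per: "\<And>n. integral {0..L} (\<lambda>x. tw_flux L (\<kappa> n) (q n) / tw_density L (\<kappa> n) (q n) x) = L * tw_speed L (\<kappa> n) c (q n)"
    and lim: "\<kappa> \<longlonglongrightarrow> k" "q \<longlonglongrightarrow> 0"
    by (rule approximating_parameters) (rule that)
  note conv = convergence[OF par lim]
  define z0 where "z0 = (\<lambda>n. (tw_profile L (\<kappa> n) c (q n), dn_wave L (\<kappa> n), \<lambda>x. - tw_speed L (\<kappa> n) c (q n) * dn_wave' L (\<kappa> n) x))"
  have tp: "travelling_profile L m (tw_speed L (\<kappa> n) c (q n)) (tw_frequency L (\<kappa> n) c (q n)) (tw_profile L (\<kappa> n) c (q n))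
      (tw_profile' L (\<kappa> n) c (q n)) (dn_wave L (\<kappa> n)) (dn_wave' L (\<kappa> n))" for n
    by (rule tw_parameters.travelling[OF par per m])
  have dist: "Y_dist L (z0 n) ?\<Phi> = sqrt (((L2_norm ?T (\<lambda>x. tw_profile L (\<kappa> n) c (q n) x - of_real (\<phi> x)))\<^sup>2
        + (L2_norm ?T (\<lambda>x. tw_profile' L (\<kappa> n) c (q n) x - of_real (\<phi>' x)))\<^sup>2)
      + ((L2_norm ?T (\<lambda>x. dn_wave L (\<kappa> n) x - \<phi> x))\<^sup>2 + (L2_norm ?T (\<lambda>x. dn_wave' L (\<kappa> n) x - \<phi>' x))\<^sup>2)
      + (L2_norm ?T (\<lambda>x. - tw_speed L (\<kappa> n) c (q n) * dn_wave' L (\<kappa> n) x - 0))\<^sup>2)" for n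
  proof -
    interpret P: travelling_profile L m "tw_speed L (\<kappa> n) c (q n)" "tw_frequency L (\<kappa> n) c (q n)" "tw_profile L (\<kappa> n) c (q n)"
      "tw_profile' L (\<kappa> n) c (q n)" "dn_wave L (\<kappa> n)" "dn_wave' L (\<kappa> n)" by (rule tp)
    have phi: "((\<lambda>x. complex_of_real (\<phi> x)) has_vector_derivative of_real (\<phi>' x)) (at x)" for x
      by (rule has_vector_derivative_of_real[OF dn_wave_has_real_derivative[OF L k(3,2)]])
    have 1: "(H1_norm ?T (\<lambda>x. tw_profile L (\<kappa> n) c (q n) x - of_real (\<phi> x)))\<^sup>2
      = (L2_norm ?T (\<lambda>x. tw_profile L (\<kappa> n) c (q n) x - of_real (\<phi> x)))\<^sup>2 + (L2_norm ?T (\<lambda>x. tw_profile' L (\<kappa> n) c (q n) x - of_real (\<phi>' x)))\<^sup>2"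
      by (rule C1_periodic_H1(5)[OF T has_vector_derivative_diff[OF P.R phi]])
        (auto intro!: continuous_intros P.continuous continuous_phi simp: P.per phi_periodic)
    have 2: "(H1_norm ?T (\<lambda>x. dn_wave L (\<kappa> n) x - \<phi> x))\<^sup>2
      = (L2_norm ?T (\<lambda>x. dn_wave L (\<kappa> n) x - \<phi> x))\<^sup>2 + (L2_norm ?T (\<lambda>x. dn_wave' L (\<kappa> n) x - \<phi>' x))\<^sup>2"
      by (rule C1_periodic_H1(5)[OF T has_vector_derivative_diff[OF P.D phi_deriv]])
        (auto intro!: continuous_intros P.continuous continuous_phi simp: P.per phi_periodic)
    show ?thesis unfolding z0_def Y_dist_def state_diff.simps Y_norm.simps 1 2 ..
  qed
  have "(\<lambda>n. Y_dist L (z0 n) ?\<Phi>) \<longlonglongrightarrow> sqrt ((0\<^sup>2 + 0\<^sup>2) + (0\<^sup>2 + 0\<^sup>2) + 0\<^sup>2)"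
    unfolding dist by (intro tendsto_intros conv)
  then have "(\<lambda>n. Y_dist L (z0 n) ?\<Phi>) \<longlonglongrightarrow> 0" by simp
  then have ev1: "\<forall>\<^sub>F n in sequentially. Y_dist L (z0 n) ?\<Phi> < \<delta>" using \<delta> by (rule order_tendstoD(2))
  have ev2: "\<forall>\<^sub>F n in sequentially. d0 / 2 < L2_norm ?T (\<lambda>x. dn_wave L (\<kappa> n) (x - L / 2) - \<phi> x)"
    by (rule order_tendstoD(1)[OF conv(6)]) (use d0 in \<open>simp add: d0_def\<close>)
  obtain n where n: "Y_dist L (z0 n) ?\<Phi> < \<delta>" "d0 / 2 < L2_norm ?T (\<lambda>x. dn_wave L (\<kappa> n) (x - L / 2) - \<phi> x)"
    using eventually_happens[OF eventually_conj[OF ev1 ev2]] by auto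
  interpret Q: tw_parameters L "\<kappa> n" c "q n" by (rule par)
  interpret P: travelling_profile L m "tw_speed L (\<kappa> n) c (q n)" "tw_frequency L (\<kappa> n) c (q n)" "tw_profile L (\<kappa> n) c (q n)"
    "tw_profile' L (\<kappa> n) c (q n)" "dn_wave L (\<kappa> n)" "dn_wave' L (\<kappa> n)" by (rule tp)
  have z0: "z0 n = (P.u 0, P.v 0, P.w 0)" by (simp add: z0_def P.u_def[abs_def] P.v_def[abs_def] P.w_def[abs_def])
  have "z0 n \<in> Y_space L" unfolding z0 Y_space_def using P.uv_H1 by auto
  from st[OF this n(1)] obtain z where sol: "global_solution L m (z0 n) z"
    and sup: "(SUP t\<in>{0..}. INF s. ennreal (Y_dist L (z t) (phase s ?\<Phi>))) < ennreal (d0 / 2)" by blast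
  define u where "u = (\<lambda>t. fst (z t))"
  define v where "v = (\<lambda>t. fst (snd (z t)))"
  define w where "w = (\<lambda>t. snd (snd (z t)))"
  have z: "z t = (u t, v t, w t)" for t by (simp add: u_def v_def w_def)
  have Y: "u t \<in> H1_per ?T" "v t \<in> H1_per ?T" "w t \<in> L2_per ?T" for t
    using sol unfolding global_solution_def Y_space_def by (auto simp: z)
  have sys: "system_at L m u v w t" for t
    using sol unfolding global_solution_def u_def v_def w_def by blast
  have init: "Y_dist L (u 0, v 0, w 0) (P.u 0, P.v 0, P.w 0) = 0"
    using sol unfolding global_solution_def z z0 by blast
  \<comment> \<open>The phase s varies with t; this is harmless, since phases change neither the
    modulus of u nor v.\<close>
  have close: "\<exists>s. Y_dist L (u t, v t, w t) ((\<lambda>x. cis s * of_real (\<phi> x)), \<phi>, (\<lambda>x. 0)) < d0 / 2" if "0 \<le> t" for t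
  proof -
    have "(INF s. ennreal (Y_dist L (z t) (phase s ?\<Phi>))) \<le> (SUP t\<in>{0..}. INF s. ennreal (Y_dist L (z t) (phase s ?\<Phi>)))"
      using that by (intro SUP_upper) simp
    then have "(INF s. ennreal (Y_dist L (z t) (phase s ?\<Phi>))) < ennreal (d0 / 2)" using sup by (rule le_less_trans)
    then obtain s where "ennreal (Y_dist L (z t) (phase s ?\<Phi>)) < ennreal (d0 / 2)" by (auto simp: INF_less_iff)
    moreover have "0 \<le> Y_dist L (z t) (phase s ?\<Phi>)" by (simp add: z Y_dist_def)
    ultimately show ?thesis by (auto simp: ennreal_less_iff z)
  qed
  \<comment> \<open>Sobolev bound for differences of H^1 norm below d0 / 2. Adding the amplitudes of
    \<phi> and of the explicit wave bounds both solutions by one \<open>B\<close>.\<close>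
  define b where "b = 2 / sqrt ?T * (1 + ?T\<^sup>2 + (d0 / 2)\<^sup>2)"
  define B where "B = b + eta L k + eta L (\<kappa> n)"
  have b: "0 \<le> b" using T by (simp add: b_def)
  have eta: "0 < eta L k" using eta_pos[OF L k(3,2)] by (simp add: eta_def)
  have sobolev: "AE x in lborel. x \<in> {0..?T} \<longrightarrow> norm (f x) \<le> b"
    if "f \<in> H1_per ?T" "H1_norm ?T f < d0 / 2" for f :: "real \<Rightarrow> 'a::euclidean_space"
  proof -
    have "2 / sqrt ?T * (1 + ?T\<^sup>2 + (H1_norm ?T f)\<^sup>2) \<le> b"
      unfolding b_def using that(2) H1_norm_nonneg[of ?T f] T
      by (intro mult_left_mono add_left_mono power_mono) auto
    then show ?thesis using H1_bounded[OF T that(1)] by (auto elim!: eventually_mono)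
  qed
  interpret S: two_solutions L m B u P.u v P.v w P.w
  proof
    show "m \<noteq> 0" using m c_pos by auto
    fix t :: real
    show "u t \<in> H1_per ?T" "v t \<in> H1_per ?T" "system_at L m u v w t" by (rule Y sys)+
    show "P.u t \<in> H1_per ?T" "P.v t \<in> H1_per ?T" by (rule P.uv_H1)+
    show "system_at L m P.u P.v P.w t" by (rule P.system)
    assume "0 \<le> t"
    then obtain s where s: "Y_dist L (u t, v t, w t) ((\<lambda>x. cis s * of_real (\<phi> x)), \<phi>, (\<lambda>x. 0)) < d0 / 2"
      using close by blast
    have phi_H1: "(\<lambda>x. cis s * complex_of_real (\<phi> x)) \<in> H1_per ?T" "\<phi> \<in> H1_per ?T"
    proof -
      have "((\<lambda>x. cis s * complex_of_real (\<phi> x)) has_vector_derivative cis s * of_real (\<phi>' x)) (at x)" for x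
        by (intro has_vector_derivative_mult_right has_vector_derivative_of_real dn_wave_has_real_derivative L k)
      then show "(\<lambda>x. cis s * complex_of_real (\<phi> x)) \<in> H1_per ?T"
        by (rule C1_periodic_H1(4)[OF T]) (auto intro!: continuous_intros continuous_phi simp: phi_periodic)
      show "\<phi> \<in> H1_per ?T"
        by (rule C1_periodic_H1(4)[OF T phi_deriv]) (auto intro!: continuous_phi simp: phi_periodic)
    qed
    have 1: "AE x in lborel. x \<in> {0..?T} \<longrightarrow> norm (u t x - cis s * of_real (\<phi> x)) \<le> b"
      by (intro sobolev H1_per_diff Y phi_H1 le_less_trans[OF Y_dist_components(1) s])
    have 2: "AE x in lborel. x \<in> {0..?T} \<longrightarrow> norm (v t x - \<phi> x) \<le> b"
      by (intro sobolev H1_per_diff Y phi_H1 le_less_trans[OF Y_dist_components(2) s])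
    show "AE x in lborel. x \<in> {0..2 * L} \<longrightarrow> cmod (u t x) \<le> B \<and> cmod (P.u t x) \<le> B \<and> \<bar>v t x\<bar> \<le> B \<and> \<bar>P.v t x\<bar> \<le> B"
      using 1 2
    proof eventually_elim
      case (elim x)
      show ?case
      proof (intro impI conjI)
        assume x: "x \<in> {0..2 * L}"
        have "cmod (cis s * of_real (\<phi> x)) \<le> eta L k" using phi_bounds(1)[of x] by (simp add: norm_mult)
        then show "cmod (u t x) \<le> B"
          using elim(1) x norm_triangle_sub[of "u t x" "cis s * of_real (\<phi> x)"] Q.eta_pos' unfolding B_def by auto
        show "\<bar>v t x\<bar> \<le> B"
          using elim(2) x phi_bounds(1)[of x] Q.eta_pos' unfolding B_def by auto
        show "cmod (P.u t x) \<le> B"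
          using Q.profile_bound[of "x - tw_speed L (\<kappa> n) c (q n) * t"] b eta unfolding B_def P.u_def by (simp add: norm_mult)
        show "\<bar>P.v t x\<bar> \<le> B"
          using dn_wave_pos[OF L Q.k, of "x - tw_speed L (\<kappa> n) c (q n) * t"] dn_wave_le[OF L Q.k, of "x - tw_speed L (\<kappa> n) c (q n) * t"]
            b eta unfolding B_def P.v_def eta_def by simp
      qed
    qed
  next
    have zero: "fcoef ?T f i = fcoef ?T g i"
      if "f \<in> L2_per ?T" "g \<in> L2_per ?T" "L2_norm ?T (\<lambda>x. f x - g x) \<le> 0" for f g :: "real \<Rightarrow> 'a::euclidean_space" and i
    proof -
      have "L2_norm ?T (\<lambda>x. f x - g x) = 0" using that(3) L2_norm_nonneg[of ?T "\<lambda>x. f x - g x"] by linarith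
      then have "fcoef ?T (\<lambda>x. f x - g x) i = 0"
        using bessel[OF T L2_per_diff[OF that(1,2)], of "{i}"] by simp
      then show ?thesis by (simp add: fcoef_diff[OF T L2_per_integrable[OF that(1)] L2_per_integrable[OF that(2)]])
    qed
    \<comment> \<open>The distance of the data is 0, so each component agrees in L^2 and therefore
      in every Fourier coefficient.\<close>
    note e = Y_dist_components[where L = L and u = "u 0" and v = "v 0" and w = "w 0" and u' = "P.u 0" and v' = "P.v 0" and w' = "P.w 0", unfolded init]
    have L2: "u 0 \<in> L2_per ?T" "P.u 0 \<in> L2_per ?T" "v 0 \<in> L2_per ?T" "P.v 0 \<in> L2_per ?T"
      using Y P.uv_H1 by (auto simp: H1_per_def)
    show "fcoef ?T (u 0) i = fcoef ?T (P.u 0) i" for i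
      by (rule zero[OF L2(1,2) order_trans[OF L2_norm_le_H1_norm e(1)]])
    show "fcoef ?T (v 0) i = fcoef ?T (P.v 0) i" for i
      by (rule zero[OF L2(3,4) order_trans[OF L2_norm_le_H1_norm e(2)]])
    show "fcoef ?T (w 0) i = fcoef ?T (P.w 0) i" for i
      by (rule zero[OF Y(3) P.uv_H1(3) e(3)])
  qed (rule L)
  \<comment> \<open>The time at which the explicit wave has moved by half a period, finite because
    its speed is positive.\<close>
  define t where "t = L / (2 * tw_speed L (\<kappa> n) c (q n))"
  have t: "0 \<le> t" "tw_speed L (\<kappa> n) c (q n) * t = L / 2" using L sp[of n] by (auto simp: t_def)
  have "AE x in lborel. x \<in> {0..?T} \<longrightarrow> v t x = dn_wave L (\<kappa> n) (x - L / 2)"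
    using S.unique[OF t(1)] unfolding P.v_def t(2) .
  moreover have "v t \<in> borel_measurable borel" using Y(2)[of t] by (auto simp: H1_per_def intro: L2_perD)
  moreover have "(\<lambda>x. dn_wave L (\<kappa> n) (x - L / 2)) \<in> borel_measurable borel"
    by (intro borel_measurable_continuous_onI continuous_on_compose2[OF Q.continuous_D(1)[of UNIV]]) (auto intro!: continuous_intros)
  moreover have "\<phi> \<in> borel_measurable borel" by (intro borel_measurable_continuous_onI continuous_phi)
  ultimately have "L2_norm ?T (\<lambda>x. v t x - \<phi> x) = L2_norm ?T (\<lambda>x. dn_wave L (\<kappa> n) (x - L / 2) - \<phi> x)"
    unfolding L2_norm_def set_lebesgue_integral_def
    by (intro arg_cong[where f = sqrt] integral_cong_AE) (auto elim!: eventually_mono simp: indicator_def)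
  \<comment> \<open>Phases do not act on the second component, so whatever s is, the distance bounds
    v - \<phi> from above.\<close>
  moreover obtain s where "Y_dist L (u t, v t, w t) ((\<lambda>x. cis s * of_real (\<phi> x)), \<phi>, (\<lambda>x. 0)) < d0 / 2"
    using close[OF t(1)] by blast
  then have "L2_norm ?T (\<lambda>x. v t x - \<phi> x) < d0 / 2"
    using order_trans[OF L2_norm_le_H1_norm Y_dist_components(2)] by (rule le_less_trans[rotated])
  ultimately show False using n(2) by simp
qed

end

theorem theorem3p4:
  fixes L c m :: real
  assumes "L > 0" and "c > pi\<^sup>2 / L\<^sup>2" and "m\<^sup>2 = 2 * c"
  shows "orbitally_unstable L m
           ((\<lambda>x. complex_of_real (dnoidal_wave L c x)), dnoidal_wave L c, (\<lambda>x. 0))"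
proof -
  interpret dnoidal L c by unfold_locales (use assms in auto)
  show ?thesis unfolding dnoidal_wave_eq k_def[symmetric] by (rule unstable[OF assms(3)])
qed

end
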